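(* Let $\Omega$ be a big and nef class on a compact Kähler manifold $(X,\omega_K)$ of complex dimension $n$ whose automorphism group is trivial, and suppose that there is a constant $\eta$ with (i) $0\le\eta<\frac{n+1}{n}\alpha_\beta(\Omega)$; (ii) $C_1(X,D)<\eta\,\Omega$; (iii) $\Big(-n\frac{C_1(X,D)\cdot\Omega^{n-1}}{\Omega^n}+\eta\Big)\Omega+(n-1)C_1(X,D)>0$. Let $\omega_{\varphi_\epsilon}=\omega_\epsilon+i\partial\bar\partial\varphi_\epsilon$, $\omega_\epsilon=\omega_{sr}+\epsilon\omega_K$, for small $\epsilon>0$, be the diagonal sequence of approximate cscK metrics in $\Omega_\epsilon=\Omega+\epsilon[\omega_K]$, i.e. smooth Kähler metrics solving $$\omega_{\varphi_\epsilon}^n=e^{F_\epsilon}\omega_{\theta_\epsilon}^n,\qquad \Delta_{\varphi_\epsilon}F_\epsilon=\mathrm{tr}_{\omega_{\varphi_\epsilon}}\theta-\underline S_{\beta,\epsilon}.$$ Then $\Omega$ admits a singular cscK metric on $X$.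
   Context: **Setting.** $D\subset X$ is a smooth hypersurface with line bundle $L_D$, defining section $s$, smooth Hermitian metric $h$, $\Theta_D=-i\partial\bar\partial\log h\in C_1(L_D)$, $0<\beta\le1$; standing assumption $C_1(L_D)\ge0$ ($h$ chosen with $\Theta_D\ge0$). Chern classes are normalised so that $C_1(X)$ is the class of Ricci forms; $C_1(X,D)=C_1(X)-(1-\beta)C_1(L_D)$ and $\theta\in C_1(X,D)$ is a fixed smooth closed $(1,1)$-form. For real $(1,1)$-classes, $A>0$ means $A$ is a Kähler class and $A<B$ means $B-A>0$. $\Omega$ is nef if $\Omega+t[\omega_K]$ is Kähler for all $t>0$, and big if it contains a closed positive current $T\ge t\omega_K$ for some $t>0$. $\omega_{sr}$ is a fixed smooth closed $(1,1)$-form in $\Omega$; $PSH(X,\omega_{sr})$ is the set of $\omega_{sr}$-plurisubharmonic functions. The log alpha invariant of a big class is $$\alpha_\beta(\Omega)=\sup\Big\{\alpha>0:\ \exists C,\ \sup_{\varphi\in PSH(X,\omega_{sr})}\int_Xe^{-\alpha(\varphi-\sup_X\varphi)}|s|_h^{2\beta-2}\omega_K^n\le C\Big\}.$$ **Reference metrics.** Let $\mu$ be a smooth positive volume form with $-i\partial\bar\partial\log\mu=\theta+(1-\beta)\Theta_D$. $\omega_{\theta_\epsilon}$ is the smooth Kähler metric in $\Omega_\epsilon$ with $\omega_{\theta_\epsilon}^n=e^{c_\epsilon}(|s|_h^2+\epsilon)^{\beta-1}\mu$, $c_\epsilon$ being the constant normalising the volume. $\underline S_{\beta,\epsilon}=n\frac{C_1(X,D)\cdot\Omega_\epsilon^{n-1}}{\Omega_\epsilon^n}$.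 $\Delta_\varphi u=g_\varphi^{i\bar j}u_{i\bar j}$. **Definition.** $\omega_\varphi=\omega_{sr}+i\partial\bar\partial\varphi$ is a singular cscK metric in the big class $\Omega=[\omega_{sr}]$ if $\varphi\in PSH(X,\omega_{sr})$ and $\varphi$ is an $L^1(X)$-limit of a sequence of smooth cscK potentials. Here "smooth cscK potentials" are smooth potentials $\varphi_{\epsilon_i}$, $\epsilon_i\to0$, of smooth Kähler metrics $\omega_{\varphi_{\epsilon_i}}=\omega_{sr}+\epsilon_i\omega_K+i\partial\bar\partial\varphi_{\epsilon_i}$ in the classes $\Omega_{\epsilon_i}=\Omega+\epsilon_i[\omega_K]$ which, together with smooth functions $F_{\epsilon_i}$, solve the system $$\omega_{\varphi_{\epsilon_i}}^n=e^{F_{\epsilon_i}}\omega_{\theta_{\epsilon_i}}^n,\qquad \Delta_{\varphi_{\epsilon_i}}F_{\epsilon_i}=\mathrm{tr}_{\omega_{\varphi_{\epsilon_i}}}\theta-\underline S_{\beta,\epsilon_i}.$$ *)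

theory Defs
  imports "HOL-Analysis.Analysis"
begin

section \<open>Smooth and holomorphic functions on open sets of complex n-space\<close>

primrec iter_deriv ::
  "'v::real_normed_vector list \<Rightarrow> ('v \<Rightarrow> 'b::real_normed_vector) \<Rightarrow> 'v \<Rightarrow> 'b" where
  "iter_deriv [] f = f"
| "iter_deriv (v # vs) f = (\<lambda>x. frechet_derivative (iter_deriv vs f) (at x) v)"

text \<open>Used for open sets only.\<close>

definition smooth_on ::
  "'v::real_normed_vector set \<Rightarrow> ('v \<Rightarrow> 'b::real_normed_vector) \<Rightarrow> bool" where
  "smooth_on S f \<longleftrightarrow> (\<forall>vs. \<forall>x\<in>S. iter_deriv vs f differentiable (at x))"

definition hol_on :: "(complex^'n) set \<Rightarrow> (complex^'n \<Rightarrow> complex) \<Rightarrow> bool" where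
  "hol_on S f \<longleftrightarrow>
     (\<forall>z\<in>S. \<exists>f'. (f has_derivative f') (at z) \<and> (\<forall>a v. f' (a *s v) = a * f' v))"

definition hol_map_on :: "(complex^'n) set \<Rightarrow> (complex^'n \<Rightarrow> complex^'m) \<Rightarrow> bool" where
  "hol_map_on S f \<longleftrightarrow> (\<forall>j. hol_on S (\<lambda>z. f z $ j))"

definition dz :: "'n \<Rightarrow> (complex^'n \<Rightarrow> complex) \<Rightarrow> complex^'n \<Rightarrow> complex" where
  "dz j f z = (frechet_derivative f (at z) (axis j 1)
                 - \<i> * frechet_derivative f (at z) (axis j \<i>)) / 2"

definition dzbar :: "'n \<Rightarrow> (complex^'n \<Rightarrow> complex) \<Rightarrow> complex^'n \<Rightarrow> complex" where
  "dzbar j f z = (frechet_derivative f (at z) (axis j 1)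
                    + \<i> * frechet_derivative f (at z) (axis j \<i>)) / 2"

definition complex_hessian :: "(complex^'n \<Rightarrow> real) \<Rightarrow> complex^'n \<Rightarrow> complex^'n^'n" where
  "complex_hessian f z = (\<chi> j k. dz j (dzbar k (\<lambda>w. complex_of_real (f w))) z)"


section \<open>Compact complex manifolds\<close>

text \<open>The manifold is the whole type \<open>'a\<close>, its dimension is \<open>CARD('n)\<close>, and its complex
  structure is given by a holomorphic atlas.  A chart is a pair of a domain and a coordinate map;
  the values of the coordinate map outside the domain are irrelevant.\<close>

type_synonym ('a, 'n) chart = "'a set \<times> ('a \<Rightarrow> complex^'n)"

definition cinv :: "('a, 'n::finite) chart \<Rightarrow> complex^'n \<Rightarrow> 'a" where
  "cinv c = inv_into (fst c) (snd c)"

definition compact_complex_manifold :: "('a::t2_space, 'n::finite) chart set \<Rightarrow> bool" where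
  "compact_complex_manifold A \<longleftrightarrow>
     compact (UNIV :: 'a set) \<and> connected (UNIV :: 'a set) \<and>
     (\<Union>c\<in>A. fst c) = UNIV \<and>
     (\<forall>c\<in>A. open (fst c) \<and> open (snd c ` fst c) \<and>
        homeomorphism (fst c) (snd c ` fst c) (snd c) (cinv c)) \<and>
     (\<forall>c\<in>A. \<forall>d\<in>A. hol_map_on (snd c ` (fst c \<inter> fst d)) (snd d \<circ> cinv c))"

definition smooth_fun_on :: "('a, 'n::finite) chart set \<Rightarrow> 'a set \<Rightarrow> ('a \<Rightarrow> real) \<Rightarrow> bool" where
  "smooth_fun_on A W f \<longleftrightarrow> (\<forall>c\<in>A. smooth_on (snd c ` (fst c \<inter> W)) (f \<circ> cinv c))"

definition hol_fun_on :: "('a, 'n::finite) chart set \<Rightarrow> 'a set \<Rightarrow> ('a \<Rightarrow> complex) \<Rightarrow> bool" where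
  "hol_fun_on A W f \<longleftrightarrow> (\<forall>c\<in>A. hol_on (snd c ` (fst c \<inter> W)) (f \<circ> cinv c))"

definition automorphism :: "('a::t2_space, 'n::finite) chart set \<Rightarrow> ('a \<Rightarrow> 'a) \<Rightarrow> bool" where
  "automorphism A f \<longleftrightarrow>
     homeomorphism UNIV UNIV f (inv f) \<and>
     (\<forall>g\<in>{f, inv f}. \<forall>c\<in>A. \<forall>d\<in>A.
        hol_map_on (snd c ` (fst c \<inter> g -` fst d)) (snd d \<circ> g \<circ> cinv c))"


section \<open>Differential forms\<close>

text \<open>A real \<open>k\<close>-form is the family of its coordinate expressions: \<open>\<omega> c p [v\<^sub>1, \<dots>, v\<^sub>k]\<close> is its
  value at \<open>p\<close> on the tangent vectors that have coordinates \<open>v\<^sub>1, \<dots>, v\<^sub>k\<close> in the chart \<open>c\<close>.  It is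
  \<open>0\<close> on meaningless arguments, so that equality of forms is equality of functions.\<close>

type_synonym ('a, 'n) form = "('a, 'n) chart \<Rightarrow> 'a \<Rightarrow> (complex^'n) list \<Rightarrow> real"

definition transition_deriv ::
  "('a, 'n::finite) chart \<Rightarrow> ('a, 'n) chart \<Rightarrow> 'a \<Rightarrow> complex^'n \<Rightarrow> complex^'n" where
  "transition_deriv c d p = frechet_derivative (snd d \<circ> cinv c) (at (snd c p))"

definition smooth_form ::
  "('a, 'n::finite) chart set \<Rightarrow> nat \<Rightarrow> ('a, 'n) form \<Rightarrow> bool" where
  "smooth_form A k \<omega> \<longleftrightarrow>
     (\<forall>c p vs. c \<notin> A \<or> p \<notin> fst c \<or> length vs \<noteq> k \<longrightarrow> \<omega> c p vs = 0) \<and>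
     (\<forall>c\<in>A. \<forall>p\<in>fst c. \<forall>vs. length vs = k \<longrightarrow>
        (\<forall>i<k. linear (\<lambda>v. \<omega> c p (vs[i := v]))) \<and>
        (\<forall>i j. i < j \<and> j < k \<and> vs ! i = vs ! j \<longrightarrow> \<omega> c p vs = 0)) \<and>
     (\<forall>c\<in>A. \<forall>d\<in>A. \<forall>p\<in>fst c \<inter> fst d. \<forall>vs. length vs = k \<longrightarrow>
        \<omega> c p vs = \<omega> d p (map (transition_deriv c d p) vs)) \<and>
     (\<forall>c\<in>A. \<forall>vs. length vs = k \<longrightarrow> smooth_on (snd c ` fst c) (\<lambda>x. \<omega> c (cinv c x) vs))"

definition form_lin ::
  "real \<Rightarrow> ('a, 'n::finite) form \<Rightarrow> real \<Rightarrow> ('a, 'n) form \<Rightarrow> ('a, 'n) form" where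
  "form_lin a \<omega> b \<eta> = (\<lambda>c p vs. a * \<omega> c p vs + b * \<eta> c p vs)"

definition ext_d :: "('a, 'n::finite) chart set \<Rightarrow> ('a, 'n) form \<Rightarrow> ('a, 'n) form" where
  "ext_d A \<omega> = (\<lambda>c p vs. if c \<in> A \<and> p \<in> fst c then
     (\<Sum>i<length vs. (-1) ^ i *
        frechet_derivative (\<lambda>x. \<omega> c (cinv c x) (take i vs @ drop (Suc i) vs))
          (at (snd c p)) (vs ! i)) else 0)"

text \<open>\<open>wedge k l\<close> is the wedge product of a \<open>k\<close>-form and an \<open>l\<close>-form, normalised so that
  \<open>(dx \<and> dy)(\<partial>\<^sub>x, \<partial>\<^sub>y) = 1\<close>.\<close>

definition wedge :: "nat \<Rightarrow> nat \<Rightarrow> ('a, 'n::finite) form \<Rightarrow> ('a, 'n) form \<Rightarrow> ('a, 'n) form" where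
  "wedge k l \<omega> \<eta> = (\<lambda>c p vs. if length vs = k + l then
     (\<Sum>\<sigma> | \<sigma> permutes {..<k + l}. of_int (sign \<sigma>) *
        \<omega> c p (map (\<lambda>i. vs ! \<sigma> i) [0..<k]) * \<eta> c p (map (\<lambda>i. vs ! \<sigma> i) [k..<k + l]))
       / (fact k * fact l) else 0)"

primrec wpow :: "('a, 'n::finite) chart set \<Rightarrow> ('a, 'n) form \<Rightarrow> nat \<Rightarrow> ('a, 'n) form" where
  "wpow A \<omega> 0 = (\<lambda>c p vs. if c \<in> A \<and> p \<in> fst c \<and> vs = [] then 1 else 0)"
| "wpow A \<omega> (Suc m) = wedge 2 (2 * m) \<omega> (wpow A \<omega> m)"

text \<open>A real form of degree \<open>2p\<close> has type \<open>(p,p)\<close> iff it is invariant under these rotations,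
  since \<open>rotate_form a\<close> multiplies the \<open>(r,s)\<close>-part by \<open>a ^ r * cnj a ^ s\<close>.\<close>

definition rotate_form :: "complex \<Rightarrow> ('a, 'n::finite) form \<Rightarrow> ('a, 'n) form" where
  "rotate_form a \<omega> = (\<lambda>c p vs. \<omega> c p (map ((*s) a) vs))"

definition rotation_invariant :: "('a, 'n::finite) form \<Rightarrow> bool" where
  "rotation_invariant \<omega> \<longleftrightarrow> (\<forall>a. norm a = 1 \<longrightarrow> rotate_form a \<omega> = \<omega>)"

definition closed11 :: "('a, 'n::finite) chart set \<Rightarrow> ('a, 'n) form \<Rightarrow> bool" where
  "closed11 A \<omega> \<longleftrightarrow>
     smooth_form A 2 \<omega> \<and> rotation_invariant \<omega> \<and> ext_d A \<omega> = (\<lambda>_ _ _. 0)"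

text \<open>The coefficients \<open>g\<^sub>j\<^sub>k\<close> of the real (1,1)-form \<open>\<omega> = i \<Sum> g\<^sub>j\<^sub>k dz\<^sub>j \<and> d(cnj z\<^sub>k)\<close>, that is,
  \<open>g\<^sub>j\<^sub>k = -i \<omega>(\<partial>/\<partial>z\<^sub>j, \<partial>/\<partial>(cnj z\<^sub>k))\<close>; by the type of \<open>\<omega>\<close> the four terms of
  the complex bilinear expansion combine to two.\<close>

definition coeffs :: "('a, 'n::finite) form \<Rightarrow> ('a, 'n) chart \<Rightarrow> 'a \<Rightarrow> complex^'n^'n" where
  "coeffs \<omega> c p = (\<chi> j k. (complex_of_real (\<omega> c p [axis j 1, axis k \<i>])
                              - \<i> * complex_of_real (\<omega> c p [axis j 1, axis k 1])) / 2)"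

text \<open>\<open>i \<partial>\<partial>bar f\<close>, evaluated on a pair of real tangent vectors.\<close>

definition idd :: "('a, 'n::finite) chart set \<Rightarrow> ('a \<Rightarrow> real) \<Rightarrow> ('a, 'n) form" where
  "idd A f = (\<lambda>c p vs. if c \<in> A \<and> p \<in> fst c \<and> length vs = 2 then
     Re (\<i> * (\<Sum>j\<in>UNIV. \<Sum>k\<in>UNIV. complex_hessian (f \<circ> cinv c) (snd c p) $ j $ k *
           ((vs ! 0) $ j * cnj ((vs ! 1) $ k) - (vs ! 1) $ j * cnj ((vs ! 0) $ k)))) else 0)"

definition semipositive :: "('a, 'n::finite) chart set \<Rightarrow> ('a, 'n) form \<Rightarrow> bool" where
  "semipositive A \<omega> \<longleftrightarrow> (\<forall>c\<in>A. \<forall>p\<in>fst c. \<forall>v. \<omega> c p [v, \<i> *s v] \<ge> 0)"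

definition kahler_form :: "('a, 'n::finite) chart set \<Rightarrow> ('a, 'n) form \<Rightarrow> bool" where
  "kahler_form A \<omega> \<longleftrightarrow>
     closed11 A \<omega> \<and> (\<forall>c\<in>A. \<forall>p\<in>fst c. \<forall>v. v \<noteq> 0 \<longrightarrow> \<omega> c p [v, \<i> *s v] > 0)"


section \<open>Integration of top-degree forms\<close>

text \<open>An oriented frame \<open>e\<^sub>1, i e\<^sub>1, e\<^sub>2, i e\<^sub>2, \<dots>\<close> of complex n-space.  The value of a
  top-degree form on it does not depend on the chosen enumeration of the coordinates.\<close>

definition frame :: "(complex^'n::finite) list" where
  "frame = concat (map (\<lambda>j. [axis j 1, axis j \<i>]) (SOME js. distinct js \<and> set js = UNIV))"

definition density :: "('a, 'n::finite) form \<Rightarrow> ('a, 'n) chart \<Rightarrow> 'a \<Rightarrow> real" where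
  "density \<tau> c p = \<tau> c p frame"

text \<open>The measure given by the absolute value of a top-degree form.\<close>

definition form_measure ::
  "('a::t2_space, 'n::finite) chart set \<Rightarrow> ('a, 'n) form \<Rightarrow> 'a measure" where
  "form_measure A \<tau> = (THE M. sets M = sets borel \<and>
     (\<forall>c\<in>A. \<forall>B\<in>sets borel. B \<subseteq> fst c \<longrightarrow>
        emeasure M B = (\<integral>\<^sup>+x\<in>snd c ` B. ennreal \<bar>density \<tau> c (cinv c x)\<bar> \<partial>lborel)))"

text \<open>The integral of a top-degree form.  The sign of its density is the same in all charts,
  because holomorphic coordinate changes preserve the orientation.\<close>

definition form_integral ::
  "('a::t2_space, 'n::finite) chart set \<Rightarrow> ('a, 'n) form \<Rightarrow> real" where
  "form_integral A \<tau> =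
     (\<integral>p. sgn (density \<tau> (SOME c. c \<in> A \<and> p \<in> fst c) p) \<partial>form_measure A \<tau>)"


section \<open>Classes of real (1,1)-forms\<close>

definition cohomologous ::
  "('a, 'n::finite) chart set \<Rightarrow> ('a, 'n) form \<Rightarrow> ('a, 'n) form \<Rightarrow> bool" where
  "cohomologous A \<omega> \<omega>' \<longleftrightarrow> (\<exists>\<eta>. smooth_form A 1 \<eta> \<and> form_lin 1 \<omega> (-1) \<omega>' = ext_d A \<eta>)"

definition cls :: "('a, 'n::finite) chart set \<Rightarrow> ('a, 'n) form \<Rightarrow> ('a, 'n) form set" where
  "cls A \<omega> = {\<omega>'. closed11 A \<omega>' \<and> cohomologous A \<omega>' \<omega>}"

definition kahler_class :: "('a, 'n::finite) chart set \<Rightarrow> ('a, 'n) form set \<Rightarrow> bool" where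
  "kahler_class A K \<longleftrightarrow> (\<exists>\<omega>\<in>K. kahler_form A \<omega>)"

definition nef ::
  "('a, 'n::finite) chart set \<Rightarrow> ('a, 'n) form \<Rightarrow> ('a, 'n) form \<Rightarrow> bool" where
  "nef A \<omega>K \<omega> \<longleftrightarrow> (\<forall>t>0. kahler_class A (cls A (form_lin 1 \<omega> t \<omega>K)))"

text \<open>Ricci form \<open>-i \<partial>\<partial>bar log det g\<close>.\<close>

definition ricci_form ::
  "('a, 'n::finite) chart set \<Rightarrow> ('a, 'n) form \<Rightarrow> ('a, 'n) form" where
  "ricci_form A \<omega> = (\<lambda>c p vs. - idd A (\<lambda>q. ln (Re (det (coeffs \<omega> c q)))) c p vs)"

text \<open>The average \<open>n (\<theta> \<and> \<omega>^(n-1)) / \<omega>^n\<close> of the trace of \<open>\<theta>\<close>.\<close>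

definition average_trace ::
  "('a::t2_space, 'n::finite) chart set \<Rightarrow> ('a, 'n) form \<Rightarrow> ('a, 'n) form \<Rightarrow> real" where
  "average_trace A \<theta> \<omega> = real CARD('n) *
     form_integral A (wedge 2 (2 * (CARD('n) - 1)) \<theta> (wpow A \<omega> (CARD('n) - 1)))
       / form_integral A (wpow A \<omega> CARD('n))"


section \<open>Currents and big classes\<close>

text \<open>A sequence of smooth \<open>k\<close>-forms tends to \<open>0\<close> if all derivatives of its components do so,
  uniformly on compact subsets of charts.  The space of smooth forms is metrizable in this topology,
  so continuity of a linear functional is sequential continuity.\<close>

definition null_sequence ::
  "('a, 'n::finite) chart set \<Rightarrow> nat \<Rightarrow> (nat \<Rightarrow> ('a, 'n) form) \<Rightarrow> bool" where
  "null_sequence A k u \<longleftrightarrow> (\<forall>m. smooth_form A k (u m)) \<and>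
     (\<forall>c\<in>A. \<forall>K vs ds. compact K \<and> K \<subseteq> snd c ` fst c \<and> length vs = k \<longrightarrow>
        uniform_limit K (\<lambda>m. iter_deriv ds (\<lambda>x. u m c (cinv c x) vs)) (\<lambda>_. 0) sequentially)"

text \<open>A current as a functional on smooth forms of degree \<open>k\<close> (so \<open>k\<close> is its dimension).\<close>

definition current ::
  "('a, 'n::finite) chart set \<Rightarrow> nat \<Rightarrow> (('a, 'n) form \<Rightarrow> real) \<Rightarrow> bool" where
  "current A k T \<longleftrightarrow>
     (\<forall>u v a b. smooth_form A k u \<and> smooth_form A k v \<longrightarrow>
        T (form_lin a u b v) = a * T u + b * T v) \<and>
     (\<forall>u. null_sequence A k u \<longrightarrow> (\<lambda>m. T (u m)) \<longlonglongrightarrow> 0)"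

text \<open>Currents of bidegree (1,1) vanish on all forms without (n-1,n-1)-part.\<close>

definition current11 ::
  "('a, 'n::finite) chart set \<Rightarrow> (('a, 'n) form \<Rightarrow> real) \<Rightarrow> bool" where
  "current11 A T \<longleftrightarrow> current A (2 * CARD('n) - 2) T \<and>
     (\<forall>u a. smooth_form A (2 * CARD('n) - 2) u \<and> norm a = 1 \<longrightarrow> T (rotate_form a u) = T u)"

definition current_closed ::
  "('a, 'n::finite) chart set \<Rightarrow> (('a, 'n) form \<Rightarrow> real) \<Rightarrow> bool" where
  "current_closed A T \<longleftrightarrow>
     (\<forall>k \<eta>. Suc k = 2 * CARD('n) - 2 \<and> smooth_form A k \<eta> \<longrightarrow> T (ext_d A \<eta>) = 0)"

definition form_current ::
  "('a::t2_space, 'n::finite) chart set \<Rightarrow> ('a, 'n) form \<Rightarrow> ('a, 'n) form \<Rightarrow> real" where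
  "form_current A \<omega> u = form_integral A (wedge 2 (2 * CARD('n) - 2) \<omega> u)"

text \<open>Positive (n-1,n-1)-forms are nonnegative on all complex hyperplanes; in this bidegree weak and
  strong positivity agree.\<close>

definition positive_test_form ::
  "('a, 'n::finite) chart set \<Rightarrow> ('a, 'n) form \<Rightarrow> bool" where
  "positive_test_form A u \<longleftrightarrow>
     smooth_form A (2 * CARD('n) - 2) u \<and> rotation_invariant u \<and>
     (\<forall>c\<in>A. \<forall>p\<in>fst c. \<forall>vs. length vs = CARD('n) - 1 \<longrightarrow>
        u c p (concat (map (\<lambda>v. [v, \<i> *s v]) vs)) \<ge> 0)"

definition current_le ::
  "('a, 'n::finite) chart set \<Rightarrow> (('a, 'n) form \<Rightarrow> real) \<Rightarrow> (('a, 'n) form \<Rightarrow> real) \<Rightarrow> bool" where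
  "current_le A S T \<longleftrightarrow> (\<forall>u. positive_test_form A u \<longrightarrow> S u \<le> T u)"

definition current_in_class ::
  "('a::t2_space, 'n::finite) chart set \<Rightarrow> (('a, 'n) form \<Rightarrow> real) \<Rightarrow> ('a, 'n) form \<Rightarrow> bool" where
  "current_in_class A T \<omega> \<longleftrightarrow> (\<exists>S. current A (2 * CARD('n) - 1) S \<and>
     (\<forall>u. smooth_form A (2 * CARD('n) - 2) u \<longrightarrow> T u - form_current A \<omega> u = S (ext_d A u)))"

definition big ::
  "('a::t2_space, 'n::finite) chart set \<Rightarrow> ('a, 'n) form \<Rightarrow> ('a, 'n) form \<Rightarrow> bool" where
  "big A \<omega>K \<omega> \<longleftrightarrow> (\<exists>T. \<exists>t>0. current11 A T \<and> current_closed A T \<and> current_le A (\<lambda>_. 0) T \<and>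
     current_in_class A T \<omega> \<and> current_le A (\<lambda>u. t * form_current A \<omega>K u) T)"


section \<open>Quasi-plurisubharmonic functions and the log alpha invariant\<close>

definition circle_mean :: "(complex^'n \<Rightarrow> ereal) \<Rightarrow> complex^'n \<Rightarrow> complex^'n \<Rightarrow> ereal" where
  "circle_mean u z w =
     (enn2ereal (\<integral>\<^sup>+t\<in>{0..2 * pi}. e2ennreal (u (z + cis t *s w)) \<partial>lborel)
      - enn2ereal (\<integral>\<^sup>+t\<in>{0..2 * pi}. e2ennreal (- u (z + cis t *s w)) \<partial>lborel)) / ereal (2 * pi)"

definition psh_on :: "(complex^'n::finite) set \<Rightarrow> (complex^'n \<Rightarrow> ereal) \<Rightarrow> bool" where
  "psh_on V u \<longleftrightarrow>
     (\<forall>z\<in>V. u z < \<infinity>) \<and> (\<forall>a. open {z\<in>V. u z < a}) \<and>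
     (\<forall>z w. (\<forall>\<zeta>. norm \<zeta> \<le> 1 \<longrightarrow> z + \<zeta> *s w \<in> V) \<longrightarrow> u z \<le> circle_mean u z w)"

text \<open>\<open>\<phi>\<close> is \<open>\<omega>\<close>-psh if \<open>\<rho> + \<phi>\<close> is psh for every local potential \<open>\<rho>\<close> of \<open>\<omega>\<close>.  Since the
  manifold is connected, such a \<open>\<phi>\<close> is integrable as soon as it is not identically minus infinity.\<close>

definition PSH :: "('a, 'n::finite) chart set \<Rightarrow> ('a, 'n) form \<Rightarrow> ('a \<Rightarrow> ereal) set" where
  "PSH A \<omega> = {\<phi>. (\<exists>p. \<phi> p \<noteq> -\<infinity>) \<and>
     (\<forall>c\<in>A. \<forall>V \<rho>. open V \<and> V \<subseteq> snd c ` fst c \<and> smooth_on V \<rho> \<and>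
        (\<forall>z\<in>V. complex_hessian \<rho> z = coeffs \<omega> c (cinv c z)) \<longrightarrow>
        psh_on V (\<lambda>z. ereal (\<rho> z) + \<phi> (cinv c z)))}"

definition exp_weight :: "real \<Rightarrow> ('a \<Rightarrow> ereal) \<Rightarrow> 'a \<Rightarrow> ennreal" where
  "exp_weight \<alpha> \<phi> p = (if \<phi> p = -\<infinity> then \<infinity>
     else ennreal (exp (- \<alpha> * (real_of_ereal (\<phi> p) - real_of_ereal (SUP q. \<phi> q)))))"

text \<open>\<open>s2\<close> is the squared norm of the section.  The junk value of \<open>powr\<close> at \<open>0\<close> is
  immaterial, because the zero set of the section has measure zero.\<close>

definition log_alpha ::
  "('a::t2_space, 'n::finite) chart set \<Rightarrow> ('a, 'n) form \<Rightarrow> ('a, 'n) form \<Rightarrow> ('a \<Rightarrow> real) \<Rightarrow> real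
     \<Rightarrow> ereal" where
  "log_alpha A \<omega>K \<omega> s2 \<beta> = Sup (ereal ` {\<alpha>. \<alpha> > 0 \<and> (\<exists>C::real. \<forall>\<phi>\<in>PSH A \<omega>.
     (\<integral>\<^sup>+p. exp_weight \<alpha> \<phi> p * ennreal (sqrt (s2 p) powr (2 * \<beta> - 2))
        \<partial>form_measure A (wpow A \<omega>K CARD('n))) \<le> ennreal C)})"


section \<open>Hermitian line bundles and smooth hypersurfaces\<close>

text \<open>A holomorphic line bundle is given by trivialisations over an open cover \<open>V\<close>, with
  transition functions \<open>g\<close>; sections and metrics are given by their local expressions.\<close>

definition line_bundle ::
  "('a::t2_space, 'n::finite) chart set \<Rightarrow> 'i set \<Rightarrow> ('i \<Rightarrow> 'a set) \<Rightarrow> ('i \<Rightarrow> 'i \<Rightarrow> 'a \<Rightarrow> complex)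
     \<Rightarrow> bool" where
  "line_bundle A I V g \<longleftrightarrow>
     (\<forall>i\<in>I. open (V i)) \<and> (\<Union>i\<in>I. V i) = UNIV \<and>
     (\<forall>i\<in>I. \<forall>j\<in>I. hol_fun_on A (V i \<inter> V j) (g i j) \<and> (\<forall>p\<in>V i \<inter> V j. g i j p \<noteq> 0)) \<and>
     (\<forall>i\<in>I. \<forall>j\<in>I. \<forall>k\<in>I. \<forall>p\<in>V i \<inter> V j \<inter> V k. g i j p * g j k p = g i k p)"

definition holomorphic_section ::
  "('a, 'n::finite) chart set \<Rightarrow> 'i set \<Rightarrow> ('i \<Rightarrow> 'a set) \<Rightarrow> ('i \<Rightarrow> 'i \<Rightarrow> 'a \<Rightarrow> complex)
     \<Rightarrow> ('i \<Rightarrow> 'a \<Rightarrow> complex) \<Rightarrow> bool" where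
  "holomorphic_section A I V g s \<longleftrightarrow>
     (\<forall>i\<in>I. hol_fun_on A (V i) (s i)) \<and>
     (\<forall>i\<in>I. \<forall>j\<in>I. \<forall>p\<in>V i \<inter> V j. s i p = g i j p * s j p)"

text \<open>\<open>h i\<close> is the squared length of the \<open>i\<close>-th local frame.\<close>

definition hermitian_metric ::
  "('a, 'n::finite) chart set \<Rightarrow> 'i set \<Rightarrow> ('i \<Rightarrow> 'a set) \<Rightarrow> ('i \<Rightarrow> 'i \<Rightarrow> 'a \<Rightarrow> complex)
     \<Rightarrow> ('i \<Rightarrow> 'a \<Rightarrow> real) \<Rightarrow> bool" where
  "hermitian_metric A I V g h \<longleftrightarrow>
     (\<forall>i\<in>I. smooth_fun_on A (V i) (h i) \<and> (\<forall>p\<in>V i. h i p > 0)) \<and>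
     (\<forall>i\<in>I. \<forall>j\<in>I. \<forall>p\<in>V i \<inter> V j. h j p = (norm (g i j p))\<^sup>2 * h i p)"

definition index_at :: "'i set \<Rightarrow> ('i \<Rightarrow> 'a set) \<Rightarrow> 'a \<Rightarrow> 'i" where
  "index_at I V p = (SOME i. i \<in> I \<and> p \<in> V i)"

definition section_norm2 ::
  "'i set \<Rightarrow> ('i \<Rightarrow> 'a set) \<Rightarrow> ('i \<Rightarrow> 'a \<Rightarrow> complex) \<Rightarrow> ('i \<Rightarrow> 'a \<Rightarrow> real) \<Rightarrow> 'a \<Rightarrow> real" where
  "section_norm2 I V s h p = h (index_at I V p) p * (norm (s (index_at I V p) p))\<^sup>2"

text \<open>The curvature form \<open>-i \<partial>\<partial>bar log h\<close>.\<close>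

definition curvature_form ::
  "('a, 'n::finite) chart set \<Rightarrow> 'i set \<Rightarrow> ('i \<Rightarrow> 'a set) \<Rightarrow> ('i \<Rightarrow> 'a \<Rightarrow> real) \<Rightarrow> ('a, 'n) form"
  where
  "curvature_form A I V h = (\<lambda>c p vs. - idd A (\<lambda>q. ln (h (index_at I V p) q)) c p vs)"

text \<open>\<open>D\<close> is the zero set of \<open>s\<close>, and \<open>s\<close> vanishes along it to first order; so \<open>D\<close> is a smooth
  hypersurface, the line bundle is the one associated with \<open>D\<close>, and \<open>s\<close> is its defining section.\<close>

definition smooth_hypersurface ::
  "('a, 'n::finite) chart set \<Rightarrow> 'i set \<Rightarrow> ('i \<Rightarrow> 'a set) \<Rightarrow> ('i \<Rightarrow> 'a \<Rightarrow> complex) \<Rightarrow> 'a set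
     \<Rightarrow> bool" where
  "smooth_hypersurface A I V s D \<longleftrightarrow>
     D = {p. \<exists>i\<in>I. p \<in> V i \<and> s i p = 0} \<and>
     (\<forall>i\<in>I. \<forall>p\<in>D \<inter> V i. \<forall>c\<in>A. p \<in> fst c \<longrightarrow>
        frechet_derivative (s i \<circ> cinv c) (at (snd c p)) \<noteq> (\<lambda>_. 0))"


section \<open>Approximate and singular cscK metrics\<close>

text \<open>The trace \<open>\<Sum> g^(i,jbar) a\<^sub>i\<^sub>j\<close> with respect to \<open>\<omega>\<close>, where \<open>g^(i,jbar)\<close> is the transposed
  inverse of the coefficient matrix of \<open>\<omega>\<close>.\<close>

definition herm_trace ::
  "('a, 'n::finite) form \<Rightarrow> ('a, 'n) chart \<Rightarrow> 'a \<Rightarrow> complex^'n^'n \<Rightarrow> complex" where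
  "herm_trace \<omega> c p a = trace (matrix_inv (coeffs \<omega> c p) ** a)"

definition laplacian ::
  "('a, 'n::finite) form \<Rightarrow> ('a, 'n) chart \<Rightarrow> 'a \<Rightarrow> ('a \<Rightarrow> real) \<Rightarrow> complex" where
  "laplacian \<omega> c p f = herm_trace \<omega> c p (complex_hessian (f \<circ> cinv c) (snd c p))"

definition smooth_volume_form ::
  "('a, 'n::finite) chart set \<Rightarrow> ('a, 'n) form \<Rightarrow> bool" where
  "smooth_volume_form A \<mu> \<longleftrightarrow>
     smooth_form A (2 * CARD('n)) \<mu> \<and> (\<forall>c\<in>A. \<forall>p\<in>fst c. density \<mu> c p > 0)"

text \<open>\<open>-i \<partial>\<partial>bar log \<mu>\<close> for a positive volume form \<open>\<mu>\<close>.\<close>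

definition volume_curvature ::
  "('a, 'n::finite) chart set \<Rightarrow> ('a, 'n) form \<Rightarrow> ('a, 'n) form" where
  "volume_curvature A \<mu> = (\<lambda>c p vs. - idd A (\<lambda>q. ln (density \<mu> c q)) c p vs)"

text \<open>The reference metric in the class of \<open>\<omega>sr + \<epsilon> \<omega>K\<close>.  The class fixes the total volume, so the
  constant \<open>a\<close> is the normalising one.\<close>

definition reference_metric ::
  "('a, 'n::finite) chart set \<Rightarrow> ('a, 'n) form \<Rightarrow> ('a, 'n) form \<Rightarrow> ('a, 'n) form \<Rightarrow> ('a \<Rightarrow> real)
     \<Rightarrow> real \<Rightarrow> real \<Rightarrow> ('a, 'n) form \<Rightarrow> bool" where
  "reference_metric A \<omega>K \<omega>sr \<mu> s2 \<beta> \<epsilon> \<omega> \<longleftrightarrow>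
     kahler_form A \<omega> \<and> \<omega> \<in> cls A (form_lin 1 \<omega>sr \<epsilon> \<omega>K) \<and>
     (\<exists>a. wpow A \<omega> CARD('n) = (\<lambda>c p vs. exp a * (s2 p + \<epsilon>) powr (\<beta> - 1) * \<mu> c p vs))"

definition potential_form ::
  "('a, 'n::finite) chart set \<Rightarrow> ('a, 'n) form \<Rightarrow> ('a, 'n) form \<Rightarrow> real \<Rightarrow> ('a \<Rightarrow> real)
     \<Rightarrow> ('a, 'n) form" where
  "potential_form A \<omega>K \<omega>sr \<epsilon> \<phi> = form_lin 1 (form_lin 1 \<omega>sr \<epsilon> \<omega>K) 1 (idd A \<phi>)"

definition approx_cscK ::
  "('a::t2_space, 'n::finite) chart set \<Rightarrow> ('a, 'n) form \<Rightarrow> ('a, 'n) form \<Rightarrow> ('a, 'n) form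
     \<Rightarrow> (real \<Rightarrow> ('a, 'n) form) \<Rightarrow> real \<Rightarrow> ('a \<Rightarrow> real) \<Rightarrow> ('a \<Rightarrow> real) \<Rightarrow> bool" where
  "approx_cscK A \<omega>K \<omega>sr \<theta> \<omega>\<theta> \<epsilon> \<phi> F \<longleftrightarrow>
     smooth_fun_on A UNIV \<phi> \<and> smooth_fun_on A UNIV F \<and>
     kahler_form A (potential_form A \<omega>K \<omega>sr \<epsilon> \<phi>) \<and>
     wpow A (potential_form A \<omega>K \<omega>sr \<epsilon> \<phi>) CARD('n)
       = (\<lambda>c p vs. exp (F p) * wpow A (\<omega>\<theta> \<epsilon>) CARD('n) c p vs) \<and>
     (\<forall>c\<in>A. \<forall>p\<in>fst c.
        laplacian (potential_form A \<omega>K \<omega>sr \<epsilon> \<phi>) c p F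
          = herm_trace (potential_form A \<omega>K \<omega>sr \<epsilon> \<phi>) c p (coeffs \<theta> c p)
            - complex_of_real (average_trace A \<theta> (form_lin 1 \<omega>sr \<epsilon> \<omega>K)))"

definition singular_cscK ::
  "('a::t2_space, 'n::finite) chart set \<Rightarrow> ('a, 'n) form \<Rightarrow> ('a, 'n) form \<Rightarrow> ('a, 'n) form
     \<Rightarrow> (real \<Rightarrow> ('a, 'n) form) \<Rightarrow> ('a \<Rightarrow> ereal) \<Rightarrow> bool" where
  "singular_cscK A \<omega>K \<omega>sr \<theta> \<omega>\<theta> \<phi> \<longleftrightarrow> \<phi> \<in> PSH A \<omega>sr \<and>
     (\<exists>(\<epsilon> :: nat \<Rightarrow> real) \<psi> F. (\<forall>i. \<epsilon> i > 0) \<and> \<epsilon> \<longlonglongrightarrow> 0 \<and>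
        (\<forall>i. approx_cscK A \<omega>K \<omega>sr \<theta> \<omega>\<theta> (\<epsilon> i) (\<psi> i) (F i)) \<and>
        (\<lambda>i. \<integral>\<^sup>+p. e2ennreal \<bar>ereal (\<psi> i p) - \<phi> p\<bar> \<partial>form_measure A (wpow A \<omega>K CARD('n)))
          \<longlonglongrightarrow> 0)"

end

theory Submission imports Defs "HOL-Library.Diagonal_Subsequence" begin

text \<open>
  The hypothesis provides cscK potentials \<open>\<phi> \<epsilon>\<close> for all small \<open>\<epsilon>\<close>; what has to be found is a
  sequence \<open>\<epsilon>\<^sub>i \<rightarrow> 0\<close> along which, after normalisation, they converge in \<open>L\<^sup>1\<close> to an
  \<open>\<omega>sr\<close>-plurisubharmonic function.  The metric and both equations of the system
  involve a potential only through its complex Hessian, so subtracting the maximum yields cscK potentials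
  \<open>\<psi>\<^sub>i \<le> 0\<close> with \<open>\<psi>\<^sub>i = 0\<close> somewhere (\<open>approx_cscK_add_const\<close>).  The theorem is then the
  classical compactness of normalised quasi-plurisubharmonic functions.

  \<^bold>\<open>Local form.\<close> On a chart ball of centre \<open>a\<close> and radius \<open>R\<close> the forms are bounded by
  a constant times the Euclidean metric, so for a suitable \<open>\<kappa>\<close>, the same for all \<open>i\<close>, the function
  \<open>\<psi>\<^sub>i + \<kappa> \<bar>z - a\<bar>\<^sup>2\<close> has semipositive Levi form and satisfies the mean value inequality on circles
  in complex lines (\<open>circle_mean_inequality\<close>).  Hence
  \<open>f\<^sub>i = \<kappa> (R\<^sup>2 - \<bar>z - a\<bar>\<^sup>2) - \<psi>\<^sub>i\<close> is nonnegative and has the reverse inequality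
  (\<open>supermean_in_chart_ball\<close>); such functions dominate their averages against radial kernels
  (\<open>supermean_cone_average\<close>).

  \<^bold>\<open>Uniform integral bounds.\<close> A bound for \<open>f\<^sub>i\<close> at one point bounds its integral over a
  neighbourhood (\<open>supermean_L1_bound\<close>), and an integral bound gives back points of bounded value in
  every smaller ball.  The set of points near which \<open>\<psi>\<^sub>i\<close> does not tend to \<open>-\<infinity>\<close> is therefore open and
  closed; it contains every cluster point of the maximum points, so it is the whole connected manifold
  (\<open>not_collapsing_everywhere\<close>).

  \<^bold>\<open>Convergence.\<close> The averages of \<open>f\<^sub>i\<close> over radius \<open>\<delta>\<close> are uniformly bounded and Lipschitz,
  and differ from \<open>f\<^sub>i\<close> by \<open>O(\<delta>)\<close> in \<open>L\<^sup>1\<close> (\<open>smear_close\<close>).  A diagonal subsequence makes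
  them converge for a null sequence of radii at all points of a countable dense set, hence everywhere,
  and then \<open>f\<^sub>i\<close> converges in \<open>L\<^sup>1\<close> on the half ball
  (\<open>supermean_sequence_L1_convergence\<close>).  The limit of the \<open>\<psi>\<^sub>i\<close> is named beforehand: it is the
  half-relaxed upper limit \<open>upper_limit \<psi>\<close>, which is defined on all of \<open>X\<close> and needs no gluing.
  Covering \<open>X\<close> by finitely many such half balls gives \<open>potentials_L1_compactness\<close>.

  \<^bold>\<open>The limit is plurisubharmonic.\<close> The upper limit is upper semicontinuous by construction,
  and it inherits the submean inequality by the reverse Fatou lemma (\<open>upper_limit_PSH\<close>).

  Integrals over \<open>X\<close> are taken against the measure of \<open>\<omega>K\<^sup>n\<close>.  That this measure exists and is
  given by its density in each chart (\<open>form_measure_spec\<close>) rests on the change of variables formula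
  and on the fact that a top-degree form transforms by the Jacobian
  (\<open>alternating_frame_jacobian\<close>).
\<close>

section \<open>Change of variables on complex coordinate space\<close>

text \<open>The name \<open>density\<close> denotes the coefficient of a top-degree form; this is the density of a measure.\<close>

abbreviation with_density :: "'a measure \<Rightarrow> ('a \<Rightarrow> ennreal) \<Rightarrow> 'a measure" where
  "with_density \<equiv> Nonnegative_Lebesgue_Integration.density"

text \<open>Change of variables on \<open>real^'m\<close> is stated for well-ordered index types.  The type
  \<open>'n bit0\<close> is a finite well-ordered type with \<open>2 * CARD('n)\<close> elements, so \<open>real^('n bit0)\<close> serves as
  the model of \<open>complex^'n\<close> as a real Euclidean space; any enumeration of the basis will do.\<close>

definition coord_basis :: "'n::finite bit0 \<Rightarrow> complex^'n" where
  "coord_basis = (SOME e. bij_betw e UNIV Basis)"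

lemma bij_coord_basis: "bij_betw (coord_basis :: 'n::finite bit0 \<Rightarrow> complex^'n) UNIV Basis"
proof -
  have "card (Basis :: (complex^'n) set) = CARD('n bit0)"
    by simp
  then have "\<exists>e. bij_betw e (UNIV :: 'n bit0 set) (Basis :: (complex^'n) set)"
    by (metis finite finite_Basis finite_same_card_bij)
  then show ?thesis
    unfolding coord_basis_def by (rule someI_ex)
qed

lemma coord_basis_in_Basis [simp]: "coord_basis k \<in> Basis"
  using bij_coord_basis by (auto simp: bij_betw_def)

lemma sum_coord_basis: "(\<Sum>b\<in>Basis. f b) = (\<Sum>k\<in>UNIV. f (coord_basis k))"
  by (rule sum.reindex_bij_betw[OF bij_coord_basis, symmetric])

lemma prod_coord_basis: "(\<Prod>b\<in>Basis. f b) = (\<Prod>k\<in>UNIV. f (coord_basis k))"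
  by (rule prod.reindex_bij_betw[OF bij_coord_basis, symmetric])

lemma inner_coord_basis: "coord_basis j \<bullet> coord_basis k = (if j = k then 1 else 0)"
  using inner_Basis[OF coord_basis_in_Basis coord_basis_in_Basis, of j k] bij_coord_basis
  by (auto simp: bij_betw_def inj_def)

definition re_coords :: "complex^'n \<Rightarrow> real^('n::finite bit0)" where
  "re_coords z = (\<chi> k. z \<bullet> coord_basis k)"

definition of_coords :: "real^('n::finite bit0) \<Rightarrow> complex^'n" where
  "of_coords y = (\<Sum>k\<in>UNIV. y $ k *\<^sub>R coord_basis k)"

lemma of_re_coords [simp]: "of_coords (re_coords z) = z"
  unfolding of_coords_def re_coords_def
  by (simp flip: sum_coord_basis[of "\<lambda>b. (z \<bullet> b) *\<^sub>R b"] add: euclidean_representation)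

lemma re_of_coords [simp]: "re_coords (of_coords y) = y"
  by (simp add: vec_eq_iff of_coords_def re_coords_def inner_sum_left inner_coord_basis
      if_distrib sum.delta cong: if_cong)

lemma linear_re_coords: "linear re_coords"
  by (rule linearI) (auto simp: vec_eq_iff re_coords_def inner_add_left)

lemma linear_of_coords: "linear of_coords"
  by (rule linearI) (auto simp: of_coords_def scaleR_add_left sum.distrib scaleR_sum_right)

lemma norm_re_coords [simp]: "norm (re_coords z) = norm z"
proof -
  have "norm (re_coords z) ^ 2 = norm z ^ 2"
    unfolding power2_norm_eq_inner
    by (subst inner_vec_def) (simp add: re_coords_def euclidean_inner[of z z] sum_coord_basis)
  then show ?thesis by simp
qed

lemma norm_of_coords [simp]: "norm (of_coords y) = norm y"
  by (metis norm_re_coords re_of_coords)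

lemma bounded_linear_re_coords: "bounded_linear re_coords"
  using linear_re_coords linear_conv_bounded_linear by blast

lemma bounded_linear_of_coords: "bounded_linear of_coords"
  using linear_of_coords linear_conv_bounded_linear by blast

lemma measurable_of_coords [measurable]: "of_coords \<in> borel_measurable borel"
  using bounded_linear_of_coords
  by (intro borel_measurable_continuous_onI) (rule linear_continuous_on)

lemma distr_of_coords: "distr lborel borel of_coords = (lborel :: (complex^'n::finite) measure)"
proof (rule lborel_eqI[symmetric])
  fix l u :: "complex^'n"
  assume le: "\<And>b. b \<in> Basis \<Longrightarrow> l \<bullet> b \<le> u \<bullet> b"
  have "of_coords -` box l u = box (re_coords l) (re_coords u)"
  proof (rule set_eqI)
    fix y :: "real^('n bit0)"
    have "y \<in> of_coords -` box l u \<longleftrightarrow>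
        (\<forall>k. l \<bullet> coord_basis k < of_coords y \<bullet> coord_basis k
             \<and> of_coords y \<bullet> coord_basis k < u \<bullet> coord_basis k)"
      using bij_coord_basis by (auto simp: mem_box bij_betw_def) (metis imageE)+
    also have "\<dots> \<longleftrightarrow> y \<in> box (re_coords l) (re_coords u)"
      using re_of_coords[of y]
      by (simp add: mem_box_cart re_coords_def vec_eq_iff)
    finally show "y \<in> of_coords -` box l u \<longleftrightarrow> y \<in> box (re_coords l) (re_coords u)" .
  qed
  moreover have "emeasure lborel (box (re_coords l) (re_coords u)) = (\<Prod>b\<in>Basis. (u - l) \<bullet> b)"
  proof -
    have "emeasure lborel (box (re_coords l) (re_coords u)) =
        (\<Prod>b\<in>Basis. (re_coords u - re_coords l) \<bullet> b)"
      by (rule emeasure_lborel_box)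
         (auto simp: Basis_vec_def inner_axis re_coords_def le[OF coord_basis_in_Basis])
    also have "(\<Prod>b\<in>Basis. (re_coords u - re_coords l) \<bullet> b) =
        (\<Prod>k\<in>UNIV. (re_coords u - re_coords l) $ k)"
    proof -
      have "(Basis :: (real^('n bit0)) set) = range (\<lambda>k. axis k 1)"
        by (auto simp: Basis_vec_def)
      moreover have "inj (\<lambda>k::'n bit0. axis k (1::real))"
        by (auto simp: inj_def axis_eq_axis)
      ultimately show ?thesis
        using prod.reindex[of "\<lambda>k::'n bit0. axis k (1::real)" UNIV
            "\<lambda>b. (re_coords u - re_coords l) \<bullet> b"]
        by (simp add: inner_axis)
    qed
    also have "\<dots> = (\<Prod>b\<in>Basis. (u - l) \<bullet> b)"
      by (simp add: prod_coord_basis re_coords_def inner_diff_left)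
    finally show ?thesis .
  qed
  ultimately show "emeasure (distr lborel borel of_coords) (box l u) = (\<Prod>b\<in>Basis. (u - l) \<bullet> b)"
    by (simp add: emeasure_distr)
qed auto

lemma nn_integral_of_coords:
  assumes "f \<in> borel_measurable borel"
  shows "(\<integral>\<^sup>+y. f (of_coords y) \<partial>lborel) = (\<integral>\<^sup>+x. f x \<partial>lborel)"
  using nn_integral_distr[of of_coords lborel borel f] assms by (simp add: distr_of_coords)

text \<open>Image measure and Jacobian integral agree whenever one of them is finite.  In \<open>ennreal\<close> they are
  then equal unconditionally, both being infinite otherwise.\<close>

lemma emeasure_differentiable_image:
  fixes f :: "real^'m::{finite,wellorder} \<Rightarrow> real^'m::_"
  assumes S: "S \<in> sets lebesgue"
    and f: "\<And>x. x \<in> S \<Longrightarrow> (f has_derivative f' x) (at x within S)"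
    and inj: "inj_on f S"
  shows "emeasure lebesgue (f ` S)
    = (\<integral>\<^sup>+x. ennreal \<bar>det (matrix (f' x))\<bar> * indicator S x \<partial>lebesgue)" (is "_ = ?I")
proof -
  let ?d = "\<lambda>x. \<bar>det (matrix (f' x))\<bar>"
  have fS: "f ` S \<in> sets lebesgue"
    using f by (intro differentiable_image_in_sets_lebesgue[OF S])
      (auto simp: differentiable_on_def differentiable_def)
  have meas: "?d \<in> borel_measurable (lebesgue_on S)"
    by (intro borel_measurable_abs borel_measurable_det_Jacobian[OF S f])
  have I: "?I = (\<integral>\<^sup>+x. ennreal (?d x) \<partial>lebesgue_on S)"
    using S by (simp add: nn_integral_restrict_space)
  show ?thesis
  proof (cases "f ` S \<in> lmeasurable")
    case True
    then have "(?d has_integral measure lebesgue (f ` S)) S"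
      using measurable_differentiable_image_eq[OF S f inj] measure_differentiable_image_eq[OF S f inj]
      by (metis integrable_integral)
    then have "(\<integral>\<^sup>+x. ennreal (indicator S x * ?d x) \<partial>lebesgue) = measure lebesgue (f ` S)"
      unfolding nn_integral_completion by (rule nn_integral_has_integral_lebesgue[rotated]) auto
    moreover have "?I = (\<integral>\<^sup>+x. ennreal (indicator S x * ?d x) \<partial>lebesgue)"
      by (rule nn_integral_cong) (simp split: split_indicator)
    ultimately show ?thesis
      using emeasure_eq_measure2[OF True] by (simp only:)
  next
    case False
    then have 1: "emeasure lebesgue (f ` S) = \<infinity>"
      using fS unfolding fmeasurable_def mem_Collect_eq by (metis infinity_ennreal_def less_top)
    have "\<not> ?I < \<infinity>"
    proof
      assume "?I < \<infinity>"
      then have "integrable (lebesgue_on S) ?d"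
        unfolding I by (intro integrableI_nonneg meas) auto
      then have "?d integrable_on S"
        using S by (simp add: integrable_on_lebesgue_on)
      then show False
        using False measurable_differentiable_image_eq[OF S f inj] by simp
    qed
    with 1 show ?thesis by (metis infinity_ennreal_def less_top)
  qed
qed

text \<open>Both sides are integrals of \<open>g\<close>, against Lebesgue measure on the image and
  against the push-forward of the Jacobian density; these two measures agree on Borel sets by the previous
  lemma, applied to preimages.\<close>

lemma nn_integral_differentiable_image:
  fixes f :: "real^'m::{finite,wellorder} \<Rightarrow> real^'m::_"
  assumes U: "open U"
    and f: "\<And>x. x \<in> U \<Longrightarrow> (f has_derivative f' x) (at x)"
    and inj: "inj_on f U" and fU: "open (f ` U)"
    and g: "g \<in> borel_measurable borel"
  shows "(\<integral>\<^sup>+y. g y * indicator (f ` U) y \<partial>lborel)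
    = (\<integral>\<^sup>+x. g (f x) * ennreal \<bar>det (matrix (f' x))\<bar> * indicator U x \<partial>lborel)"
proof -
  let ?d = "\<lambda>x. ennreal \<bar>det (matrix (f' x))\<bar>"
  let ?D = "with_density (lebesgue_on U) ?d"
  have Us: "U \<in> sets lebesgue" using U by auto
  have meas: "?d \<in> borel_measurable (lebesgue_on U)"
    by (intro measurable_compose[OF borel_measurable_abs measurable_ennreal]
        borel_measurable_det_Jacobian[OF Us]) (rule has_derivative_at_withinI, rule f)
  have cont: "continuous_on U f"
    using f has_derivative_continuous_on has_derivative_at_withinI by blast
  have fm: "f \<in> measurable (lebesgue_on U) borel"
    using cont Us by (rule continuous_imp_measurable_on_sets_lebesgue)
  then have fm': "f \<in> measurable ?D borel" by simp
  have eq: "distr ?D borel f = with_density lborel (indicator (f ` U))"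
  proof (rule measure_eqI)
    fix Y assume "Y \<in> sets (distr ?D borel f)"
    then have Y[measurable]: "Y \<in> sets borel" by simp
    let ?S = "f -` Y \<inter> U"
    have S: "?S \<in> sets (lebesgue_on U)"
      using measurable_sets[OF fm Y] by simp
    then have SL: "?S \<in> sets lebesgue" using Us by (simp add: sets_restrict_space_iff)
    have "emeasure (distr ?D borel f) Y = emeasure ?D ?S"
      using fm' by (simp add: emeasure_distr)
    also have "\<dots> = (\<integral>\<^sup>+x. ?d x * indicator ?S x \<partial>lebesgue_on U)"
      using S meas by (simp add: emeasure_density)
    also have "\<dots> = (\<integral>\<^sup>+x. ?d x * indicator ?S x \<partial>lebesgue)"
      using Us by (simp add: nn_integral_restrict_space)
        (auto intro!: nn_integral_cong split: split_indicator)
    also have "\<dots> = emeasure lebesgue (f ` ?S)"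
      using inj by (intro emeasure_differentiable_image[symmetric] SL)
        (auto intro!: has_derivative_at_withinI f intro: inj_on_subset)
    also have "f ` ?S = f ` U \<inter> Y" by auto
    also have "emeasure lebesgue (f ` U \<inter> Y) = emeasure (with_density lborel (indicator (f ` U))) Y"
      using fU by (simp add: emeasure_density nn_integral_indicator flip: indicator_inter_arith)
    finally show "emeasure (distr ?D borel f) Y
      = emeasure (with_density lborel (indicator (f ` U))) Y" .
  qed simp
  have "(\<integral>\<^sup>+y. g y * indicator (f ` U) y \<partial>lborel)
      = (\<integral>\<^sup>+y. g y \<partial>with_density lborel (indicator (f ` U)))"
    using g fU by (subst nn_integral_density) (auto simp: mult.commute)
  also have "\<dots> = (\<integral>\<^sup>+x. g (f x) \<partial>?D)"
    unfolding eq[symmetric] using g fm' by (simp add: nn_integral_distr)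
  also have "\<dots> = (\<integral>\<^sup>+x. ?d x * g (f x) \<partial>lebesgue_on U)"
    using meas measurable_compose[OF fm] g by (intro nn_integral_density) auto
  also have "\<dots> = (\<integral>\<^sup>+x. g (f x) * ?d x * indicator U x \<partial>lebesgue)"
    using Us by (simp add: nn_integral_restrict_space mult.commute)
  finally show ?thesis by (simp add: nn_integral_completion)
qed

text \<open>The absolute value of the real Jacobian determinant of a real-linear map.\<close>

definition jacobian :: "(complex^'n::finite \<Rightarrow> complex^'n) \<Rightarrow> real" where
  "jacobian L = \<bar>det (matrix (re_coords \<circ> L \<circ> of_coords))\<bar>"

text \<open>Transport of the real formula through the measure-preserving isometry \<open>of_coords\<close>.\<close>

theorem nn_integral_change_of_variables:
  fixes T :: "complex^'n::finite \<Rightarrow> complex^'n"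
  assumes U: "open U"
    and T: "\<And>x. x \<in> U \<Longrightarrow> (T has_derivative T' x) (at x)"
    and inj: "inj_on T U" and TU: "open (T ` U)"
    and g: "g \<in> borel_measurable borel"
    and gT: "(\<lambda>x. g (T x) * ennreal (jacobian (T' x)) * indicator U x) \<in> borel_measurable borel"
  shows "(\<integral>\<^sup>+y. g y * indicator (T ` U) y \<partial>lborel)
    = (\<integral>\<^sup>+x. g (T x) * ennreal (jacobian (T' x)) * indicator U x \<partial>lborel)"
proof -
  let ?U = "re_coords ` U"
  let ?f = "re_coords \<circ> T \<circ> of_coords" and ?f' = "\<lambda>y. re_coords \<circ> T' (of_coords y) \<circ> of_coords"
  have open_im: "open (re_coords ` W)" if "open W" for W :: "(complex^'n) set"
  proof -
    have "re_coords ` W = of_coords -` W"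
      by (auto simp: image_iff) (metis re_of_coords)
    then show ?thesis
      using that by (metis open_vimage linear_continuous_on[OF bounded_linear_of_coords])
  qed
  have mem: "y \<in> re_coords ` W \<longleftrightarrow> of_coords y \<in> W" for y and W :: "(complex^'n) set"
    by (metis image_iff of_re_coords re_of_coords)
  have fU: "?f ` ?U = re_coords ` (T ` U)"
    by (force simp: image_iff)
  have "(\<integral>\<^sup>+y. g y * indicator (T ` U) y \<partial>lborel)
      = (\<integral>\<^sup>+y. g (of_coords y) * indicator (T ` U) (of_coords y) \<partial>lborel)"
    using g TU by (subst nn_integral_of_coords[symmetric]) auto
  also have "\<dots> = (\<integral>\<^sup>+y. g (of_coords y) * indicator (?f ` ?U) y \<partial>lborel)"
    unfolding fU by (intro nn_integral_cong) (auto simp: mem split: split_indicator)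
  also have "\<dots> = (\<integral>\<^sup>+y. g (of_coords (?f y)) * ennreal \<bar>det (matrix (?f' y))\<bar> * indicator ?U y
      \<partial>lborel)"
  proof (rule nn_integral_differentiable_image)
    show "open ?U" "open (?f ` ?U)" unfolding fU using U TU by (auto intro: open_im)
    show "inj_on ?f ?U"
      using inj by (auto simp: inj_on_def) (metis of_re_coords)
    show "(\<lambda>y. g (of_coords y)) \<in> borel_measurable borel" using g by simp
    show "(?f has_derivative ?f' y) (at y)" if "y \<in> ?U" for y
    proof -
      have "(of_coords has_derivative of_coords) (at y)"
        using bounded_linear_of_coords by (rule bounded_linear_imp_has_derivative)
      moreover have "(T has_derivative T' (of_coords y)) (at (of_coords y))"
        using that by (intro T) (simp add: mem)
      moreover have "(re_coords has_derivative re_coords) (at (T (of_coords y)))"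
        using bounded_linear_re_coords by (rule bounded_linear_imp_has_derivative)
      ultimately show ?thesis
        by (intro diff_chain_at) auto
    qed
  qed
  also have "\<dots> = (\<integral>\<^sup>+y. g (T (of_coords y)) * ennreal (jacobian (T' (of_coords y)))
      * indicator U (of_coords y) \<partial>lborel)"
    by (intro nn_integral_cong) (auto simp: mem jacobian_def split: split_indicator)
  also have "\<dots> = (\<integral>\<^sup>+x. g (T x) * ennreal (jacobian (T' x)) * indicator U x \<partial>lborel)"
    using gT by (rule nn_integral_of_coords)
  finally show ?thesis .
qed

lemma jacobian_isometry:
  assumes "linear L" "\<And>x. norm (L x) = norm x"
  shows "jacobian L = 1"
proof -
  have "linear (re_coords \<circ> L \<circ> of_coords)"
    by (intro linear_compose linear_of_coords linear_re_coords assms)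
  then have "orthogonal_transformation (re_coords \<circ> L \<circ> of_coords)"
    by (simp add: orthogonal_transformation assms)
  then show ?thesis
    by (simp add: jacobian_def)
qed

lemma nn_integral_isometry:
  fixes L :: "complex^'n::finite \<Rightarrow> complex^'n"
  assumes "linear L" "\<And>x. norm (L x) = norm x" and g: "g \<in> borel_measurable borel"
  shows "(\<integral>\<^sup>+x. g (L x) \<partial>lborel) = (\<integral>\<^sup>+x. g x \<partial>lborel)"
proof -
  have L: "bounded_linear L" using assms linear_conv_bounded_linear by blast
  then have cont: "continuous_on UNIV L" by (rule linear_continuous_on)
  have inj: "inj L"
    using assms by (metis linear_injective_0 norm_eq_zero)
  then have surj: "range L = UNIV"
    using assms(1) linear_injective_imp_surjective by blast
  have [measurable]: "L \<in> borel_measurable borel"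
    using cont by (rule borel_measurable_continuous_onI)
  have "(\<integral>\<^sup>+y. g y * indicator (range L) y \<partial>lborel)
      = (\<integral>\<^sup>+x. g (L x) * ennreal (jacobian L) * indicator UNIV x \<partial>lborel)"
    using inj surj g L by (intro nn_integral_change_of_variables)
      (auto intro: bounded_linear_imp_has_derivative)
  then show ?thesis
    using jacobian_isometry[OF assms(1,2)] surj by simp
qed

section \<open>Alternating functions and determinants\<close>

definition alternating :: "nat \<Rightarrow> ('v::real_vector list \<Rightarrow> real) \<Rightarrow> bool" where
  "alternating k f \<longleftrightarrow> (\<forall>vs. length vs = k \<longrightarrow>
     (\<forall>i<k. linear (\<lambda>v. f (vs[i := v]))) \<and>
     (\<forall>i j. i < j \<and> j < k \<and> vs ! i = vs ! j \<longrightarrow> f vs = 0))"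

lemma alternating_linear:
  "alternating k f \<Longrightarrow> length vs = k \<Longrightarrow> i < k \<Longrightarrow> linear (\<lambda>v. f (vs[i := v]))"
  unfolding alternating_def by blast

lemma alternating_eq_0:
  assumes "alternating k f" "length vs = k" "i < k" "j < k" "i \<noteq> j" "vs ! i = vs ! j"
  shows "f vs = 0"
  using assms unfolding alternating_def by (metis linorder_neq_iff)

text \<open>Multilinearity and vanishing on repeated arguments survive a linear substitution, which is what makes
  the induction over compositions in \<open>alternating_det\<close> possible.\<close>

lemma alternating_compose:
  assumes f: "alternating k f" and L: "linear L"
  shows "alternating k (\<lambda>vs. f (map L vs))"
  unfolding alternating_def
proof (intro allI impI conjI)
  fix vs :: "'b list" and i assume vs: "length vs = k" and i: "i < k"
  have "linear ((\<lambda>v. f ((map L vs)[i := v])) \<circ> L)"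
    using alternating_linear[OF f, of "map L vs"] vs i L by (intro linear_compose) auto
  then show "linear (\<lambda>v. f (map L (vs[i := v])))"
    by (simp add: o_def map_update)
next
  fix vs :: "'b list" and i j assume vs: "length vs = k" and "i < j \<and> j < k \<and> vs ! i = vs ! j"
  then show "f (map L vs) = 0"
    using alternating_eq_0[OF f, of "map L vs" i j] by auto
qed

lemma alternating_swap:
  assumes f: "alternating k f" and vs: "length vs = k" and ij: "i < k" "j < k" "i \<noteq> j"
  shows "f (vs[i := vs ! j, j := vs ! i]) = - f vs"
proof -
  let ?F = "\<lambda>a b. f (vs[i := a, j := b])"
  have l1: "linear (?F a)" for a
    using alternating_linear[OF f, of "vs[i := a]" j] vs ij by simp
  have l2: "linear (\<lambda>a. ?F a b)" for b
    using alternating_linear[OF f, of "vs[j := b]" i] vs ij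
    by (simp add: list_update_swap)
  have 0: "?F a a = 0" for a
    using vs ij by (intro alternating_eq_0[OF f, of _ i j]) auto
  define a b where "a = vs ! i" and "b = vs ! j"
  have "0 = ?F (a + b) (a + b)" by (simp add: 0)
  also have "\<dots> = ?F a a + ?F a b + (?F b a + ?F b b)"
    by (simp only: linear_add[OF l1] linear_add[OF l2])
  finally have "?F b a = - ?F a b" by (simp add: 0)
  then show ?thesis by (simp add: a_def b_def)
qed

lemma alternating_dependent:
  assumes f: "alternating k f" and vs: "length vs = k" and i: "i < k"
    and span: "vs ! i \<in> span {vs ! j |j. j < k \<and> j \<noteq> i}"
  shows "f vs = 0"
proof -
  have lin: "linear (\<lambda>v. f (vs[i := v]))"
    using alternating_linear[OF f vs i] .
  have "span {vs ! j |j. j < k \<and> j \<noteq> i} \<subseteq> {v. f (vs[i := v]) = 0}"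
  proof (rule span_minimal)
    show "subspace {v. f (vs[i := v]) = 0}"
      using lin by (rule linear_subspace_kernel)
    show "{vs ! j |j. j < k \<and> j \<noteq> i} \<subseteq> {v. f (vs[i := v]) = 0}"
    proof clarsimp
      fix j assume "j < k" "j \<noteq> i"
      then show "f (vs[i := vs ! j]) = 0"
        using vs i by (intro alternating_eq_0[OF f, of _ i j]) auto
    qed
  qed
  then have "f (vs[i := vs ! i]) = 0" using span by blast
  then show ?thesis by simp
qed

lemma alternating_scale:
  assumes f: "alternating k f" and vs: "length vs = k"
  shows "f (map (\<lambda>i. c i *\<^sub>R vs ! i) [0..<k]) = (\<Prod>i<k. c i) * f vs"
proof -
  let ?w = "\<lambda>m. map (\<lambda>i. if i < m then c i *\<^sub>R vs ! i else vs ! i) [0..<k]"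
  have "m \<le> k \<Longrightarrow> f (?w m) = (\<Prod>i<m. c i) * f vs" for m
  proof (induction m)
    case 0
    have "?w 0 = vs" using vs map_nth[of vs] by simp
    then show ?case by simp
  next
    case (Suc m)
    have lin: "linear (\<lambda>v. f ((?w m)[m := v]))"
      using Suc.prems by (intro alternating_linear[OF f]) auto
    have "?w (Suc m) = (?w m)[m := c m *\<^sub>R vs ! m]"
      using Suc.prems by (intro nth_equalityI) (auto simp: nth_list_update less_Suc_eq)
    then have "f (?w (Suc m)) = c m * f ((?w m)[m := vs ! m])"
      using linear_scale[OF lin, of "c m" "vs ! m"] by simp
    also have "(?w m)[m := vs ! m] = ?w m"
      using Suc.prems by (intro nth_equalityI) (auto simp: nth_list_update)
    finally show ?case using Suc by simp
  qed
  moreover have "?w k = map (\<lambda>i. c i *\<^sub>R vs ! i) [0..<k]" by auto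
  ultimately show ?thesis by (metis order_refl)
qed

text \<open>The space of alternating forms of top degree is one-dimensional, so a linear map acts on it by a
  scalar, its determinant.  Rather than expand over permutations, the proof checks the scalar on generators:
  every linear map is composed of maps into coordinate hyperplanes, diagonal maps, transpositions and
  shears (\<open>induct_linear_elementary\<close>), and both sides are multiplicative.  Absolute values make
  the order of the basis irrelevant.\<close>

lemma alternating_det:
  fixes L :: "real^'m::finite \<Rightarrow> real^'m"
  assumes L: "linear L" and ks: "distinct ks" "set ks = (UNIV :: 'm set)"
    and f: "alternating CARD('m) f"
  shows "\<bar>f (map L (map (\<lambda>k. axis k 1) ks))\<bar> = \<bar>det (matrix L)\<bar> * \<bar>f (map (\<lambda>k. axis k 1) ks)\<bar>"
proof -
  define es :: "(real^'m) list" where "es = map (\<lambda>k. axis k 1) ks"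
  have len: "length ks = CARD('m)" using ks by (metis distinct_card)
  have les: "length es = CARD('m)" by (simp add: es_def len)
  have pos: "\<exists>p<CARD('m). ks ! p = k" for k
    using ks len by (metis UNIV_I in_set_conv_nth)
  have es_nth: "es ! p = axis (ks ! p) 1" if "p < CARD('m)" for p
    using that len by (simp add: es_def)
  have ks_inj: "ks ! p = ks ! q \<longleftrightarrow> p = q" if "p < CARD('m)" "q < CARD('m)" for p q
    using that ks len nth_eq_iff_index_eq by metis
  let ?P = "\<lambda>L :: real^'m \<Rightarrow> real^'m. \<forall>f. alternating CARD('m) f \<longrightarrow>
    \<bar>f (map L es)\<bar> = \<bar>det (matrix L)\<bar> * \<bar>f es\<bar>"
  have "?P L"
  proof (rule induct_linear_elementary[OF L]; intro allI impI)
    fix L M :: "real^'m \<Rightarrow> real^'m" and f :: "(real^'m) list \<Rightarrow> real"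
    assume L: "linear L" and M: "linear M" and PL: "?P L" and PM: "?P M"
      and f: "alternating CARD('m) f"
    have "\<bar>f (map L (map M es))\<bar> = \<bar>det (matrix M)\<bar> * \<bar>f (map L es)\<bar>"
      using PM alternating_compose[OF f L] by blast
    also have "\<dots> = \<bar>det (matrix M)\<bar> * (\<bar>det (matrix L)\<bar> * \<bar>f es\<bar>)"
      using PL f by simp
    finally show "\<bar>f (map (L \<circ> M) es)\<bar> = \<bar>det (matrix (L \<circ> M))\<bar> * \<bar>f es\<bar>"
      using matrix_compose[OF M L] by (simp add: det_mul abs_mult)
  next
    fix L :: "real^'m \<Rightarrow> real^'m" and i and f :: "(real^'m) list \<Rightarrow> real"
    assume L: "linear L" and 0: "\<And>x. L x $ i = 0" and f: "alternating CARD('m) f"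
    \<comment> \<open>A map into a coordinate hyperplane has determinant zero, and it sends the basis
      to a linearly dependent list, on which an alternating form vanishes.\<close>
    have "\<not> inj L"
      by (metis (full_types) L 0 linear_injective_imp_surjective one_neq_zero surjE vec_component)
    then have det: "det (matrix L) = 0"
      using det_nz_iff_inj[OF L] by blast
    define vs where "vs = map L es"
    have lvs: "length vs = CARD('m)" by (simp add: vs_def les)
    have "f vs = 0"
    proof (cases "distinct vs")
      case False
      then obtain p q where "p < length vs" "q < length vs" "p \<noteq> q" "vs ! p = vs ! q"
        by (auto simp: distinct_conv_nth)
      then show ?thesis using alternating_eq_0[OF f lvs] lvs by auto
    next
      case True
      have "span (set vs) \<subseteq> {x. x $ i = 0}"
        by (rule span_minimal) (auto simp: vs_def 0 subspace_def)
      then have notin: "axis i 1 \<notin> span (set vs)" by auto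
      have "\<not> independent (set vs)"
      proof
        assume "independent (set vs)"
        then have "independent (insert (axis i 1) (set vs))"
          using notin by (simp add: independent_insert span_base)
        then have "card (insert (axis i 1) (set vs)) \<le> DIM(real^'m)"
          using independent_bound by blast
        moreover have "axis i 1 \<notin> set vs" using notin span_base by blast
        ultimately show False
          using True lvs by (simp add: distinct_card)
      qed
      then obtain a where a: "a \<in> set vs" "a \<in> span (set vs - {a})"
        by (auto simp: dependent_def)
      then obtain p where p: "p < CARD('m)" "vs ! p = a"
        using lvs by (metis in_set_conv_nth)
      have "set vs - {a} \<subseteq> {vs ! j |j. j < CARD('m) \<and> j \<noteq> p}"
        using lvs p by (auto simp: in_set_conv_nth)
      then have "vs ! p \<in> span {vs ! j |j. j < CARD('m) \<and> j \<noteq> p}"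
        using a p span_mono by blast
      then show ?thesis using alternating_dependent[OF f lvs p(1)] by blast
    qed
    then show "\<bar>f (map L es)\<bar> = \<bar>det (matrix L)\<bar> * \<bar>f es\<bar>"
      by (simp add: det vs_def)
  next
    fix c and f :: "(real^'m) list \<Rightarrow> real" assume f: "alternating CARD('m) f"
    let ?L = "\<lambda>x::real^'m. \<chi> i. c i * x $ i"
    have "map ?L es = map (\<lambda>p. c (ks ! p) *\<^sub>R es ! p) [0..<CARD('m)]"
      by (intro nth_equalityI) (auto simp: les es_nth vec_eq_iff axis_def)
    then have "f (map ?L es) = (\<Prod>p<CARD('m). c (ks ! p)) * f es"
      using alternating_scale[OF f les] by simp
    also have "(\<Prod>p<CARD('m). c (ks ! p)) = (\<Prod>k\<in>UNIV. c k)"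
      using bij_betw_nth[OF ks(1)] ks(2) len
      by (intro prod.reindex_bij_betw) (auto simp: atLeast0LessThan)
    also have "\<dots> = det (matrix ?L)"
      by (subst det_diagonal) (auto simp: matrix_def axis_def)
    finally show "\<bar>f (map ?L es)\<bar> = \<bar>det (matrix ?L)\<bar> * \<bar>f es\<bar>"
      by (simp add: abs_mult)
  next
    fix m n :: 'm and f :: "(real^'m) list \<Rightarrow> real"
    assume mn: "m \<noteq> n" and f: "alternating CARD('m) f"
    let ?h = "\<lambda>v::real^'m. \<chi> i. v $ Transposition.transpose m n i"
    have "(\<chi> i j. if Transposition.transpose m n i = j then 1 else 0)
        = (\<chi> i j. if j = Transposition.transpose m n i then 1 else (0::real))"
      by (auto intro!: Cart_lambda_cong)
    then have "matrix ?h = transpose(\<chi> i j. mat 1 $ i $ Transposition.transpose m n j)"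
      by (auto simp: matrix_eq transpose_def axis_def mat_def matrix_def)
    then have 1: "\<bar>det (matrix ?h)\<bar> = 1"
      by (simp add: det_permute_columns permutes_swap_id sign_swap_id abs_mult)
    obtain p q where p: "p < CARD('m)" "ks ! p = m" and q: "q < CARD('m)" "ks ! q = n"
      using pos by meson
    have pq: "p \<noteq> q" using mn p q by auto
    have ax: "?h (axis k 1) = axis (Transposition.transpose m n k) 1" for k
      by (auto simp: vec_eq_iff axis_def)
    have "map ?h es = es[p := es ! q, q := es ! p]"
    proof (intro nth_equalityI)
      fix r assume "r < length (map ?h es)"
      then have r: "r < CARD('m)" by (simp add: les)
      have "map ?h es ! r = axis (Transposition.transpose m n (ks ! r)) 1"
        using r by (simp add: les es_nth ax)
      also have "\<dots> = es[p := es ! q, q := es ! p] ! r"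
        using r p q pq ks_inj[OF r p(1)] ks_inj[OF r q(1)]
        by (auto simp: nth_list_update les es_nth Transposition.transpose_def)
      finally show "map ?h es ! r = es[p := es ! q, q := es ! p] ! r" .
    qed simp
    then have "f (map ?h es) = - f es"
      using alternating_swap[OF f les p(1) q(1) pq] by simp
    then show "\<bar>f (map ?h es)\<bar> = \<bar>det (matrix ?h)\<bar> * \<bar>f es\<bar>"
      by (simp add: 1)
  next
    fix m n :: 'm and f :: "(real^'m) list \<Rightarrow> real"
    assume mn: "m \<noteq> n" and f: "alternating CARD('m) f"
    \<comment> \<open>The shear changes the basis only in one place, where it adds another basis vector; that
      summand repeats an argument and drops out.\<close>
    let ?h = "\<lambda>v::real^'m. \<chi> i. if i = m then v $ m + v $ n else v $ i"
    have "matrix ?h = (\<chi> k. if k = m then row m (mat 1) + 1 *s row n (mat 1) else row k (mat 1))"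
      by (auto simp: vec_eq_iff matrix_def row_def mat_def axis_def)
    then have 1: "det (matrix ?h) = 1"
      using det_row_operation[OF mn, of "mat 1 :: real^'m^'m" 1] by simp
    obtain p q where p: "p < CARD('m)" "ks ! p = m" and q: "q < CARD('m)" "ks ! q = n"
      using pos by meson
    have pq: "p \<noteq> q" using mn p q by auto
    have "map ?h es = es[q := es ! q + es ! p]"
    proof (intro nth_equalityI)
      fix r assume "r < length (map ?h es)"
      then have r: "r < CARD('m)" by (simp add: les)
      show "map ?h es ! r = es[q := es ! q + es ! p] ! r"
        using r p q pq mn ks_inj[OF r p(1)] ks_inj[OF r q(1)]
        by (auto simp: nth_list_update les es_nth vec_eq_iff axis_def)
    qed simp
    moreover have "f (es[q := es ! q + es ! p]) = f (es[q := es ! q]) + f (es[q := es ! p])"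
      by (rule linear_add[OF alternating_linear[OF f les q(1)]])
    ultimately have "f (map ?h es) = f (es[q := es ! q]) + f (es[q := es ! p])"
      by simp
    moreover have "f (es[q := es ! p]) = 0"
      using p q pq les by (intro alternating_eq_0[OF f, of _ q p]) auto
    ultimately show "\<bar>f (map ?h es)\<bar> = \<bar>det (matrix ?h)\<bar> * \<bar>f es\<bar>"
      by (simp add: 1)
  qed
  then show ?thesis using f by (simp add: es_def)
qed

section \<open>Powers of two-forms in charts\<close>

lemma linear_mult_both:
  fixes F :: "'v::real_vector \<Rightarrow> real"
  assumes "linear F"
  shows "linear (\<lambda>v. a * F v * b)"
  using linear_add[OF assms] linear_scale[OF assms]
  by (intro linearI) (auto simp: algebra_simps)

text \<open>Each summand is linear in each argument, since a permutation puts a given argument into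
  exactly one of the two factors.  If two arguments agree, composing with their transposition
  matches the summands in pairs of opposite sign.\<close>

lemma wedge_alternating:
  fixes \<omega> \<eta> :: "('a, 'n::finite) form"
  assumes f: "alternating k (\<omega> c p)" and g: "alternating l (\<eta> c p)"
  shows "alternating (k + l) (wedge k l \<omega> \<eta> c p)"
proof -
  let ?t = "\<lambda>vs \<sigma>. of_int (sign \<sigma>) * \<omega> c p (map (\<lambda>i. vs ! \<sigma> i) [0..<k])
    * \<eta> c p (map (\<lambda>i. vs ! \<sigma> i) [k..<k + l])"
  have W: "wedge k l \<omega> \<eta> c p vs = (\<Sum>\<sigma> | \<sigma> permutes {..<k + l}. ?t vs \<sigma>) / (fact k * fact l)"
    if "length vs = k + l" for vs
    using that by (simp add: wedge_def)
  have lin: "linear (\<lambda>v. ?t (vs[i := v]) \<sigma>)"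
    if vs: "length vs = k + l" and i: "i < k + l" and \<sigma>: "\<sigma> permutes {..<k + l}" for vs i \<sigma>
  proof -
    obtain a where a: "a < k + l" "\<sigma> a = i"
      using i permutes_image[OF \<sigma>] by (metis image_iff lessThan_iff)
    have inj: "\<sigma> b = i \<longleftrightarrow> b = a" for b
      using a permutes_inj[OF \<sigma>] by (auto simp: inj_def)
    then have inj': "i = \<sigma> b \<longleftrightarrow> b = a" for b
      by metis
    have lt: "\<sigma> b < k + l" if "b < k + l" for b
      using that permutes_in_image[OF \<sigma>, of b] by simp
    let ?U = "map (\<lambda>i. vs ! \<sigma> i) [0..<k]" and ?V = "map (\<lambda>i. vs ! \<sigma> i) [k..<k + l]"
    show ?thesis
    proof (cases "a < k")
      case True
      have 1: "map (\<lambda>b. vs[i := v] ! \<sigma> b) [0..<k] = ?U[a := v]" for v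
        using True vs i lt inj' by (intro nth_equalityI) (auto simp: nth_list_update)
      have 2: "map (\<lambda>b. vs[i := v] ! \<sigma> b) [k..<k + l] = ?V" for v
        using True vs i lt inj' by (intro nth_equalityI) (auto simp: nth_list_update)
      have "linear (\<lambda>v. \<omega> c p (?U[a := v]))"
        using True by (intro alternating_linear[OF f]) auto
      then show ?thesis
        unfolding 1 2 by (rule linear_mult_both)
    next
      case False
      have 1: "map (\<lambda>b. vs[i := v] ! \<sigma> b) [k..<k + l] = ?V[a - k := v]" for v
        using False a vs i lt inj' by (intro nth_equalityI) (auto simp: nth_list_update)
      have 2: "map (\<lambda>b. vs[i := v] ! \<sigma> b) [0..<k] = ?U" for v
        using False vs i lt inj' by (intro nth_equalityI) (auto simp: nth_list_update)
      have "linear (\<lambda>v. \<eta> c p (?V[a - k := v]))"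
        using False a by (intro alternating_linear[OF g]) auto
      then show ?thesis
        unfolding 1 2
        using linear_mult_both[of _ "of_int (sign \<sigma>) * \<omega> c p ?U" 1] by simp
    qed
  qed
  show ?thesis
    unfolding alternating_def
  proof (intro allI impI conjI)
    fix vs :: "(complex^'n) list" and i assume vs: "length vs = k + l" and i: "i < k + l"
    have "linear (\<lambda>v. \<Sum>\<sigma> | \<sigma> permutes {..<k + l}. ?t (vs[i := v]) \<sigma>)"
      using lin[OF vs i] by (intro linear_compose_sum) auto
    then show "linear (\<lambda>v. wedge k l \<omega> \<eta> c p (vs[i := v]))"
      using linear_mult_both[of _ 1 "1 / (fact k * fact l)"] by (simp add: W vs)
  next
    fix vs :: "(complex^'n) list" and i j
    assume vs: "length vs = k + l" and ij: "i < j \<and> j < k + l \<and> vs ! i = vs ! j"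
    let ?q = "Transposition.transpose i j"
    have q: "?q permutes {..<k + l}" using ij by (intro permutes_swap_id) auto
    have "(\<Sum>\<sigma> | \<sigma> permutes {..<k + l}. ?t vs \<sigma>)
        = (\<Sum>\<sigma> | \<sigma> permutes {..<k + l}. ?t vs (?q \<circ> \<sigma>))"
      proof (rule sum.reindex_bij_witness[of _ "\<lambda>\<sigma>. ?q \<circ> \<sigma>" "\<lambda>\<sigma>. ?q \<circ> \<sigma>"])
      have qq: "?q \<circ> (?q \<circ> \<sigma>) = \<sigma>" for \<sigma>
        by (simp add: fun_eq_iff)
      show "?q \<circ> (?q \<circ> \<sigma>) = \<sigma>" "?q \<circ> (?q \<circ> \<sigma>) = \<sigma>"
        "?t vs (?q \<circ> (?q \<circ> \<sigma>)) = ?t vs \<sigma>" for \<sigma>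
        by (simp_all only: qq)
    qed (use q permutes_compose in auto)
    also have "\<dots> = (\<Sum>\<sigma> | \<sigma> permutes {..<k + l}. - ?t vs \<sigma>)"
    proof (rule sum.cong)
      fix \<sigma> assume "\<sigma> \<in> {\<sigma>. \<sigma> permutes {..<k + l}}"
      then have \<sigma>: "\<sigma> permutes {..<k + l}" by simp
      have "vs ! (?q \<circ> \<sigma>) b = vs ! \<sigma> b" for b
        using ij by (auto simp: Transposition.transpose_def)
      moreover have "sign (?q \<circ> \<sigma>) = - sign \<sigma>"
        using ij \<sigma> q by (subst sign_compose)
          (auto simp: sign_swap_id permutation_permutes intro: exI[of _ "{..<k + l}"])
      ultimately show "?t vs (?q \<circ> \<sigma>) = - ?t vs \<sigma>" by simp
    qed simp
    finally have "(\<Sum>\<sigma> | \<sigma> permutes {..<k + l}. ?t vs \<sigma>) = 0"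
      by (simp add: sum_negf)
    then show "wedge k l \<omega> \<eta> c p vs = 0"
      by (simp only: W[OF vs])
  qed
qed

lemma smooth_form_alternating:
  "smooth_form A k \<omega> \<Longrightarrow> c \<in> A \<Longrightarrow> p \<in> fst c \<Longrightarrow> alternating k (\<omega> c p)"
  unfolding smooth_form_def alternating_def by blast

lemma wpow_alternating:
  assumes "smooth_form A 2 \<omega>" "c \<in> A" "p \<in> fst c"
  shows "alternating (2 * m) (wpow A \<omega> m c p)"
proof (induction m)
  case 0 then show ?case by (simp add: alternating_def)
next
  case (Suc m)
  have "alternating (2 + 2 * m) (wedge 2 (2 * m) \<omega> (wpow A \<omega> m) c p)"
    using smooth_form_alternating[OF assms] Suc by (rule wedge_alternating)
  then show ?case by simp
qed

text \<open>Pull-back commutes with the wedge product; stated for a change of chart.\<close>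

lemma wedge_transform:
  assumes \<omega>: "\<And>vs. length vs = k \<Longrightarrow> \<omega> c p vs = \<omega> d p (map L vs)"
    and \<eta>: "\<And>vs. length vs = l \<Longrightarrow> \<eta> c p vs = \<eta> d p (map L vs)"
  shows "wedge k l \<omega> \<eta> c p vs = wedge k l \<omega> \<eta> d p (map L vs)"
proof (cases "length vs = k + l")
  case True
  have "\<omega> c p (map (\<lambda>i. vs ! \<sigma> i) [0..<k]) = \<omega> d p (map (\<lambda>i. map L vs ! \<sigma> i) [0..<k])"
    "\<eta> c p (map (\<lambda>i. vs ! \<sigma> i) [k..<k + l]) = \<eta> d p (map (\<lambda>i. map L vs ! \<sigma> i) [k..<k + l])"
    if "\<sigma> permutes {..<k + l}" for \<sigma>
  proof -
    have "\<sigma> i < length vs" if "i < k + l" for i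
      using that permutes_in_image[OF \<open>\<sigma> permutes {..<k + l}\<close>, of i] True by simp
    then have 1: "map (\<lambda>i. map L vs ! \<sigma> i) [0..<k] = map L (map (\<lambda>i. vs ! \<sigma> i) [0..<k])"
      and 2: "map (\<lambda>i. map L vs ! \<sigma> i) [k..<k + l] = map L (map (\<lambda>i. vs ! \<sigma> i) [k..<k + l])"
      by auto
    then show "\<omega> c p (map (\<lambda>i. vs ! \<sigma> i) [0..<k]) = \<omega> d p (map (\<lambda>i. map L vs ! \<sigma> i) [0..<k])"
      "\<eta> c p (map (\<lambda>i. vs ! \<sigma> i) [k..<k + l]) = \<eta> d p (map (\<lambda>i. map L vs ! \<sigma> i) [k..<k + l])"
      unfolding 1 2 by (simp_all only: \<omega> \<eta> length_map length_upt diff_zero diff_add_inverse)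
  qed
  then show ?thesis
    using True unfolding wedge_def by (auto intro!: arg_cong2[where f = "(/)"] sum.cong)
next
  case False then show ?thesis by (simp add: wedge_def)
qed

lemma wpow_transform:
  assumes \<omega>: "smooth_form A 2 \<omega>" and "c \<in> A" "d \<in> A" "p \<in> fst c \<inter> fst d"
  shows "wpow A \<omega> m c p vs = wpow A \<omega> m d p (map (transition_deriv c d p) vs)"
proof (induction m arbitrary: vs)
  case 0 then show ?case using assms by auto
next
  case (Suc m)
  have "\<omega> c p vs = \<omega> d p (map (transition_deriv c d p) vs)" if "length vs = 2" for vs
    using assms that unfolding smooth_form_def by blast
  then show ?case using Suc by (auto intro: wedge_transform)
qed

lemma smooth_on_continuous: "smooth_on S f \<Longrightarrow> continuous_on S f"
  unfolding smooth_on_def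
  by (metis continuous_at_imp_continuous_on differentiable_imp_continuous_within iter_deriv.simps(1))

lemma cinv_mem: "x \<in> snd c ` fst c \<Longrightarrow> cinv c x \<in> fst c"
  unfolding cinv_def by (rule inv_into_into)

lemma wpow_continuous:
  assumes \<omega>: "smooth_form A 2 \<omega>" and c: "c \<in> A"
  shows "continuous_on (snd c ` fst c) (\<lambda>x. wpow A \<omega> m c (cinv c x) vs)"
proof (induction m arbitrary: vs)
  case 0
  show ?case
    by (rule continuous_on_eq[of _ "\<lambda>_. if vs = [] then 1 else 0"]) (auto simp: c cinv_mem)
next
  case (Suc m)
  have cont: "continuous_on (snd c ` fst c) (\<lambda>x. \<omega> c (cinv c x) vs)" if "length vs = 2" for vs
    using \<omega> c that unfolding smooth_form_def by (blast intro: smooth_on_continuous)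
  show ?case
    unfolding wpow.simps wedge_def
    by (cases "length vs = 2 + 2 * m") (auto intro!: continuous_intros cont Suc)
qed

text \<open>The frame used for densities is the standard real basis in some order, so it corresponds to a
  permutation of the coordinate axes of the real model.\<close>

lemma frame_coord_basis:
  obtains ks where "distinct ks" "set ks = UNIV"
    "(frame :: (complex^'n::finite) list) = map (\<lambda>k. of_coords (axis k 1)) ks"
proof -
  define js :: "'n list" where "js = (SOME js. distinct js \<and> set js = UNIV)"
  have "\<exists>js :: 'n list. distinct js \<and> set js = UNIV"
    using finite_distinct_list[OF finite, of "UNIV :: 'n set"] by metis
  then have js: "distinct js" "set js = UNIV"
    unfolding js_def by (metis (mono_tags, lifting) someI_ex)+
  have fr: "(frame :: (complex^'n) list) = concat (map (\<lambda>j. [axis j 1, axis j \<i>]) js)"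
    unfolding frame_def js_def ..
  have set: "set (frame :: (complex^'n) list) = Basis"
    unfolding fr by (auto simp: js Basis_vec_def Basis_complex_def)
  have "length (frame :: (complex^'n) list) = 2 * length js"
    unfolding fr by (induction js) auto
  then have "card (set (frame :: (complex^'n) list)) = length (frame :: (complex^'n) list)"
    using distinct_card[OF js(1)] by (simp add: set js)
  then have dist: "distinct (frame :: (complex^'n) list)"
    by (rule card_distinct)
  have cb: "of_coords (axis k 1) = coord_basis k" for k :: "'n bit0"
    by (simp add: of_coords_def axis_def if_distrib[of "\<lambda>c. c *\<^sub>R _"] sum.delta cong: if_cong)
  let ?ks = "map (inv_into UNIV coord_basis) (frame :: (complex^'n) list)"
  have surj: "coord_basis (inv_into UNIV coord_basis b) = b" if "b \<in> Basis" for b :: "complex^'n"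
    using that bij_coord_basis[where 'n = 'n] f_inv_into_f[of b coord_basis UNIV]
    by (auto simp: bij_betw_def)
  have inj: "inj (coord_basis :: 'n bit0 \<Rightarrow> complex^'n)"
    using bij_coord_basis by (auto simp: bij_betw_def)
  have "distinct ?ks"
    using dist surj by (auto simp: distinct_map set inj_on_def) metis
  moreover have "set ?ks = UNIV"
    using inj by (auto simp: set image_iff) (metis coord_basis_in_Basis inv_f_f)
  moreover have "frame = map (\<lambda>k. of_coords (axis k 1)) ?ks"
    using surj by (auto simp: cb set intro!: map_idI[symmetric])
  ultimately show ?thesis using that by blast
qed

text \<open>The transformation law that makes the absolute value of a top-degree form a measure.\<close>

lemma alternating_frame_jacobian:
  fixes L :: "complex^'n::finite \<Rightarrow> complex^'n"
  assumes f: "alternating (2 * CARD('n)) f" and L: "linear L"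
  shows "\<bar>f (map L frame)\<bar> = jacobian L * \<bar>f frame\<bar>"
proof -
  obtain ks where ks: "distinct ks" "set ks = (UNIV :: 'n bit0 set)"
    and fr: "(frame :: (complex^'n) list) = map (\<lambda>k. of_coords (axis k 1)) ks"
    by (rule frame_coord_basis)
  let ?L = "re_coords \<circ> L \<circ> of_coords" and ?es = "map (\<lambda>k. axis k 1 :: real^('n bit0)) ks"
  have g: "alternating CARD('n bit0) (\<lambda>vs. f (map of_coords vs))"
    using alternating_compose[OF f linear_of_coords] by simp
  have "linear ?L"
    by (intro linear_compose linear_of_coords linear_re_coords L)
  from alternating_det[OF this ks g] show ?thesis
    by (simp add: fr o_def jacobian_def)
qed

section \<open>The measure of a volume form\<close>

lemma sum_axis_components: "(\<Sum>j\<in>UNIV. axis j (x $ j)) = (x :: 'b::comm_monoid_add^'n::finite)"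
  by (simp add: vec_eq_iff axis_def sum.delta' cong: if_cong)

lemma differentiable_of_components:
  fixes f :: "'v::real_normed_vector \<Rightarrow> complex^'m::finite"
  assumes "\<And>j. (\<lambda>z. f z $ j) differentiable (at z)"
  shows "f differentiable (at z)"
proof -
  have "bounded_linear (axis j :: complex \<Rightarrow> complex^'m)" for j
    by (intro linear_conv_bounded_linear[THEN iffD1] linearI) (auto simp: vec_eq_iff axis_def)
  then have "(\<lambda>z. axis j (f z $ j)) differentiable (at z)" for j
    using assms[of j] bounded_linear.has_derivative[of "axis j :: complex \<Rightarrow> complex^'m"]
    unfolding differentiable_def by blast
  then have "(\<lambda>z. \<Sum>j\<in>UNIV. axis j (f z $ j)) differentiable (at z)"
    by (intro differentiable_sum) auto
  then show ?thesis by (simp add: sum_axis_components)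
qed

lemma hol_map_on_differentiable: "hol_map_on S f \<Longrightarrow> z \<in> S \<Longrightarrow> f differentiable (at z)"
  unfolding hol_map_on_def hol_on_def
  by (rule differentiable_of_components) (unfold differentiable_def, blast)

lemma indicator_absorb:
  "S \<subseteq> T \<Longrightarrow> indicator S y * a * indicator T y = (a * indicator S y :: ennreal)"
  by (auto simp: indicator_def)

context
  fixes A :: "('a::t2_space, 'n::finite) chart set"
  assumes X: "compact_complex_manifold A"
begin

lemma open_chart_domain: "c \<in> A \<Longrightarrow> open (fst c)"
  and open_chart_image: "c \<in> A \<Longrightarrow> open (snd c ` fst c)"
  and chart_homeomorphism: "c \<in> A \<Longrightarrow> homeomorphism (fst c) (snd c ` fst c) (snd c) (cinv c)"
  using X unfolding compact_complex_manifold_def by blast+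

lemma charts_cover: "\<exists>c\<in>A. p \<in> fst c"
  using X unfolding compact_complex_manifold_def by blast

lemma cinv_chart: "c \<in> A \<Longrightarrow> p \<in> fst c \<Longrightarrow> cinv c (snd c p) = p"
  using chart_homeomorphism homeomorphism_apply1 by metis

lemma chart_cinv: "c \<in> A \<Longrightarrow> x \<in> snd c ` fst c \<Longrightarrow> snd c (cinv c x) = x"
  using chart_homeomorphism homeomorphism_apply2 by metis

lemma continuous_cinv: "c \<in> A \<Longrightarrow> continuous_on (snd c ` fst c) (cinv c)"
  using chart_homeomorphism homeomorphism_cont2 by metis

lemma continuous_chart: "c \<in> A \<Longrightarrow> continuous_on (fst c) (snd c)"
  using chart_homeomorphism homeomorphism_cont1 by metis

lemma chart_image_eq_vimage:
  assumes "c \<in> A"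
  shows "snd c ` (B \<inter> fst c) = cinv c -` B \<inter> snd c ` fst c"
  using assms by (auto simp: cinv_chart)

lemma open_chart_image_subset:
  assumes c: "c \<in> A" and W: "open W"
  shows "open (snd c ` (W \<inter> fst c))"
  unfolding chart_image_eq_vimage[OF c]
  using continuous_open_preimage[OF continuous_cinv[OF c] open_chart_image[OF c] W]
  by (simp add: Int_commute)

lemma open_chart_vimage:
  assumes c: "c \<in> A" and U: "open U"
  shows "open {p \<in> fst c. snd c p \<in> U}"
  using continuous_open_preimage[OF continuous_chart[OF c] open_chart_domain[OF c] U]
  by (simp add: Int_def vimage_def)

lemma borel_chart_image:
  assumes c: "c \<in> A" and B: "B \<in> sets borel"
  shows "snd c ` (B \<inter> fst c) \<in> sets borel"
proof -
  have "cinv c \<in> measurable (restrict_space borel (snd c ` fst c)) borel"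
    using continuous_cinv[OF c] by (rule borel_measurable_continuous_on_restrict)
  from measurable_sets[OF this B] show ?thesis
    using open_chart_image[OF c]
    by (simp add: chart_image_eq_vimage[OF c] sets_restrict_space_iff space_restrict_space)
qed

lemma transition_has_derivative:
  assumes "c \<in> A" "d \<in> A" "p \<in> fst c" "p \<in> fst d"
  shows "((snd d \<circ> cinv c) has_derivative transition_deriv c d p) (at (snd c p))"
proof -
  have "hol_map_on (snd c ` (fst c \<inter> fst d)) (snd d \<circ> cinv c)"
    using X assms unfolding compact_complex_manifold_def by blast
  then have "(snd d \<circ> cinv c) differentiable (at (snd c p))"
    using assms by (intro hol_map_on_differentiable) auto
  then show ?thesis
    unfolding transition_deriv_def frechet_derivative_works .
qed

text \<open>The measure that a volume form induces through one chart: the push-forward of its density.\<close>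

definition chart_measure :: "('a, 'n) form \<Rightarrow> ('a, 'n) chart \<Rightarrow> 'a measure" where
  "chart_measure \<tau> c = distr (with_density (restrict_space lborel (snd c ` fst c))
     (\<lambda>x. ennreal \<bar>density \<tau> c (cinv c x)\<bar>)) borel (cinv c)"

context
  fixes \<tau> :: "('a, 'n) form"
  assumes cont: "\<And>c. c \<in> A \<Longrightarrow> continuous_on (snd c ` fst c) (\<lambda>x. density \<tau> c (cinv c x))"
begin

lemma measurable_abs_density:
  "c \<in> A \<Longrightarrow> (\<lambda>x. ennreal \<bar>density \<tau> c (cinv c x)\<bar>) \<in>
     borel_measurable (restrict_space borel (snd c ` fst c))"
  by (intro measurable_compose[OF borel_measurable_abs measurable_ennreal]
      borel_measurable_continuous_on_restrict cont)

lemma measurable_cinv: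
  "c \<in> A \<Longrightarrow> cinv c \<in> measurable (restrict_space borel (snd c ` fst c)) borel"
  using continuous_cinv by (rule borel_measurable_continuous_on_restrict)

lemma measurable_cong_lborel:
  "measurable (restrict_space lborel S) N = measurable (restrict_space borel S) N"
  by (rule measurable_cong_sets) (auto simp: sets_restrict_space)

lemma nn_integral_chart_measure:
  assumes c: "c \<in> A" and f: "f \<in> borel_measurable borel"
  shows "(\<integral>\<^sup>+p. f p \<partial>chart_measure \<tau> c) =
    (\<integral>\<^sup>+x\<in>snd c ` fst c. ennreal \<bar>density \<tau> c (cinv c x)\<bar> * f (cinv c x) \<partial>lborel)"
proof -
  have "(\<integral>\<^sup>+p. f p \<partial>chart_measure \<tau> c) =
    (\<integral>\<^sup>+x. ennreal \<bar>density \<tau> c (cinv c x)\<bar> * f (cinv c x)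
       \<partial>restrict_space lborel (snd c ` fst c))"
    unfolding chart_measure_def
    using measurable_cinv[OF c] measurable_abs_density[OF c] f
    by (subst nn_integral_distr)
      (auto simp: measurable_cong_lborel intro!: nn_integral_density measurable_compose[OF _ f])
  also have "\<dots> = (\<integral>\<^sup>+x\<in>snd c ` fst c. ennreal \<bar>density \<tau> c (cinv c x)\<bar> * f (cinv c x) \<partial>lborel)"
    using open_chart_image[OF c] by (intro nn_integral_restrict_space) auto
  finally show ?thesis .
qed

lemma emeasure_chart_measure:
  assumes c: "c \<in> A" and B: "B \<in> sets borel"
  shows "emeasure (chart_measure \<tau> c) B =
    (\<integral>\<^sup>+x\<in>snd c ` (B \<inter> fst c). ennreal \<bar>density \<tau> c (cinv c x)\<bar> \<partial>lborel)"
proof -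
  have "emeasure (chart_measure \<tau> c) B = (\<integral>\<^sup>+p. indicator B p \<partial>chart_measure \<tau> c)"
    using B by (simp add: chart_measure_def)
  also have "\<dots> = (\<integral>\<^sup>+x\<in>snd c ` fst c. ennreal \<bar>density \<tau> c (cinv c x)\<bar> * indicator B (cinv c x)
      \<partial>lborel)"
    using B by (intro nn_integral_chart_measure c) auto
  also have "\<dots> = (\<integral>\<^sup>+x\<in>snd c ` (B \<inter> fst c). ennreal \<bar>density \<tau> c (cinv c x)\<bar> \<partial>lborel)"
    unfolding chart_image_eq_vimage[OF c]
    by (intro nn_integral_cong) (auto split: split_indicator)
  finally show ?thesis .
qed

lemma sets_chart_measure [simp]: "sets (chart_measure \<tau> c) = sets borel"
  by (simp add: chart_measure_def)

context
  assumes trans: "\<And>c d p. c \<in> A \<Longrightarrow> d \<in> A \<Longrightarrow> p \<in> fst c \<Longrightarrow> p \<in> fst d \<Longrightarrow>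
    \<bar>density \<tau> c p\<bar> = jacobian (transition_deriv c d p) * \<bar>density \<tau> d p\<bar>"
begin

text \<open>On an overlap the two densities differ by the Jacobian of the transition map, so the two
  measures agree there by the change of variables formula.\<close>

lemma chart_measure_agree:
  assumes c: "c \<in> A" and d: "d \<in> A" and B: "B \<in> sets borel" "B \<subseteq> fst c" "B \<subseteq> fst d"
  shows "emeasure (chart_measure \<tau> c) B = emeasure (chart_measure \<tau> d) B"
proof -
  let ?U = "snd c ` (fst d \<inter> fst c)" and ?T = "snd d \<circ> cinv c"
  let ?g = "\<lambda>y. indicator (snd d ` (B \<inter> fst d)) y * ennreal \<bar>density \<tau> d (cinv d y)\<bar>"
  have TU: "?T ` ?U = snd d ` (fst c \<inter> fst d)"
    using c d by (auto simp: image_image cinv_chart intro!: image_eqI)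
  have Bd: "snd d ` (B \<inter> fst d) \<subseteq> ?T ` ?U"
    unfolding TU using B by auto
  have eq: "?g (?T x) * ennreal (jacobian (transition_deriv c d (cinv c x))) * indicator ?U x
      = ennreal \<bar>density \<tau> c (cinv c x)\<bar> * indicator (snd c ` (B \<inter> fst c)) x" for x
  proof (cases "x \<in> ?U")
    case True
    then obtain p where p: "p \<in> fst c" "p \<in> fst d" "x = snd c p" by auto
    have 1: "snd c p \<in> snd c ` (B \<inter> fst c) \<longleftrightarrow> p \<in> B" "snd d p \<in> snd d ` (B \<inter> fst d) \<longleftrightarrow> p \<in> B"
      using p c d by (auto simp: image_iff) (metis cinv_chart)+
    have "ennreal \<bar>density \<tau> d p\<bar> * ennreal (jacobian (transition_deriv c d p))
        = ennreal \<bar>density \<tau> c p\<bar>"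
      using trans[OF c d p(1,2)] by (simp add: jacobian_def mult.commute flip: ennreal_mult)
    then show ?thesis
      using True p by (auto simp: cinv_chart c d 1 split: split_indicator)
  next
    case False
    then have "x \<notin> snd c ` (B \<inter> fst c)" using B by auto
    with False show ?thesis by simp
  qed
  have meas: "(\<lambda>x. ennreal \<bar>density \<tau> e (cinv e x)\<bar> * indicator (snd e ` (B \<inter> fst e)) x)
      \<in> borel_measurable borel" if e: "e \<in> A" for e
  proof -
    have "(\<lambda>x. ennreal \<bar>density \<tau> e (cinv e x)\<bar> * indicator (snd e ` fst e) x) \<in> borel_measurable borel"
      using measurable_abs_density[OF e] open_chart_image[OF e]
      by (subst (asm) borel_measurable_restrict_space_iff_ennreal) auto
    then have "(\<lambda>x. (ennreal \<bar>density \<tau> e (cinv e x)\<bar> * indicator (snd e ` fst e) x)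
        * indicator (snd e ` (B \<inter> fst e)) x) \<in> borel_measurable borel"
      by (rule borel_measurable_times_ennreal)
         (rule borel_measurable_indicator[OF borel_chart_image[OF e B(1)]])
    then show ?thesis
      by (rule measurable_cong[THEN iffD1, rotated]) (auto split: split_indicator)
  qed
  have "emeasure (chart_measure \<tau> d) B = (\<integral>\<^sup>+y. ?g y * indicator (?T ` ?U) y \<partial>lborel)"
    unfolding indicator_absorb[OF Bd] by (rule emeasure_chart_measure[OF d B(1)])
  also have "\<dots> = (\<integral>\<^sup>+x. ?g (?T x) * ennreal (jacobian (transition_deriv c d (cinv c x)))
      * indicator ?U x \<partial>lborel)"
  proof (rule nn_integral_change_of_variables)
    show "open ?U" using c d by (intro open_chart_image_subset open_chart_domain)
    show "open (?T ` ?U)" unfolding TU using c d by (intro open_chart_image_subset open_chart_domain)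
    show "inj_on ?T ?U"
      using c d by (intro inj_onI) (auto simp: cinv_chart, metis cinv_chart)
    show "(?T has_derivative transition_deriv c d (cinv c x)) (at x)" if x: "x \<in> ?U" for x
    proof -
      obtain p where p: "p \<in> fst c" "p \<in> fst d" "x = snd c p" using x by auto
      then show ?thesis using transition_has_derivative[OF c d p(1,2)] by (simp add: cinv_chart c)
    qed
    show "?g \<in> borel_measurable borel"
      using meas[OF d] by (simp add: mult.commute)
    show "(\<lambda>x. ?g (?T x) * ennreal (jacobian (transition_deriv c d (cinv c x))) * indicator ?U x)
        \<in> borel_measurable borel"
      unfolding eq by (rule meas[OF c])
  qed
  also have "\<dots> = emeasure (chart_measure \<tau> c) B"
    unfolding eq emeasure_chart_measure[OF c B(1)] ..
  finally show ?thesis ..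
qed

text \<open>The measure of a form is a definite description, so existence and uniqueness are needed before
  it can be used at all.  By compactness finitely many charts cover the manifold; cutting their domains down to
  disjoint Borel pieces \<open>Q j\<close> and adding up the chart measures of the pieces gives a measure, and by
  \<open>chart_measure_agree\<close> it has the prescribed value in every chart.  The same cutting shows that the
  prescribed values determine it.\<close>

lemma form_measure_spec:
  "sets (form_measure A \<tau>) = sets borel \<and>
     (\<forall>c\<in>A. \<forall>B\<in>sets borel. B \<subseteq> fst c \<longrightarrow>
        emeasure (form_measure A \<tau>) B = emeasure (chart_measure \<tau> c) B)"
proof -
  let ?P = "\<lambda>M. sets M = sets borel \<and> (\<forall>c\<in>A. \<forall>B\<in>sets borel. B \<subseteq> fst c \<longrightarrow>
        emeasure M B = emeasure (chart_measure \<tau> c) B)"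
  obtain C where C: "C \<subseteq> A" "finite C" "UNIV \<subseteq> (\<Union>c\<in>C. fst c)"
  proof (rule compactE_image)
    show "compact (UNIV :: 'a set)" using X by (simp add: compact_complex_manifold_def)
    show "UNIV \<subseteq> (\<Union>c\<in>A. fst c)" using charts_cover by blast
  qed (auto intro: open_chart_domain)
  obtain cs where cs: "set cs = C" using C(2) finite_list by blast
  define m where "m = length cs"
  define Q where "Q = (\<lambda>j. fst (cs ! j) - (\<Union>k<j. fst (cs ! k)))"
  have csA: "cs ! j \<in> A" if "j < m" for j using that cs C by (auto simp: m_def)
  have Qb[measurable]: "Q j \<in> sets borel" if "j < m" for j
    unfolding Q_def using that csA
    by (intro sets.Diff sets.finite_UN borel_open open_chart_domain) auto
  have Qsub: "Q j \<subseteq> fst (cs ! j)" for j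
    unfolding Q_def by auto
  have disj: "disjoint_family_on Q {..<m}"
    unfolding disjoint_family_on_def Q_def
  proof (intro ballI impI)
    fix i j assume "i \<in> {..<m}" "j \<in> {..<m}" "i \<noteq> j"
    then show "(fst (cs ! i) - (\<Union>k<i. fst (cs ! k))) \<inter> (fst (cs ! j) - (\<Union>k<j. fst (cs ! k))) = {}"
      by (cases rule: linorder_cases[of i j]) auto
  qed
  have cover: "(\<Union>j<m. Q j) = UNIV"
  proof (intro set_eqI iffI UNIV_I)
    fix p :: 'a
    obtain j where "j < m" "p \<in> fst (cs ! j)"
      using C(3) cs by (auto simp: m_def) (metis UNIV_I UN_E in_set_conv_nth subsetD)
    then have "\<exists>j. j < m \<and> p \<in> fst (cs ! j)" by blast
    then obtain j where j: "j < m" "p \<in> fst (cs ! j)"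
      and min: "\<And>k. k < j \<Longrightarrow> \<not> (k < m \<and> p \<in> fst (cs ! k))"
      using exists_least_iff[of "\<lambda>j. j < m \<and> p \<in> fst (cs ! j)"] by blast
    then have "p \<in> Q j" unfolding Q_def by force
    with j show "p \<in> (\<Union>j<m. Q j)" by blast
  qed
  have split: "emeasure M B = (\<Sum>j<m. emeasure M (B \<inter> Q j))"
    if M: "sets M = sets borel" and B: "B \<in> sets borel" for M :: "'a measure" and B
  proof -
    have "(\<Sum>j<m. emeasure M (B \<inter> Q j)) = emeasure M (\<Union>j<m. B \<inter> Q j)"
      using disj B M by (intro sum_emeasure) (auto simp: disjoint_family_on_def)
    also have "(\<Union>j<m. B \<inter> Q j) = B" using cover by blast
    finally show ?thesis ..
  qed
  define \<nu> where "\<nu> = (\<lambda>B. \<Sum>j<m. emeasure (chart_measure \<tau> (cs ! j)) (B \<inter> Q j))"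
  define M where "M = measure_of UNIV (sets borel) \<nu>"
  have setsM: "sets M = sets borel"
    unfolding M_def by (metis sets.sets_measure_of_eq space_borel)
  have emM: "emeasure M B = \<nu> B" if "B \<in> sets borel" for B
    unfolding M_def
  proof (rule emeasure_measure_of_sigma)
    show "sigma_algebra UNIV (sets (borel :: 'a measure))"
      by (metis sets.sigma_algebra_axioms space_borel)
    show "positive (sets borel) \<nu>" by (simp add: positive_def \<nu>_def)
    show "countably_additive (sets borel) \<nu>"
      unfolding countably_additive_def
    proof (intro allI impI)
      fix F :: "nat \<Rightarrow> 'a set"
      assume F: "range F \<subseteq> sets borel" "disjoint_family F" "(\<Union>i. F i) \<in> sets borel"
      have "(\<Sum>i. \<nu> (F i)) = (\<Sum>j<m. \<Sum>i. emeasure (chart_measure \<tau> (cs ! j)) (F i \<inter> Q j))"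
        unfolding \<nu>_def by (rule suminf_sum) simp
      also have "\<dots> = (\<Sum>j<m. emeasure (chart_measure \<tau> (cs ! j)) (\<Union>i. F i \<inter> Q j))"
        using F by (intro sum.cong refl suminf_emeasure) (auto simp: disjoint_family_on_def)
      also have "\<dots> = \<nu> (\<Union>i. F i)" by (simp add: \<nu>_def)
      finally show "(\<Sum>i. \<nu> (F i)) = \<nu> (\<Union>i. F i)" .
    qed
    show "B \<in> sets borel" by fact
  qed
  have "?P M"
  proof (intro conjI ballI impI setsM)
    fix c B assume c: "c \<in> A" and B: "B \<in> sets borel" "B \<subseteq> fst c"
    have "emeasure M B = (\<Sum>j<m. emeasure (chart_measure \<tau> (cs ! j)) (B \<inter> Q j))"
      using emM[OF B(1)] by (simp add: \<nu>_def)
    also have "\<dots> = (\<Sum>j<m. emeasure (chart_measure \<tau> c) (B \<inter> Q j))"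
      using B c csA by (intro sum.cong refl chart_measure_agree) (use Qsub in \<open>auto simp: Qb\<close>)
    also have "\<dots> = emeasure (chart_measure \<tau> c) B"
      using B by (intro split[symmetric]) auto
    finally show "emeasure M B = emeasure (chart_measure \<tau> c) B" .
  qed
  moreover have "N = M" if "?P N" for N
  proof (rule measure_eqI)
    show "sets N = sets M" using that setsM by simp
    fix B assume "B \<in> sets N"
    then have B: "B \<in> sets borel" using that by simp
    have "emeasure N B = (\<Sum>j<m. emeasure N (B \<inter> Q j))"
      using that B by (intro split) auto
    also have "\<dots> = (\<Sum>j<m. emeasure (chart_measure \<tau> (cs ! j)) (B \<inter> Q j))"
    proof (intro sum.cong refl)
      fix j assume "j \<in> {..<m}"
      then have "cs ! j \<in> A" "B \<inter> Q j \<in> sets borel" "B \<inter> Q j \<subseteq> fst (cs ! j)"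
        using csA B Qsub Qb by auto
      then show "emeasure N (B \<inter> Q j) = emeasure (chart_measure \<tau> (cs ! j)) (B \<inter> Q j)"
        using that by blast
    qed
    also have "\<dots> = emeasure M B" using emM[OF B] by (simp add: \<nu>_def)
    finally show "emeasure N B = emeasure M B" .
  qed
  ultimately have "\<exists>!M. ?P M" by metis
  then have "?P (THE M. ?P M)" by (rule theI')
  moreover have "form_measure A \<tau> = (THE M. ?P M)"
  proof -
    have "emeasure (chart_measure \<tau> c) B
        = (\<integral>\<^sup>+x\<in>snd c ` B. ennreal \<bar>density \<tau> c (cinv c x)\<bar> \<partial>lborel)"
      if "c \<in> A" "B \<in> sets borel" "B \<subseteq> fst c" for c B
      using emeasure_chart_measure[OF that(1,2)] that(3) by (simp add: Int_absorb2)
    then have "(\<lambda>M. sets M = sets borel \<and> (\<forall>c\<in>A. \<forall>B\<in>sets borel. B \<subseteq> fst c \<longrightarrow>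
        emeasure M B = (\<integral>\<^sup>+x\<in>snd c ` B. ennreal \<bar>density \<tau> c (cinv c x)\<bar> \<partial>lborel))) = ?P"
      by (intro ext) auto
    then show ?thesis unfolding form_measure_def by (rule arg_cong)
  qed
  ultimately show ?thesis by simp
qed

lemma nn_integral_form_measure_chart:
  assumes c: "c \<in> A" and f: "f \<in> borel_measurable borel"
  shows "(\<integral>\<^sup>+p\<in>fst c. f p \<partial>form_measure A \<tau>) =
    (\<integral>\<^sup>+x\<in>snd c ` fst c. ennreal \<bar>density \<tau> c (cinv c x)\<bar> * f (cinv c x) \<partial>lborel)"
proof -
  let ?M = "form_measure A \<tau>"
  have sM[simp]: "sets ?M = sets borel" using form_measure_spec by blast
  have fc[measurable]: "fst c \<in> sets borel" using open_chart_domain[OF c] by simp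
  have mM: "borel_measurable ?M = borel_measurable borel"
    by (rule measurable_cong_sets) auto
  have "with_density ?M (indicator (fst c)) = chart_measure \<tau> c"
  proof (rule measure_eqI)
    fix B assume "B \<in> sets (with_density ?M (indicator (fst c)))"
    then have B: "B \<in> sets borel" by simp
    have "emeasure (with_density ?M (indicator (fst c))) B = emeasure ?M (fst c \<inter> B)"
      using B by (subst emeasure_density) (simp_all add: mM flip: indicator_inter_arith)
    also have "\<dots> = emeasure (chart_measure \<tau> c) (fst c \<inter> B)"
      using B by (intro form_measure_spec[THEN conjunct2, rule_format, OF c]) auto
    also have "\<dots> = emeasure (chart_measure \<tau> c) B"
      using B c by (simp add: emeasure_chart_measure Int_ac)
    finally show "emeasure (with_density ?M (indicator (fst c))) B = emeasure (chart_measure \<tau> c) B" .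
  qed simp
  then have "(\<integral>\<^sup>+p. f p \<partial>chart_measure \<tau> c) = (\<integral>\<^sup>+p. indicator (fst c) p * f p \<partial>?M)"
    using f by (subst nn_integral_density[symmetric]) (simp_all add: mM)
  then show ?thesis
    using nn_integral_chart_measure[OF c f] by (simp add: mult.commute)
qed

end
end

text \<open>The two hypotheses of the preceding construction hold for the top power of a smooth two-form.\<close>

lemma kahler_volume_regular:
  assumes \<omega>: "smooth_form A 2 \<omega>"
  shows "c \<in> A \<Longrightarrow> continuous_on (snd c ` fst c) (\<lambda>x. density (wpow A \<omega> CARD('n)) c (cinv c x))"
    and "c \<in> A \<Longrightarrow> d \<in> A \<Longrightarrow> p \<in> fst c \<Longrightarrow> p \<in> fst d \<Longrightarrow>
      \<bar>density (wpow A \<omega> CARD('n)) c p\<bar>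
        = jacobian (transition_deriv c d p) * \<bar>density (wpow A \<omega> CARD('n)) d p\<bar>"
proof -
  show "continuous_on (snd c ` fst c) (\<lambda>x. density (wpow A \<omega> CARD('n)) c (cinv c x))"
    if "c \<in> A" unfolding density_def by (rule wpow_continuous[OF \<omega> that])
  assume c: "c \<in> A" and d: "d \<in> A" and p: "p \<in> fst c" "p \<in> fst d"
  have "linear (transition_deriv c d p)"
    using transition_has_derivative[OF c d p] by (rule has_derivative_linear)
  with wpow_alternating[OF \<omega> d p(2)] show "\<bar>density (wpow A \<omega> CARD('n)) c p\<bar>
        = jacobian (transition_deriv c d p) * \<bar>density (wpow A \<omega> CARD('n)) d p\<bar>"
    using wpow_transform[OF \<omega> c d, of p] p
    unfolding density_def by (simp add: alternating_frame_jacobian)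
qed

end

section \<open>Circle means of functions with semipositive Levi form\<close>

text \<open>A function of class \<open>C\<^sup>2\<close> with its first and second partial derivatives in the basis directions
  given explicitly, so that sums of smooth functions and quadratic polynomials can be treated alike.\<close>

definition c2_on :: "'v::euclidean_space set \<Rightarrow> ('v \<Rightarrow> real) \<Rightarrow> ('v \<Rightarrow> 'v \<Rightarrow> real)
    \<Rightarrow> ('v \<Rightarrow> 'v \<Rightarrow> 'v \<Rightarrow> real) \<Rightarrow> bool" where
  "c2_on V u u1 u2 \<longleftrightarrow>
     (\<forall>x\<in>V. (u has_derivative (\<lambda>v. \<Sum>b\<in>Basis. (v \<bullet> b) * u1 b x)) (at x) \<and>
        (\<forall>b\<in>Basis. (u1 b has_derivative (\<lambda>v. \<Sum>b'\<in>Basis. (v \<bullet> b') * u2 b' b x)) (at x))) \<and>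
     (\<forall>b\<in>Basis. \<forall>b'\<in>Basis. continuous_on V (u2 b' b))"

definition hess :: "('v::euclidean_space \<Rightarrow> 'v \<Rightarrow> 'v \<Rightarrow> real) \<Rightarrow> 'v \<Rightarrow> 'v \<Rightarrow> real" where
  "hess u2 x v = (\<Sum>b\<in>Basis. (v \<bullet> b) * (\<Sum>b'\<in>Basis. (v \<bullet> b') * u2 b' b x))"

text \<open>The Laplacian of \<open>\<zeta> \<mapsto> u (x + \<zeta> v)\<close> at zero, hence four times the classical Levi form.\<close>

definition levi :: "((complex^'n::finite) \<Rightarrow> complex^'n \<Rightarrow> complex^'n \<Rightarrow> real)
    \<Rightarrow> complex^'n \<Rightarrow> complex^'n \<Rightarrow> real" where
  "levi u2 x v = hess u2 x v + hess u2 x (\<i> *s v)"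

lemma norm_vector_smult: "norm (a *s w) = norm a * norm (w :: complex^'n::finite)"
  by (simp add: norm_vec_def norm_mult L2_set_right_distrib)

lemma bounded_linear_smult_left: "bounded_linear (\<lambda>a. a *s (w :: complex^'n::finite))"
  by (intro linear_conv_bounded_linear[THEN iffD1] linearI)
    (auto simp: vec_eq_iff algebra_simps)

lemma bounded_linear_smult_right: "bounded_linear (\<lambda>w. a *s (w :: complex^'n::finite))"
  by (intro linear_conv_bounded_linear[THEN iffD1] linearI)
    (auto simp: vec_eq_iff algebra_simps)

lemma c2_on_continuous:
  assumes "c2_on V u u1 u2"
  shows "continuous_on V u" and "b \<in> Basis \<Longrightarrow> continuous_on V (u1 b)"
  using assms unfolding c2_on_def
  by (auto intro!: continuous_at_imp_continuous_on has_derivative_continuous)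

lemma c2_on_chain1:
  assumes u: "c2_on V u u1 u2" and \<gamma>: "(\<gamma> has_vector_derivative v) (at s within S)" "\<gamma> s \<in> V"
  shows "((\<lambda>s. u (\<gamma> s)) has_vector_derivative (\<Sum>b\<in>Basis. (v \<bullet> b) * u1 b (\<gamma> s))) (at s within S)"
proof -
  have "(u has_derivative (\<lambda>v. \<Sum>b\<in>Basis. (v \<bullet> b) * u1 b (\<gamma> s))) (at (\<gamma> s))"
    using u \<gamma>(2) by (simp add: c2_on_def)
  then have "(u has_derivative (\<lambda>v. \<Sum>b\<in>Basis. (v \<bullet> b) * u1 b (\<gamma> s))) (at (\<gamma> s) within \<gamma> ` S)"
    by (rule has_derivative_at_withinI)
  from vector_derivative_diff_chain_within[OF \<gamma>(1) this] show ?thesis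
    by (simp add: o_def)
qed

lemma c2_on_chain2:
  assumes u: "c2_on V u u1 u2" and \<gamma>: "(\<gamma> has_vector_derivative v s) (at s within S)" "\<gamma> s \<in> V"
    and v: "(v has_vector_derivative a) (at s within S)"
  shows "((\<lambda>s. \<Sum>b\<in>Basis. (v s \<bullet> b) * u1 b (\<gamma> s)) has_vector_derivative
    hess u2 (\<gamma> s) (v s) + (\<Sum>b\<in>Basis. (a \<bullet> b) * u1 b (\<gamma> s))) (at s within S)"
proof -
  have "((\<lambda>s. (v s \<bullet> b) * u1 b (\<gamma> s)) has_vector_derivative
      (v s \<bullet> b) * (\<Sum>b'\<in>Basis. (v s \<bullet> b') * u2 b' b (\<gamma> s)) + (a \<bullet> b) * u1 b (\<gamma> s)) (at s within S)"
    if b: "b \<in> Basis" for b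
  proof (rule has_vector_derivative_mult)
    show "((\<lambda>s. v s \<bullet> b) has_vector_derivative a \<bullet> b) (at s within S)"
      using bounded_linear.has_vector_derivative[OF bounded_linear_inner_left v] .
    have "(u1 b has_derivative (\<lambda>v. \<Sum>b'\<in>Basis. (v \<bullet> b') * u2 b' b (\<gamma> s))) (at (\<gamma> s) within \<gamma> ` S)"
      using u \<gamma>(2) b by (simp add: c2_on_def has_derivative_at_withinI)
    from vector_derivative_diff_chain_within[OF \<gamma>(1) this]
    show "((\<lambda>s. u1 b (\<gamma> s)) has_vector_derivative (\<Sum>b'\<in>Basis. (v s \<bullet> b') * u2 b' b (\<gamma> s)))
        (at s within S)"
      by (simp add: o_def)
  qed
  then have "((\<lambda>s. \<Sum>b\<in>Basis. (v s \<bullet> b) * u1 b (\<gamma> s)) has_vector_derivative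
     (\<Sum>b\<in>Basis. (v s \<bullet> b) * (\<Sum>b'\<in>Basis. (v s \<bullet> b') * u2 b' b (\<gamma> s)) + (a \<bullet> b) * u1 b (\<gamma> s)))
     (at s within S)"
    by (intro has_vector_derivative_sum)
  then show ?thesis by (simp add: hess_def sum.distrib)
qed

text \<open>The mean value inequality for subharmonic functions of one variable, along the disc
  \<open>z + \<zeta> w\<close>.  In the logarithmic polar coordinates \<open>\<zeta> = exp (\<sigma> + \<i> t)\<close> the Laplacian becomes
  \<open>\<partial>\<^sub>\<sigma>\<^sup>2 + \<partial>\<^sub>t\<^sup>2\<close> up to a positive factor, and the second term integrates to zero over a period.
  So the integral \<open>M \<sigma>\<close> over the circle of radius \<open>exp \<sigma>\<close> is a convex function of
  \<open>\<sigma> \<le> 0\<close>.  It is bounded above, and a convex function that is bounded above near \<open>-\<infinity>\<close> is nondecreasing; its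
  limit there is \<open>2 \<pi> u z\<close>, and its value at zero is the right-hand side.\<close>

lemma circle_mean_inequality:
  fixes z w :: "complex^'n::finite"
  assumes u: "c2_on V u u1 u2"
    and disc: "\<And>\<zeta>. norm \<zeta> \<le> 1 \<Longrightarrow> z + \<zeta> *s w \<in> V"
    and levi: "\<And>\<zeta>. norm \<zeta> \<le> 1 \<Longrightarrow> levi u2 (z + \<zeta> *s w) (\<zeta> *s w) \<ge> 0"
  shows "2 * pi * u z \<le> integral {0..2*pi} (\<lambda>t. u (z + cis t *s w))"
proof -
  define e where "e = (\<lambda>(\<sigma>::real) t. of_real (exp \<sigma>) * cis t)"
  define v where "v = (\<lambda>\<sigma> t. e \<sigma> t *s w)"
  define g where "g = (\<lambda>\<sigma> t. z + v \<sigma> t)"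
  let ?D = "\<lambda>x v. \<Sum>b\<in>Basis. (v \<bullet> b) * u1 b x"
  have ne: "norm (e \<sigma> t) = exp \<sigma>" for \<sigma> t
    by (simp add: e_def norm_mult)
  then have V: "g \<sigma> t \<in> V" if "\<sigma> \<le> 0" for \<sigma> t
    using that disc[of "e \<sigma> t"] by (simp add: g_def v_def)
  have e\<sigma>: "((\<lambda>\<sigma>. e \<sigma> t) has_vector_derivative e \<sigma> t) (at \<sigma> within S)" for \<sigma> t S
    unfolding e_def
    by (intro has_vector_derivative_mult_left has_vector_derivative_of_real
        DERIV_subset[OF DERIV_exp]) simp
  have et: "((\<lambda>t. e \<sigma> t) has_vector_derivative \<i> * e \<sigma> t) (at t within S)" for \<sigma> t S
  proof -
    have "(cis has_vector_derivative \<i> * cis t) (at t within S)"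
      unfolding has_vector_derivative_def by (rule has_derivative_cis) (rule has_derivative_ident)
    from has_vector_derivative_mult_right[OF this, of "of_real (exp \<sigma>)"] show ?thesis
      unfolding e_def by (simp only: mult.left_commute)
  qed
  have v\<sigma>: "((\<lambda>\<sigma>. v \<sigma> t) has_vector_derivative v \<sigma> t) (at \<sigma> within S)" for \<sigma> t S
    unfolding v_def by (rule bounded_linear.has_vector_derivative[OF bounded_linear_smult_left e\<sigma>])
  have vt: "((\<lambda>t. v \<sigma> t) has_vector_derivative \<i> *s v \<sigma> t) (at t within S)" for \<sigma> t S
    using bounded_linear.has_vector_derivative[OF bounded_linear_smult_left et]
    unfolding v_def by (simp add: vector_smult_assoc)
  have ivt: "((\<lambda>t. \<i> *s v \<sigma> t) has_vector_derivative - v \<sigma> t) (at t within S)" for \<sigma> t S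
    using bounded_linear.has_vector_derivative[OF bounded_linear_smult_right[of \<i>] vt[of \<sigma> t S]]
    by (simp add: vector_smult_assoc)
  have g\<sigma>: "((\<lambda>\<sigma>. g \<sigma> t) has_vector_derivative v \<sigma> t) (at \<sigma> within S)" for \<sigma> t S
    unfolding g_def using v\<sigma> by (simp add: add.commute[of z] has_vector_derivative_add_const)
  have gt: "((\<lambda>t. g \<sigma> t) has_vector_derivative \<i> *s v \<sigma> t) (at t within S)" for \<sigma> t S
    unfolding g_def using vt by (simp add: add.commute[of z] has_vector_derivative_add_const)
  have ce: "continuous_on UNIV (\<lambda>p. e (fst p) (snd p))"
    unfolding e_def by (intro continuous_intros)
  have cv: "continuous_on S (\<lambda>p. v (fst p) (snd p))" for S
    unfolding v_def
    by (rule continuous_on_subset[OF bounded_linear.continuous_on[OF bounded_linear_smult_left ce]]) simp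
  have cg: "continuous_on S (\<lambda>p. g (fst p) (snd p))" for S
    unfolding g_def by (intro continuous_intros cv)
  have comp: "continuous_on ({..0} \<times> T) (\<lambda>p. f (g (fst p) (snd p)))"
    if "continuous_on V f" for f :: "complex^'n \<Rightarrow> real" and T
    by (rule continuous_on_compose2[OF that cg]) (auto intro: V)
  note cu = c2_on_continuous[OF u]
  have cD: "continuous_on ({..0} \<times> T) (\<lambda>(\<sigma>, t). ?D (g \<sigma> t) (v \<sigma> t))" for T
    unfolding split_beta by (intro continuous_intros cv comp cu)
  have cH: "continuous_on ({..0} \<times> T) (\<lambda>(\<sigma>, t). hess u2 (g \<sigma> t) (v \<sigma> t) + ?D (g \<sigma> t) (v \<sigma> t))" for T
    unfolding split_beta hess_def
    using u by (intro continuous_intros cv comp cu) (auto simp: c2_on_def)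
  have slice: "(\<lambda>t. f \<sigma> t) integrable_on {0..2*pi}"
    if "continuous_on ({..0} \<times> {0..2*pi}) (\<lambda>(\<sigma>, t). f \<sigma> t)" "\<sigma> \<le> 0" for f :: "real \<Rightarrow> real \<Rightarrow> real" and \<sigma>
  proof -
    have "continuous_on {0..2*pi} (\<lambda>t. (\<lambda>(\<sigma>, t). f \<sigma> t) (\<sigma>, t))"
      by (rule continuous_on_compose2[OF that(1)]) (use that(2) in \<open>auto intro!: continuous_intros\<close>)
    then show ?thesis by (simp add: integrable_continuous_real)
  qed
  have cU: "continuous_on ({..0} \<times> T) (\<lambda>(\<sigma>, t). u (g \<sigma> t))" for T
    unfolding split_beta by (intro comp cu)
  define M where "M = (\<lambda>\<sigma>. integral {0..2*pi} (\<lambda>t. u (g \<sigma> t)))"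
  define M1 where "M1 = (\<lambda>\<sigma>. integral {0..2*pi} (\<lambda>t. ?D (g \<sigma> t) (v \<sigma> t)))"
  define M2 where "M2 = (\<lambda>\<sigma>. integral {0..2*pi} (\<lambda>t. hess u2 (g \<sigma> t) (v \<sigma> t) + ?D (g \<sigma> t) (v \<sigma> t)))"
  have dM: "(M has_vector_derivative M1 \<sigma>) (at \<sigma> within {..0})" if "\<sigma> \<le> 0" for \<sigma>
    unfolding M_def M1_def
    using that cD slice[OF cU] c2_on_chain1[OF u g\<sigma> V]
    by (intro leibniz_rule_vector_derivative[of "{..0}" 0 "2*pi", unfolded cbox_interval]) auto
  have dM1: "(M1 has_vector_derivative M2 \<sigma>) (at \<sigma> within {..0})" if "\<sigma> \<le> 0" for \<sigma>
    unfolding M1_def M2_def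
    using that cH slice[OF cD] c2_on_chain2[OF u g\<sigma> V v\<sigma>]
    by (intro leibniz_rule_vector_derivative[of "{..0}" 0 "2*pi", unfolded cbox_interval]) auto
  have M2: "M2 \<sigma> \<ge> 0" if \<sigma>: "\<sigma> \<le> 0" for \<sigma>
  proof -
    \<comment> \<open>The angular derivative \<open>?ht\<close> is periodic, so the integral of its derivative \<open>?htt\<close> vanishes;
      adding it completes the radial second derivative to the Laplacian.\<close>
    let ?ht = "\<lambda>t. ?D (g \<sigma> t) (\<i> *s v \<sigma> t)"
    let ?htt = "\<lambda>t. hess u2 (g \<sigma> t) (\<i> *s v \<sigma> t) + ?D (g \<sigma> t) (- v \<sigma> t)"
    have "(?ht has_vector_derivative ?htt t) (at t within {0..2*pi})" for t
      by (rule c2_on_chain2[OF u gt V ivt]) fact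
    then have "(?htt has_integral ?ht (2*pi) - ?ht 0) {0..2*pi}"
      by (intro fundamental_theorem_of_calculus) auto
    moreover have "?ht (2*pi) = ?ht 0"
      by (simp add: g_def v_def e_def)
    ultimately have htt: "(?htt has_integral 0) {0..2*pi}" by simp
    have "((\<lambda>t. hess u2 (g \<sigma> t) (v \<sigma> t) + ?D (g \<sigma> t) (v \<sigma> t)) has_integral M2 \<sigma>) {0..2*pi}"
      unfolding M2_def by (intro integrable_integral slice[OF cH] \<sigma>)
    from has_integral_add[OF this htt]
    have "((\<lambda>t. levi u2 (g \<sigma> t) (v \<sigma> t)) has_integral M2 \<sigma>) {0..2*pi}"
      by (simp add: levi_def sum_negf algebra_simps)
    then show ?thesis
      by (rule has_integral_nonneg)
        (use \<sigma> levi ne in \<open>auto simp: g_def v_def\<close>)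
  qed
  have mono: "f a \<le> f b" if der: "\<And>\<sigma>. \<sigma> \<le> 0 \<Longrightarrow> (f has_vector_derivative f' \<sigma>) (at \<sigma> within {..0})"
    and nonneg: "\<And>\<sigma>. \<sigma> \<le> b \<Longrightarrow> f' \<sigma> \<ge> 0" and ab: "a \<le> b" "b \<le> 0" for f f' :: "real \<Rightarrow> real" and a b
  proof -
    have "(f' has_integral f b - f a) {a..b}"
    proof (rule fundamental_theorem_of_calculus)
      show "(f has_vector_derivative f' \<sigma>) (at \<sigma> within {a..b})" if "\<sigma> \<in> {a..b}" for \<sigma>
        using that ab by (intro has_vector_derivative_within_subset[OF der]) auto
    qed (rule ab)
    then have "0 \<le> f b - f a"
      by (rule has_integral_nonneg) (use nonneg in auto)
    then show ?thesis by simp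
  qed
  have M1mono: "M1 a \<le> M1 b" if "a \<le> b" "b \<le> 0" for a b
    by (rule mono[of M1 M2 b a, OF dM1 M2]) (use that in auto)
  obtain C where C: "\<And>\<sigma> t. \<sigma> \<le> 0 \<Longrightarrow> u (g \<sigma> t) \<le> C"
  proof -
    have "compact ((\<lambda>\<zeta>. z + \<zeta> *s w) ` cball 0 1)"
      by (intro compact_continuous_image continuous_intros
          bounded_linear.continuous_on[OF bounded_linear_smult_left]) auto
    moreover have "(\<lambda>\<zeta>. z + \<zeta> *s w) ` cball 0 1 \<subseteq> V" using disc by auto
    ultimately have "bounded (u ` (\<lambda>\<zeta>. z + \<zeta> *s w) ` cball 0 1)"
      using compact_continuous_image[OF continuous_on_subset[OF cu(1)]] compact_imp_bounded by blast
    then obtain C where C: "\<And>x. x \<in> u ` (\<lambda>\<zeta>. z + \<zeta> *s w) ` cball 0 1 \<Longrightarrow> norm x \<le> C"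
      unfolding bounded_iff by blast
    have "u (g \<sigma> t) \<le> C" if "\<sigma> \<le> 0" for \<sigma> t
    proof -
      have "u (g \<sigma> t) \<in> u ` (\<lambda>\<zeta>. z + \<zeta> *s w) ` cball 0 1"
        using that ne[of \<sigma> t] unfolding g_def v_def by (intro imageI) simp
      from C[OF this] show ?thesis by simp
    qed
    then show ?thesis using that by blast
  qed
  have MC: "M \<sigma> \<le> 2 * pi * C" if "\<sigma> \<le> 0" for \<sigma>
  proof -
    have "M \<sigma> \<le> integral {0..2*pi} (\<lambda>t. C)"
      unfolding M_def using that by (intro integral_le slice[OF cU] C) auto
    then show ?thesis by simp
  qed
  have M1: "M1 \<sigma> \<ge> 0" if \<sigma>: "\<sigma> \<le> 0" for \<sigma>
  proof (rule ccontr)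
    assume "\<not> M1 \<sigma> \<ge> 0"
    then have neg: "M1 \<sigma> < 0" by simp
    \<comment> \<open>If the derivative were negative at \<open>\<sigma>\<close>, then by convexity the tangent line there would force
      \<open>M\<close> above its upper bound at this \<open>s\<close>.\<close>
    define s where "s = \<sigma> - (\<bar>2 * pi * C - M \<sigma>\<bar> + 1) / (- M1 \<sigma>)"
    have s: "s < \<sigma>" using neg by (simp add: s_def field_simps)
    have "- M s - M1 \<sigma> * (- s) \<le> - M \<sigma> - M1 \<sigma> * (- \<sigma>)"
    proof (rule mono[of "\<lambda>x. - M x - M1 \<sigma> * (- x)" "\<lambda>x. M1 \<sigma> - M1 x" \<sigma> s])
      show "((\<lambda>x. - M x - M1 \<sigma> * (- x)) has_vector_derivative M1 \<sigma> - M1 x) (at x within {..0})"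
        if "x \<le> 0" for x
        using dM[OF that] unfolding has_real_derivative_iff_has_vector_derivative[symmetric]
        by (auto intro!: derivative_eq_intros)
      show "0 \<le> M1 \<sigma> - M1 x" if "x \<le> \<sigma>" for x using M1mono[OF that \<sigma>] by simp
    qed (use s \<sigma> in auto)
    then have "M s \<ge> M \<sigma> + (- M1 \<sigma>) * (\<sigma> - s)" by (simp add: algebra_simps)
    moreover have "(- M1 \<sigma>) * (\<sigma> - s) = \<bar>2 * pi * C - M \<sigma>\<bar> + 1"
      using neg by (simp add: s_def)
    ultimately show False using MC[of s] s \<sigma> by linarith
  qed
  have Mmono: "M \<sigma> \<le> M 0" if "\<sigma> \<le> 0" for \<sigma>
    by (rule mono[of M M1 0 \<sigma>, OF dM M1]) (use that in auto)
  have "2 * pi * (u z - \<epsilon>) \<le> M 0" if \<epsilon>: "\<epsilon> > 0" for \<epsilon>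
  proof -
    have "z \<in> V" using disc[of 0] by simp
    then have "isCont u z"
      using u has_derivative_continuous unfolding c2_on_def by blast
    then obtain d where d: "d > 0" "\<And>x. dist x z < d \<Longrightarrow> dist (u x) (u z) < \<epsilon>"
      using \<epsilon> unfolding continuous_at_eps_delta by blast
    define k where "k = norm w"
    have k: "0 \<le> k" by (simp add: k_def)
    \<comment> \<open>A circle so small that \<open>u\<close> differs from \<open>u z\<close> by less than \<open>\<epsilon>\<close> on it.\<close>
    define \<sigma> where "\<sigma> = min 0 (ln (d / (2 * (k + 1))))"
    have \<sigma>: "\<sigma> \<le> 0" by (simp add: \<sigma>_def)
    have pos: "2 * (k + 1) > 0" using k by (simp add: add_nonneg_pos)
    have "\<sigma> \<le> ln (d / (2 * (k + 1)))" unfolding \<sigma>_def by (rule min.cobounded2)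
    then have "exp \<sigma> \<le> exp (ln (d / (2 * (k + 1))))" by (simp only: exp_le_cancel_iff)
    also have "\<dots> = d / (2 * (k + 1))"
      using d(1) pos by (intro exp_ln divide_pos_pos)
    finally have "exp \<sigma> * (2 * (k + 1)) \<le> d"
      using pos by (simp only: pos_le_divide_eq)
    moreover have "exp \<sigma> * k < exp \<sigma> * (2 * (k + 1))"
      using k by (intro mult_strict_left_mono) (simp_all add: add_nonneg_pos)
    ultimately have ex: "exp \<sigma> * k < d" by linarith
    have "u z - \<epsilon> \<le> u (g \<sigma> t)" for t
    proof -
      have "dist (g \<sigma> t) z < d"
        using ex ne[of \<sigma> t] by (simp add: g_def v_def dist_norm norm_vector_smult k_def)
      from d(2)[OF this] show ?thesis by (simp add: dist_real_def)
    qed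
    then have "integral {0..2*pi} (\<lambda>t. u z - \<epsilon>) \<le> M \<sigma>"
      unfolding M_def using \<sigma> by (intro integral_le slice[OF cU]) auto
    with Mmono[OF \<sigma>] show ?thesis by simp
  qed
  then have "2 * pi * (u z - \<epsilon> / (2 * pi)) \<le> M 0" if "\<epsilon> > 0" for \<epsilon>
    using that by simp
  then have "2 * pi * u z \<le> M 0 + \<epsilon>" if "\<epsilon> > 0" for \<epsilon>
    using that by (simp add: right_diff_distrib diff_le_eq)
  then have "2 * pi * u z \<le> M 0" by (rule field_le_epsilon)
  then show ?thesis by (simp add: M_def g_def v_def e_def)
qed

section \<open>Averages of superharmonic functions\<close>

text \<open>A radial kernel with compact support.  It is Lipschitz, which makes averages against it
  Lipschitz, and it is bounded below on smaller balls.\<close>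

definition cone :: "real \<Rightarrow> (complex^'n::finite) \<Rightarrow> real" where
  "cone \<delta> w = max 0 (\<delta> - norm w)"

definition cone_mass :: "'n::finite itself \<Rightarrow> real \<Rightarrow> real" where
  "cone_mass _ \<delta> = enn2real (\<integral>\<^sup>+w. ennreal (cone \<delta> (w :: complex^'n)) \<partial>lborel)"

lemma cone_nonneg [simp]: "cone \<delta> w \<ge> 0"
  by (simp add: cone_def)

lemma cone_le: "\<delta> \<ge> 0 \<Longrightarrow> cone \<delta> w \<le> \<delta>"
  by (simp add: cone_def)

lemma cone_eq_0: "\<delta> \<le> norm w \<Longrightarrow> cone \<delta> w = 0"
  by (simp add: cone_def)

lemma cone_lipschitz: "cone \<delta> w \<le> cone \<delta> w' + norm (w - w')"
  using norm_triangle_ineq3[of w w'] unfolding cone_def by linarith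

lemma measurable_cone [measurable]: "cone \<delta> \<in> borel_measurable borel"
  unfolding cone_def by measurable

lemma cone_mass:
  assumes "\<delta> > 0"
  shows "(\<integral>\<^sup>+w. ennreal (cone \<delta> (w :: complex^'n::finite)) \<partial>lborel) = ennreal (cone_mass TYPE('n) \<delta>)"
    and "cone_mass TYPE('n) \<delta> > 0"
proof -
  let ?I = "\<integral>\<^sup>+w. ennreal (cone \<delta> (w :: complex^'n)) \<partial>lborel"
  have "?I \<le> (\<integral>\<^sup>+w. ennreal \<delta> * indicator (cball 0 \<delta>) (w :: complex^'n) \<partial>lborel)"
    using assms by (intro nn_integral_mono) (auto simp: cone_le cone_eq_0 ennreal_leI split: split_indicator)
  also have "\<dots> = ennreal \<delta> * emeasure lborel (cball (0 :: complex^'n) \<delta>)"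
    by (subst nn_integral_cmult_indicator) auto
  also have "\<dots> < \<infinity>"
    using emeasure_lborel_cball_finite[of "0 :: complex^'n" \<delta>] by (simp add: ennreal_mult_less_top)
  finally have fin: "?I < \<infinity>" .
  then show "?I = ennreal (cone_mass TYPE('n) \<delta>)"
    by (simp add: cone_mass_def)
  have "0 < ennreal (\<delta> / 2) * emeasure lborel (ball (0 :: complex^'n) (\<delta> / 2))"
  proof -
    have "emeasure lborel (ball (0 :: complex^'n) (\<delta> / 2)) \<noteq> 0"
    proof
      assume "emeasure lborel (ball (0 :: complex^'n) (\<delta> / 2)) = 0"
      then have "Sigma_Algebra.measure lborel (ball (0 :: complex^'n) (\<delta> / 2)) = 0"
        by (simp add: measure_def)
      then show False using content_ball_pos[of "\<delta> / 2" "0 :: complex^'n"] assms by simp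
    qed
    then show ?thesis using assms by (simp add: ennreal_zero_less_mult_iff zero_less_iff_neq_zero)
  qed
  also have "\<dots> = (\<integral>\<^sup>+w. ennreal (\<delta> / 2) * indicator (ball 0 (\<delta> / 2)) (w :: complex^'n) \<partial>lborel)"
    by (subst nn_integral_cmult_indicator) auto
  also have "\<dots> \<le> ?I"
    by (intro nn_integral_mono) (auto simp: cone_def le_max_iff_disj intro!: ennreal_leI split: split_indicator)
  finally show "cone_mass TYPE('n) \<delta> > 0"
    using fin by (simp add: cone_mass_def enn2real_positive_iff)
qed

lemma nn_integral_translate:
  fixes x :: "'v::euclidean_space"
  assumes [measurable]: "g \<in> borel_measurable borel"
  shows "(\<integral>\<^sup>+w. g (x + w) \<partial>lborel) = (\<integral>\<^sup>+y. g y \<partial>lborel)"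
  using nn_integral_distr[of "(+) x" lborel borel g] by (simp add: lborel_distr_plus)

text \<open>The local properties of \<open>const - u\<close>, for plurisubharmonic \<open>u\<close> bounded above by the
  constant, that the compactness argument uses.\<close>

definition supermean :: "(complex^'n::finite) set \<Rightarrow> (complex^'n \<Rightarrow> real) \<Rightarrow> bool" where
  "supermean B f \<longleftrightarrow> continuous_on B f \<and> (\<forall>x\<in>B. f x \<ge> 0) \<and>
     (\<forall>x w. (\<forall>\<zeta>. norm \<zeta> \<le> 1 \<longrightarrow> x + \<zeta> *s w \<in> B) \<longrightarrow>
        integral {0..2*pi} (\<lambda>t. f (x + cis t *s w)) \<le> 2 * pi * f x)"

lemma measurable_on_open:
  fixes f :: "'v::euclidean_space \<Rightarrow> real"
  assumes "open B" "continuous_on B f"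
  shows "(\<lambda>y. ennreal (f y) * indicator B y) \<in> borel_measurable borel"
proof -
  have "(\<lambda>y. indicator B y *\<^sub>R f y) \<in> borel_measurable borel"
    using assms by (intro borel_measurable_continuous_on_indicator) auto
  then have "(\<lambda>y. ennreal (indicator B y *\<^sub>R f y)) \<in> borel_measurable borel" by simp
  also have "(\<lambda>y. ennreal (indicator B y *\<^sub>R f y)) = (\<lambda>y. ennreal (f y) * indicator B y)"
    by (auto simp: indicator_def)
  finally show ?thesis .
qed

text \<open>A radial kernel is invariant under \<open>w \<mapsto> cis t *s w\<close>.  Averaging the integral over \<open>t\<close> and
  exchanging the integrals replaces \<open>f (x + w)\<close> by its mean over the circle through \<open>w\<close> in the
  complex line of \<open>w\<close>, which is at most \<open>f x\<close>.\<close>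

lemma supermean_cone_average:
  fixes f :: "complex^'n::finite \<Rightarrow> real"
  assumes B: "open B" and f: "supermean B f" and \<delta>: "\<delta> > 0" and x: "cball x \<delta> \<subseteq> B"
  shows "(\<integral>\<^sup>+y. ennreal (f y) * indicator B y * ennreal (cone \<delta> (y - x)) \<partial>lborel)
    \<le> ennreal (cone_mass TYPE('n) \<delta> * f x)"
proof -
  define F where "F = (\<lambda>y. ennreal (f y) * indicator B y)"
  let ?g = "\<lambda>w. F (x + w) * ennreal (cone \<delta> w)"
  let ?I = "{0..2*pi}" and ?c = "ennreal (2 * pi)"
  have [measurable]: "F \<in> borel_measurable borel"
    unfolding F_def using B f by (intro measurable_on_open) (auto simp: supermean_def)
  have "x \<in> cball x \<delta>" using \<delta> by simp
  then have fx: "f x \<ge> 0" using f x unfolding supermean_def by blast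
  have g[measurable]: "?g \<in> borel_measurable borel" by measurable
  have rot: "(\<integral>\<^sup>+w. ?g (cis t *s w) \<partial>lborel) = (\<integral>\<^sup>+w. ?g w \<partial>lborel)" for t
    by (rule nn_integral_isometry[OF _ _ g])
      (auto simp: norm_vector_smult intro: bounded_linear.linear[OF bounded_linear_smult_right])
  have cont: "continuous_on UNIV (\<lambda>p::real \<times> (complex^'n). cis (fst p) *s snd p)"
  proof -
    have "(\<lambda>p::real \<times> (complex^'n). cis (fst p) *s snd p) = (\<lambda>p. \<chi> i. cis (fst p) * snd p $ i)"
      by (auto simp: vec_eq_iff)
    then show ?thesis by (simp only:) (intro continuous_intros)
  qed
  have [measurable]: "(\<lambda>p::real \<times> (complex^'n). cis (fst p) *s snd p) \<in> borel_measurable (lborel \<Otimes>\<^sub>M lborel)"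
    using borel_measurable_continuous_onI[OF cont] by (simp add: lborel_prod)
  have meas: "(\<lambda>(t, w). ?g (cis t *s w) * indicator ?I t) \<in> borel_measurable (lborel \<Otimes>\<^sub>M lborel)"
    unfolding split_beta
    by (intro borel_measurable_times_ennreal measurable_compose[OF _ g]) measurable
  have inner: "(\<integral>\<^sup>+t. ?g (cis t *s w) * indicator ?I t \<partial>lborel) \<le> ?c * (ennreal (f x) * ennreal (cone \<delta> w))"
    for w :: "complex^'n"
  proof (cases "norm w \<le> \<delta>")
    case False
    then have "?g (cis t *s w) = 0" for t
      by (simp add: cone_eq_0 norm_vector_smult)
    then have "(\<integral>\<^sup>+t. ?g (cis t *s w) * indicator ?I t \<partial>lborel) = (\<integral>\<^sup>+t. 0 \<partial>(lborel :: real measure))"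
      by (intro nn_integral_cong) (simp only: mult_zero_left)
    then show ?thesis by simp
  next
    case True
    have disc: "x + \<zeta> *s w \<in> B" if "norm \<zeta> \<le> 1" for \<zeta>
    proof -
      have "norm (\<zeta> *s w) \<le> 1 * \<delta>"
        unfolding norm_vector_smult using that True by (intro mult_mono) auto
      then show ?thesis using x by (auto simp: dist_norm)
    qed
    have circ: "x + cis t *s w \<in> B" for t using disc[of "cis t"] by simp
    have cw: "continuous_on ?I (\<lambda>t. f (x + cis t *s w))"
    proof (rule continuous_on_compose2[of B f])
      show "continuous_on B f" using f by (simp add: supermean_def)
      show "continuous_on ?I (\<lambda>t. x + cis t *s w)"
        by (intro continuous_intros bounded_linear.continuous_on[OF bounded_linear_smult_left])
    qed (use circ in auto)
    have "(\<integral>\<^sup>+t. ennreal (f (x + cis t *s w)) * indicator ?I t \<partial>lborel)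
        = ennreal (integral ?I (\<lambda>t. f (x + cis t *s w)))"
      using f circ cw
      by (intro nn_integral_has_integral_lebesgue' integrable_integral integrable_continuous_real)
        (auto simp: supermean_def)
    also have "\<dots> \<le> ennreal (2 * pi * f x)"
      using f disc by (intro ennreal_leI) (auto simp: supermean_def)
    finally have *: "(\<integral>\<^sup>+t. ennreal (f (x + cis t *s w)) * indicator ?I t \<partial>lborel) \<le> ennreal (2 * pi * f x)" .
    have "(\<integral>\<^sup>+t. ?g (cis t *s w) * indicator ?I t \<partial>lborel)
        = (\<integral>\<^sup>+t. ennreal (cone \<delta> w) * (F (x + cis t *s w) * indicator ?I t) \<partial>lborel)"
      by (intro nn_integral_cong) (simp add: cone_def norm_vector_smult mult_ac)
    also have "\<dots> = ennreal (cone \<delta> w) * (\<integral>\<^sup>+t. F (x + cis t *s w) * indicator ?I t \<partial>lborel)"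
    proof (rule nn_integral_cmult)
      have "continuous_on UNIV (\<lambda>t. x + cis t *s w)"
        by (intro continuous_intros bounded_linear.continuous_on[OF bounded_linear_smult_left])
      from measurable_compose[OF borel_measurable_continuous_onI[OF this] \<open>F \<in> borel_measurable borel\<close>]
      show "(\<lambda>t. F (x + cis t *s w) * indicator ?I t) \<in> borel_measurable lborel"
        by simp
    qed
    also have "\<dots> = ennreal (cone \<delta> w) * (\<integral>\<^sup>+t. ennreal (f (x + cis t *s w)) * indicator ?I t \<partial>lborel)"
      by (simp add: circ F_def)
    also have "\<dots> \<le> ennreal (cone \<delta> w) * ennreal (2 * pi * f x)"
      using * by (rule mult_left_mono) simp
    also have "\<dots> = ?c * (ennreal (f x) * ennreal (cone \<delta> w))"
      using fx by (simp add: ennreal_mult mult_ac)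
    finally show ?thesis .
  qed
  have "?c * (\<integral>\<^sup>+w. ?g w \<partial>lborel) = (\<integral>\<^sup>+t. (\<integral>\<^sup>+w. ?g w \<partial>lborel) * indicator ?I t \<partial>lborel)"
    by (subst nn_integral_cmult_indicator) (auto simp: mult.commute)
  also have "\<dots> = (\<integral>\<^sup>+t. (\<integral>\<^sup>+w. ?g (cis t *s w) * indicator ?I t \<partial>lborel) \<partial>lborel)"
  proof (intro nn_integral_cong)
    fix t
    show "(\<integral>\<^sup>+w. ?g w \<partial>lborel) * indicator ?I t = (\<integral>\<^sup>+w. ?g (cis t *s w) * indicator ?I t \<partial>lborel)"
      using rot[of t] by (auto split: split_indicator)
  qed
  also have "\<dots> = (\<integral>\<^sup>+w. (\<integral>\<^sup>+t. ?g (cis t *s w) * indicator ?I t \<partial>lborel) \<partial>lborel)"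
    using lborel_pair.Fubini'[OF meas] by simp
  also have "\<dots> \<le> (\<integral>\<^sup>+w. ?c * (ennreal (f x) * ennreal (cone \<delta> (w :: complex^'n))) \<partial>lborel)"
    by (intro nn_integral_mono inner)
  also have "\<dots> = ?c * (ennreal (f x) * ennreal (cone_mass TYPE('n) \<delta>))"
    using cone_mass(1)[OF \<delta>, where 'n = 'n] by (simp add: nn_integral_cmult)
  finally have "(\<integral>\<^sup>+w. ?g w \<partial>lborel) \<le> ennreal (f x) * ennreal (cone_mass TYPE('n) \<delta>)"
    by (simp add: ennreal_mult_le_mult_iff)
  moreover have "(\<integral>\<^sup>+w. ?g w \<partial>lborel) = (\<integral>\<^sup>+y. F y * ennreal (cone \<delta> (y - x)) \<partial>lborel)"
    using nn_integral_translate[of "\<lambda>y. F y * ennreal (cone \<delta> (y - x))" x] by simp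
  ultimately show ?thesis
    using fx cone_mass(2)[OF \<delta>, where 'n = 'n] by (simp add: F_def ennreal_mult mult.commute)
qed

text \<open>On the ball of radius \<open>r\<close> the kernel of radius \<open>\<delta>\<close> is at least \<open>\<delta> - r\<close>, so one value of \<open>f\<close> controls
  its integral.\<close>

lemma supermean_L1_bound:
  fixes f :: "complex^'n::finite \<Rightarrow> real"
  assumes B: "open B" and f: "supermean B f" and r: "0 < r" "r < \<delta>" and x: "cball x \<delta> \<subseteq> B"
  shows "(\<integral>\<^sup>+y\<in>ball x r. ennreal (f y) \<partial>lborel)
    \<le> ennreal (cone_mass TYPE('n) \<delta> * f x / (\<delta> - r))"
proof -
  define F where "F = (\<lambda>y. ennreal (f y) * indicator B y)"
  have \<delta>: "\<delta> > 0" using r by simp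
  have [measurable]: "ball x r \<in> sets borel" by simp
  have [measurable]: "F \<in> borel_measurable borel"
    unfolding F_def using B f by (intro measurable_on_open) (auto simp: supermean_def)
  have "x \<in> cball x \<delta>" using \<delta> by simp
  then have fx: "f x \<ge> 0" using f x unfolding supermean_def by blast
  have "ennreal (\<delta> - r) * (\<integral>\<^sup>+y\<in>ball x r. ennreal (f y) \<partial>lborel)
      = ennreal (\<delta> - r) * (\<integral>\<^sup>+y. F y * indicator (ball x r) y \<partial>lborel)"
  proof (rule arg_cong2[where f = "(*)", OF refl], rule nn_integral_cong)
    fix y
    have "y \<in> B" if "y \<in> ball x r" using that x r by (intro subsetD[OF x]) auto
    then show "ennreal (f y) * indicator (ball x r) y = F y * indicator (ball x r) y"
      by (auto simp: F_def split: split_indicator)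
  qed
  also have "\<dots> = (\<integral>\<^sup>+y. ennreal (\<delta> - r) * (F y * indicator (ball x r) y) \<partial>lborel)"
    by (rule nn_integral_cmult[symmetric]) measurable
  also have "\<dots> \<le> (\<integral>\<^sup>+y. F y * ennreal (cone \<delta> (y - x)) \<partial>lborel)"
  proof (intro nn_integral_mono)
    fix y
    have "ennreal (\<delta> - r) \<le> ennreal (cone \<delta> (y - x))" if "y \<in> ball x r"
      using that by (intro ennreal_leI) (simp add: cone_def dist_norm norm_minus_commute)
    then show "ennreal (\<delta> - r) * (F y * indicator (ball x r) y) \<le> F y * ennreal (cone \<delta> (y - x))"
      by (cases "y \<in> ball x r") (auto simp: mult.commute intro: mult_left_mono)
  qed
  also have "\<dots> \<le> ennreal (cone_mass TYPE('n) \<delta> * f x)"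
    unfolding F_def by (rule supermean_cone_average) fact+
  also have "\<dots> = ennreal (\<delta> - r) * ennreal (cone_mass TYPE('n) \<delta> * f x / (\<delta> - r))"
    using r fx cone_mass(2)[OF \<delta>, where 'n = 'n] by (simp flip: ennreal_mult)
  finally show ?thesis using r by (simp add: ennreal_mult_le_mult_iff)
qed

section \<open>Compactness in \<open>L\<^sup>1\<close> on a ball\<close>

lemma convergent_subsequence_family:
  fixes b :: "'j \<Rightarrow> nat \<Rightarrow> real"
  assumes J: "countable J" and bd: "\<And>j. j \<in> J \<Longrightarrow> bounded (range (b j))"
  obtains r where "strict_mono r" "\<And>j. j \<in> J \<Longrightarrow> convergent (\<lambda>i. b j (r i))"
proof (cases "J = {}")
  case True then show ?thesis using that[of id] by (auto simp: strict_mono_def)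
next
  case False
  let ?e = "from_nat_into J"
  let ?P = "\<lambda>n s. convergent (\<lambda>i. b (?e n) (s i))"
  interpret subseqs ?P
  proof
    fix n and s :: "nat \<Rightarrow> nat" assume "strict_mono s"
    have "bounded (range (\<lambda>i. b (?e n) (s i)))"
      using bd[OF from_nat_into[OF False, of n]] by (rule bounded_subset) auto
    then obtain l r where "strict_mono r" "((\<lambda>i. b (?e n) (s i)) \<circ> r) \<longlonglongrightarrow> l"
      using bounded_imp_convergent_subsequence by blast
    then show "\<exists>r'. strict_mono r' \<and> ?P n (s \<circ> r')"
      by (auto simp: convergent_def o_def)
  qed
  have "?P n (diagseq \<circ> ((+) (Suc n)))" for n
  proof (rule diagseq_holds)
    fix r s :: "nat \<Rightarrow> nat" and n assume "strict_mono r" "?P n s"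
    then show "?P n (s \<circ> r)"
      using LIMSEQ_subseq_LIMSEQ[of "\<lambda>i. b (?e n) (s i)" _ r] by (auto simp: convergent_def o_def)
  qed
  then have "?P n diagseq" for n
    using convergent_ignore_initial_segment[of "\<lambda>i. b (?e n) (diagseq i)" "Suc n"]
    unfolding o_def add.commute[of "Suc _"] by blast
  then show ?thesis
    using that[OF subseq_diagseq] from_nat_into_surj[OF J] by metis
qed

text \<open>The average of \<open>f\<close>, extended by zero outside \<open>B\<close>, against the normalised kernel.  Thanks to
  the extension it is Lipschitz on the whole space, also near the boundary of \<open>B\<close>.\<close>

definition smear :: "(complex^'n::finite) set \<Rightarrow> real \<Rightarrow> (complex^'n \<Rightarrow> real) \<Rightarrow> complex^'n \<Rightarrow> real" where
  "smear B \<delta> f x = enn2real (\<integral>\<^sup>+y. ennreal (f y) * indicator B y * ennreal (cone \<delta> (y - x)) \<partial>lborel)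
     / cone_mass TYPE('n) \<delta>"

locale supermean_L1 =
  fixes B :: "(complex^'n::finite) set" and f :: "complex^'n \<Rightarrow> real" and C \<delta> m :: real
  assumes B: "open B" and f: "supermean B f" and C: "C \<ge> 0"
    and L1: "(\<integral>\<^sup>+y\<in>B. ennreal (f y) \<partial>lborel) \<le> ennreal C" and \<delta>: "\<delta> > 0"
    and m_eq: "m = cone_mass TYPE('n) \<delta>"
begin

definition F where "F = (\<lambda>y. ennreal (f y) * indicator B y)"

lemma m: "m > 0" unfolding m_eq by (rule cone_mass(2)[OF \<delta>])

lemma F_measurable [measurable]: "F \<in> borel_measurable borel"
  unfolding F_def using B f by (intro measurable_on_open) (auto simp: supermean_def)

lemma L1': "(\<integral>\<^sup>+y. F y \<partial>lborel) \<le> ennreal C"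
  using L1 by (simp add: F_def)

lemma smear_alt: "smear B \<delta> f x = enn2real (\<integral>\<^sup>+y. F y * ennreal (cone \<delta> (y - x)) \<partial>lborel) / m"
  by (simp add: smear_def F_def m_eq)

lemma smear_eq: "(\<integral>\<^sup>+y. F y * ennreal (cone \<delta> (y - x)) \<partial>lborel) = ennreal (m * smear B \<delta> f x)"
  and smear_nonneg: "0 \<le> smear B \<delta> f x"
  and smear_le: "smear B \<delta> f x \<le> C * \<delta> / m"
proof -
  have "(\<integral>\<^sup>+y. F y * ennreal (cone \<delta> (y - x)) \<partial>lborel) \<le> (\<integral>\<^sup>+y. F y * ennreal \<delta> \<partial>lborel)"
    using \<delta> by (intro nn_integral_mono mult_left_mono ennreal_leI cone_le) auto
  also have "\<dots> = (\<integral>\<^sup>+y. F y \<partial>lborel) * ennreal \<delta>" by (rule nn_integral_multc) measurable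
  also have "\<dots> \<le> ennreal C * ennreal \<delta>" using L1' by (rule mult_right_mono) simp
  finally have le: "(\<integral>\<^sup>+y. F y * ennreal (cone \<delta> (y - x)) \<partial>lborel) \<le> ennreal (C * \<delta>)"
    using C \<delta> by (simp add: ennreal_mult)
  then have fin: "(\<integral>\<^sup>+y. F y * ennreal (cone \<delta> (y - x)) \<partial>lborel) < top"
    using ennreal_less_top le_less_trans by blast
  with m show "(\<integral>\<^sup>+y. F y * ennreal (cone \<delta> (y - x)) \<partial>lborel) = ennreal (m * smear B \<delta> f x)"
    by (simp add: smear_alt)
  show "0 \<le> smear B \<delta> f x" using m by (simp add: smear_alt)
  have "enn2real (\<integral>\<^sup>+y. F y * ennreal (cone \<delta> (y - x)) \<partial>lborel) \<le> C * \<delta>"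
    using le C \<delta> by (intro enn2real_leI) auto
  then show "smear B \<delta> f x \<le> C * \<delta> / m"
    unfolding smear_alt using m by (intro divide_right_mono) auto
qed

text \<open>Inherited from the kernel, with a constant that depends on \<open>f\<close> only through its integral.\<close>

lemma smear_lipschitz: "smear B \<delta> f x \<le> smear B \<delta> f x' + C / m * norm (x - x')"
proof -
  have "ennreal (m * smear B \<delta> f x) = (\<integral>\<^sup>+y. F y * ennreal (cone \<delta> (y - x)) \<partial>lborel)"
    by (simp add: smear_eq)
  also have "\<dots> \<le> (\<integral>\<^sup>+y. F y * ennreal (cone \<delta> (y - x')) + F y * ennreal (norm (x - x')) \<partial>lborel)"
  proof (intro nn_integral_mono)
    fix y
    have "cone \<delta> (y - x) \<le> cone \<delta> (y - x') + norm (x - x')"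
      using cone_lipschitz[of \<delta> "y - x" "y - x'"] by (simp add: norm_minus_commute)
    then have "ennreal (cone \<delta> (y - x)) \<le> ennreal (cone \<delta> (y - x')) + ennreal (norm (x - x'))"
      by (simp flip: ennreal_plus add: ennreal_leI)
    then show "F y * ennreal (cone \<delta> (y - x))
        \<le> F y * ennreal (cone \<delta> (y - x')) + F y * ennreal (norm (x - x'))"
      unfolding distrib_left[symmetric] by (rule mult_left_mono) simp
  qed
  also have "\<dots> = (\<integral>\<^sup>+y. F y * ennreal (cone \<delta> (y - x')) \<partial>lborel)
      + (\<integral>\<^sup>+y. F y * ennreal (norm (x - x')) \<partial>lborel)"
    by (rule nn_integral_add) measurable
  also have "(\<integral>\<^sup>+y. F y * ennreal (norm (x - x')) \<partial>lborel) = (\<integral>\<^sup>+y. F y \<partial>lborel) * ennreal (norm (x - x'))"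
    by (rule nn_integral_multc) measurable
  also have "(\<integral>\<^sup>+y. F y * ennreal (cone \<delta> (y - x')) \<partial>lborel) + \<dots>
      \<le> ennreal (m * smear B \<delta> f x') + ennreal C * ennreal (norm (x - x'))"
    unfolding smear_eq by (intro add_left_mono mult_right_mono L1') simp
  also have "\<dots> = ennreal (m * smear B \<delta> f x' + C * norm (x - x'))"
    using m smear_nonneg C by (simp add: ennreal_mult ennreal_plus)
  finally have "m * smear B \<delta> f x \<le> m * smear B \<delta> f x' + C * norm (x - x')"
    using m smear_nonneg C by (subst (asm) ennreal_le_iff) auto
  then have "(m * smear B \<delta> f x) / m \<le> (m * smear B \<delta> f x' + C * norm (x - x')) / m"
    using m by (intro divide_right_mono) auto
  then show ?thesis using m by (simp add: add_divide_distrib)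
qed

lemma smear_dist: "\<bar>smear B \<delta> f x - smear B \<delta> f x'\<bar> \<le> C / m * norm (x - x')"
  using smear_lipschitz[of x x'] smear_lipschitz[of x' x] by (simp add: norm_minus_commute abs_le_iff)

lemma smear_continuous: "continuous_on S (smear B \<delta> f)"
proof -
  have "(C / m)-lipschitz_on S (smear B \<delta> f)"
    using smear_dist C m by (intro lipschitz_onI) (auto simp: dist_norm)
  then show ?thesis by (rule lipschitz_on_continuous_on)
qed

lemma smear_measurable [measurable]: "smear B \<delta> f \<in> borel_measurable borel"
  by (rule borel_measurable_continuous_onI) (rule smear_continuous)

lemma smear_le_self: "cball x \<delta> \<subseteq> B \<Longrightarrow> smear B \<delta> f x \<le> f x"
proof -
  assume x: "cball x \<delta> \<subseteq> B"
  have "x \<in> cball x \<delta>" using \<delta> by simp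
  then have fx: "f x \<ge> 0" using f x unfolding supermean_def by blast
  have "ennreal (m * smear B \<delta> f x) \<le> ennreal (m * f x)"
    using supermean_cone_average[OF B f \<delta> x] smear_eq[of x] by (simp add: F_def m_eq)
  then have "m * smear B \<delta> f x \<le> m * f x"
    using m fx by (subst (asm) ennreal_le_iff) auto
  then show ?thesis using m by simp
qed

text \<open>For a nonnegative kernel of total mass one, averaging preserves the integral up to what
  happens near the boundary.  Since the average lies below \<open>f\<close>, closeness of the integrals is closeness
  in \<open>L\<^sup>1\<close>.  The boundary is handled by a Lipschitz cutoff \<open>\<eta>\<close>: by Fubini the kernel can be moved
  from \<open>f\<close> to \<open>\<eta>\<close>, and averaging changes \<open>\<eta>\<close> by at most its Lipschitz constant \<open>4 / R\<close> times the
  radius of the kernel.\<close>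

lemma smear_close:
  assumes BR: "B = ball a R" and R: "\<delta> \<le> R / 4"
  shows "(\<integral>\<^sup>+x\<in>ball a (R / 2). ennreal (f x - smear B \<delta> f x) \<partial>lborel) \<le> ennreal (4 * C * \<delta> / R)"
proof -
  have R0: "R > 0" using R \<delta> by simp
  have [measurable]: "ball a (R / 2) \<in> sets borel" by simp
  let ?k = "\<lambda>y x :: complex^'n. ennreal (cone \<delta> (y - x))"
  let ?s = "smear B \<delta> f"
  \<comment> \<open>The cutoff is one on the ball of radius \<open>R / 2\<close> and vanishes outside radius \<open>3 R / 4\<close>, so on its
    support the kernel of radius \<open>\<delta> \<le> R / 4\<close> stays inside \<open>B\<close>.\<close>
  define \<eta> where "\<eta> = (\<lambda>x. max 0 (min 1 ((3 * R / 4 - norm (x - a)) * (4 / R))))"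
  have \<eta>0: "0 \<le> \<eta> x" "\<eta> x \<le> 1" for x by (auto simp: \<eta>_def)
  have \<eta>1: "\<eta> x = 1" if "x \<in> ball a (R / 2)" for x
  proof -
    have "(3 * R / 4 - norm (x - a)) * (4 / R) \<ge> (R / 4) * (4 / R)"
      using that R0 by (intro mult_right_mono) (auto simp: dist_norm norm_minus_commute)
    then show ?thesis using R0 by (simp add: \<eta>_def)
  qed
  have sub: "cball x \<delta> \<subseteq> B" if "\<eta> x \<noteq> 0" for x
  proof -
    have "norm (x - a) < 3 * R / 4"
    proof (rule ccontr)
      assume "\<not> norm (x - a) < 3 * R / 4"
      then have "(3 * R / 4 - norm (x - a)) * (4 / R) \<le> 0"
        using R0 by (intro mult_nonpos_nonneg) auto
      then show False using that by (simp add: \<eta>_def)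
    qed
    then have "dist a x < 3 * R / 4" by (simp add: dist_norm norm_minus_commute)
    then show ?thesis unfolding BR using R
    proof (intro subsetI)
      fix y assume "y \<in> cball x \<delta>"
      then have "dist x y \<le> \<delta>" by simp
      then have "dist a y < R"
        using \<open>dist a x < 3 * R / 4\<close> dist_triangle[of a y x] R by linarith
      then show "y \<in> ball a R" by simp
    qed
  qed
  have \<eta>_lip: "\<eta> y \<le> \<eta> x + 4 / R * norm (y - x)" for x y
  proof -
    have "norm (x - a) \<le> norm (y - a) + norm (y - x)"
      using norm_triangle_ineq3[of "x - a" "y - a"] by (simp add: norm_minus_commute) 
    then have "(3 * R / 4 - norm (y - a)) * (4 / R) \<le> (3 * R / 4 - norm (x - a) + norm (y - x)) * (4 / R)"
      using R0 by (intro mult_right_mono) auto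
    also have "\<dots> = (3 * R / 4 - norm (x - a)) * (4 / R) + 4 / R * norm (y - x)"
      by (simp only: distrib_right mult.commute[of "norm (y - x)"])
    finally have *: "(3 * R / 4 - norm (y - a)) * (4 / R) \<le> (3 * R / 4 - norm (x - a)) * (4 / R) + 4 / R * norm (y - x)" .
    have "0 \<le> 4 / R * norm (y - x)" using R0 by simp
    with * show ?thesis unfolding \<eta>_def by linarith
  qed
  have [measurable]: "\<eta> \<in> borel_measurable borel" unfolding \<eta>_def by measurable
  have [measurable]: "(\<lambda>p. ?k (fst p) (snd p)) \<in> borel_measurable (lborel \<Otimes>\<^sub>M lborel)"
    by measurable
  have mk: "(\<integral>\<^sup>+x. ?k y x \<partial>lborel) = ennreal m" for y :: "complex^'n"
  proof -
    have "(\<integral>\<^sup>+x. ?k y x \<partial>lborel) = (\<integral>\<^sup>+x. ?k y (y + x) \<partial>lborel)"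
      by (rule nn_integral_translate[symmetric]) measurable
    also have "\<dots> = (\<integral>\<^sup>+x. ennreal (cone \<delta> (x :: complex^'n)) \<partial>lborel)"
      by (simp add: cone_def)
    finally show ?thesis using cone_mass(1)[OF \<delta>, where 'n = 'n] by (simp add: m_eq)
  qed
  have point: "ennreal (\<eta> y) * ennreal m
      \<le> (\<integral>\<^sup>+x. ennreal (\<eta> x) * ?k y x \<partial>lborel) + ennreal (4 * \<delta> / R) * ennreal m" for y
  proof -
    have "ennreal (\<eta> y) * ennreal m = (\<integral>\<^sup>+x. ennreal (\<eta> y) * ?k y x \<partial>lborel)"
      by (subst nn_integral_cmult) (auto simp: mk)
    also have "\<dots> \<le> (\<integral>\<^sup>+x. ennreal (\<eta> x) * ?k y x + ennreal (4 * \<delta> / R) * ?k y x \<partial>lborel)"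
    proof (intro nn_integral_mono)
      fix x
      show "ennreal (\<eta> y) * ?k y x \<le> ennreal (\<eta> x) * ?k y x + ennreal (4 * \<delta> / R) * ?k y x"
      proof (cases "norm (y - x) \<le> \<delta>")
        case True
        have "4 / R * norm (y - x) \<le> 4 / R * \<delta>"
          using True R0 by (intro mult_left_mono) auto
        then have "\<eta> y \<le> \<eta> x + 4 * \<delta> / R" using \<eta>_lip[of y x] by simp
        then have "ennreal (\<eta> y) \<le> ennreal (\<eta> x) + ennreal (4 * \<delta> / R)"
          using \<eta>0 R0 \<delta> by (simp flip: ennreal_plus add: ennreal_leI)
        then show ?thesis
          unfolding distrib_right[symmetric] by (rule mult_right_mono) simp
      qed (simp add: cone_eq_0)
    qed
    also have "\<dots> = (\<integral>\<^sup>+x. ennreal (\<eta> x) * ?k y x \<partial>lborel) + ennreal (4 * \<delta> / R) * ennreal m"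
      by (subst nn_integral_add) (auto simp: nn_integral_cmult mk)
    finally show ?thesis .
  qed
  let ?E = "ennreal (4 * \<delta> / R) * ennreal m * ennreal C"
  let ?S = "\<integral>\<^sup>+x. ennreal (\<eta> x) * ennreal (m * ?s x) \<partial>lborel"
  have "(\<integral>\<^sup>+y. F y * (ennreal (\<eta> y) * ennreal m) \<partial>lborel)
      \<le> (\<integral>\<^sup>+y. F y * (\<integral>\<^sup>+x. ennreal (\<eta> x) * ?k y x \<partial>lborel)
           + ennreal (4 * \<delta> / R) * ennreal m * F y \<partial>lborel)"
    by (intro nn_integral_mono order_trans[OF mult_left_mono[OF point]])
      (auto simp: distrib_left mult_ac)
  also have "\<dots> = (\<integral>\<^sup>+y. F y * (\<integral>\<^sup>+x. ennreal (\<eta> x) * ?k y x \<partial>lborel) \<partial>lborel)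
      + ennreal (4 * \<delta> / R) * ennreal m * (\<integral>\<^sup>+y. F y \<partial>lborel)"
    by (subst nn_integral_add) (auto simp: nn_integral_cmult)
  also have "(\<integral>\<^sup>+y. F y * (\<integral>\<^sup>+x. ennreal (\<eta> x) * ?k y x \<partial>lborel) \<partial>lborel)
      = (\<integral>\<^sup>+y. \<integral>\<^sup>+x. F y * (ennreal (\<eta> x) * ?k y x) \<partial>lborel \<partial>lborel)"
    by (intro nn_integral_cong nn_integral_cmult[symmetric]) measurable
  also have "\<dots> = (\<integral>\<^sup>+x. \<integral>\<^sup>+y. F y * (ennreal (\<eta> x) * ?k y x) \<partial>lborel \<partial>lborel)"
    by (rule lborel_pair.Fubini') measurable
  also have "\<dots> = (\<integral>\<^sup>+x. ennreal (\<eta> x) * (\<integral>\<^sup>+y. F y * ?k y x \<partial>lborel) \<partial>lborel)"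
    by (subst nn_integral_cmult[symmetric]) (auto simp: mult_ac)
  also have "\<dots> = ?S" by (simp add: smear_eq)
  also have "?S + ennreal (4 * \<delta> / R) * ennreal m * (\<integral>\<^sup>+y. F y \<partial>lborel) \<le> ?S + ?E"
    by (intro add_left_mono mult_left_mono L1') simp
  finally have upper: "(\<integral>\<^sup>+y. F y * (ennreal (\<eta> y) * ennreal m) \<partial>lborel) \<le> ?S + ?E" .
  let ?D = "\<integral>\<^sup>+x. ennreal (\<eta> x) * ennreal (m * (f x - ?s x)) \<partial>lborel"
  \<comment> \<open>In \<open>ennreal\<close> the difference of the two integrals is expressed through this additive splitting,
    and the common summand \<open>?S\<close> is cancelled once it is known to be finite.\<close>
  have Fsplit: "F y * (ennreal (\<eta> y) * ennreal m)
      = ennreal (\<eta> y) * ennreal (m * ?s y) + ennreal (\<eta> y) * ennreal (m * (f y - ?s y))" for y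
  proof (cases "\<eta> y = 0")
    case False
    then have "cball y \<delta> \<subseteq> B" by (rule sub)
    moreover have "y \<in> cball y \<delta>" using \<delta> by simp
    ultimately have "y \<in> B" "?s y \<le> f y" using smear_le_self by blast+
    then show ?thesis
      using m \<eta>0[of y] smear_nonneg[of y]
      by (simp add: F_def flip: ennreal_mult ennreal_plus) (simp add: algebra_simps)
  qed simp
  have fD: "(\<lambda>x. ennreal (\<eta> x) * ennreal (m * (f x - ?s x))) \<in> borel_measurable borel"
  proof -
    have "(\<lambda>x. F x * (ennreal (\<eta> x) * ennreal m) - ennreal (\<eta> x) * ennreal (m * ?s x)) \<in> borel_measurable borel"
      by measurable
    also have "(\<lambda>x. F x * (ennreal (\<eta> x) * ennreal m) - ennreal (\<eta> x) * ennreal (m * ?s x))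
      = (\<lambda>x. ennreal (\<eta> x) * ennreal (m * (f x - ?s x)))"
      by (simp only: Fsplit) (simp add: ennreal_mult_eq_top_iff)
    finally show ?thesis .
  qed
  have "?S + ?D \<le> ?S + ?E"
    using upper fD unfolding Fsplit by (subst (asm) nn_integral_add) auto
  moreover have "?S < top"
  proof -
    have "?S \<le> (\<integral>\<^sup>+x. ennreal (C * \<delta>) * indicator (cball a R) x \<partial>lborel)"
    proof (intro nn_integral_mono)
      fix x
      have "x \<in> cball a R" if "\<eta> x \<noteq> 0"
      proof -
        have "x \<in> cball x \<delta>" using \<delta> by simp
        then have "x \<in> B" using sub[OF that] by blast
        then show ?thesis by (simp add: BR)
      qed
      moreover have "\<eta> x * (m * ?s x) \<le> 1 * (C * \<delta>)"
      proof -
        have "m * ?s x \<le> C * \<delta>" using smear_le[of x] m by (simp add: field_simps)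
        moreover have "\<eta> x * (m * ?s x) \<le> 1 * (m * ?s x)"
          using \<eta>0 smear_nonneg[of x] m by (intro mult_right_mono) auto
        ultimately show ?thesis by simp
      qed
      ultimately show "ennreal (\<eta> x) * ennreal (m * ?s x) \<le> ennreal (C * \<delta>) * indicator (cball a R) x"
        using \<eta>0 smear_nonneg[of x] m
        by (cases "\<eta> x = 0") (auto simp flip: ennreal_mult intro!: ennreal_leI)
    qed
    also have "\<dots> < top"
      using emeasure_lborel_cball_finite[of a R]
      by (subst nn_integral_cmult_indicator) (auto simp: ennreal_mult_less_top)
    finally show ?thesis .
  qed
  ultimately have DE: "?D \<le> ?E" by auto
  have "ennreal m * (\<integral>\<^sup>+x\<in>ball a (R / 2). ennreal (f x - ?s x) \<partial>lborel)
      = (\<integral>\<^sup>+x. ennreal m * (ennreal (f x - ?s x) * indicator (ball a (R / 2)) x) \<partial>lborel)"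
  proof (rule nn_integral_cmult[symmetric])
    have "(\<lambda>x. (F x - ennreal (?s x)) * indicator (ball a (R / 2)) x) \<in> borel_measurable lborel"
      by measurable
    also have "(\<lambda>x. (F x - ennreal (?s x)) * indicator (ball a (R / 2)) x)
      = (\<lambda>x. ennreal (f x - ?s x) * indicator (ball a (R / 2)) x)"
    proof
      fix x
      have "x \<in> B" if "x \<in> ball a (R / 2)" using that R0 by (simp add: BR)
      then show "(F x - ennreal (?s x)) * indicator (ball a (R / 2)) x
          = ennreal (f x - ?s x) * indicator (ball a (R / 2)) x"
        using smear_nonneg by (cases "x \<in> ball a (R / 2)") (simp_all add: F_def ennreal_minus)
    qed
    finally show "(\<lambda>x. ennreal (f x - ?s x) * indicator (ball a (R / 2)) x) \<in> borel_measurable lborel" .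
  qed
  also have "\<dots> \<le> ?D"
  proof (intro nn_integral_mono)
    fix x
    show "ennreal m * (ennreal (f x - ?s x) * indicator (ball a (R / 2)) x)
      \<le> ennreal (\<eta> x) * ennreal (m * (f x - ?s x))"
      using m \<eta>1[of x] by (cases "x \<in> ball a (R / 2)") (auto simp: ennreal_mult')
  qed
  also have "?D \<le> ?E" by (rule DE)
  also have "?E = ennreal m * ennreal (4 * C * \<delta> / R)"
    using m C \<delta> R0 by (simp flip: ennreal_mult add: mult_ac)
  finally show ?thesis using m by (simp add: ennreal_mult_le_mult_iff)
qed

end

text \<open>The truncated differences on the left add up to the distance between \<open>f\<close> and \<open>v\<close>.  The numbers
  \<open>t\<close> and \<open>s\<close> will be averages of \<open>f\<close> and their limit.\<close>

lemma ennreal_dist_triangle: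
  assumes "0 \<le> t" "t \<le> f" "0 \<le> s" "ennreal s \<le> v"
  shows "(ennreal f - v) + (v - ennreal f)
    \<le> ennreal (f - t) + (ennreal \<bar>t - s\<bar> + (v - ennreal s))"
proof (cases v)
  case (real w)
  then have "s \<le> w" using assms by (simp add: ennreal_le_iff)
  then have "(ennreal f - v) + (v - ennreal f) = ennreal \<bar>f - w\<bar>"
    using assms real by (cases "f \<le> w") (auto simp: ennreal_minus ennreal_neg)
  also have "\<dots> \<le> ennreal ((f - t) + (\<bar>t - s\<bar> + (w - s)))"
    using assms(2) \<open>s \<le> w\<close> by (intro ennreal_leI) linarith
  also have "\<dots> = ennreal (f - t) + (ennreal \<bar>t - s\<bar> + (v - ennreal s))"
    using assms real \<open>s \<le> w\<close> by (simp add: ennreal_plus ennreal_minus)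
  finally show ?thesis .
qed simp

text \<open>The candidate limit \<open>fl\<close> is described by two one-sided conditions: it lies below
  the pointwise lower limit, and above every constant that eventually bounds the \<open>f i\<close> from below near the
  point.  Both hold for half-relaxed lower limits.

  For a fixed radius the averages \<open>t i\<close> converge on \<open>Q\<close>, hence everywhere to some \<open>s\<close>, because they are
  uniformly Lipschitz.  As \<open>t i \<le> f i\<close>, the second condition gives \<open>s \<le> fl\<close>.  As \<open>f i\<close> is close to
  \<open>t i\<close> in \<open>L\<^sup>1\<close>, the first condition and Fatou's lemma bound the integral of \<open>fl\<close> by that of \<open>s\<close>
  plus an error, so \<open>s\<close> and \<open>fl\<close> are close in \<open>L\<^sup>1\<close>.  The error tends to zero with the radius.\<close>

lemma supermean_sequence_L1_convergence:
  fixes f :: "nat \<Rightarrow> complex^'n::finite \<Rightarrow> real" and fl :: "complex^'n \<Rightarrow> ennreal"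
  assumes R: "R > 0" and super: "\<And>i. supermean (ball a R) (f i)" and C: "C \<ge> 0"
    and L1: "\<And>i. (\<integral>\<^sup>+y\<in>ball a R. ennreal (f i y) \<partial>lborel) \<le> ennreal C"
    and dense: "closure Q = UNIV"
    and conv: "\<And>k x. x \<in> Q \<Longrightarrow> convergent (\<lambda>i. smear (ball a R) (R / (4 * (real k + 1))) (f i) x)"
    and meas: "(\<lambda>x. fl x * indicator (ball a (R / 2)) x) \<in> borel_measurable borel"
    and below: "\<And>x. x \<in> ball a (R / 2) \<Longrightarrow> fl x \<le> liminf (\<lambda>i. ennreal (f i x))"
    and above: "\<And>x c r. x \<in> ball a (R / 2) \<Longrightarrow> 0 \<le> c \<Longrightarrow> 0 < r \<Longrightarrow>
      (\<forall>\<^sub>F i in sequentially. \<forall>y\<in>ball x r. c \<le> f i y) \<Longrightarrow> ennreal c \<le> fl x"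
  shows "(\<lambda>i. \<integral>\<^sup>+x\<in>ball a (R / 2). ((ennreal (f i x) - fl x) + (fl x - ennreal (f i x))) \<partial>lborel)
    \<longlonglongrightarrow> 0"
proof -
  let ?B = "ball a R"
  define H where "H = ball a (R / 2)"
  have [measurable]: "H \<in> sets borel" by (simp add: H_def)
  define D where "D = (\<lambda>i. \<integral>\<^sup>+x\<in>H. ((ennreal (f i x) - fl x) + (fl x - ennreal (f i x))) \<partial>lborel)"
  have canc: "q * (e / (c * q)) = e / c" if "q > 0" for q e c :: real
    using that by simp
  \<comment> \<open>The index \<open>k\<close> selects the averaging radius; one \<open>C / (k + 1)\<close> bounds the distance of
    \<open>f i\<close> to \<open>t i\<close>, the other that of \<open>s\<close> to \<open>fl\<close>.\<close>
  have main: "\<exists>e. e \<longlonglongrightarrow> 0 \<and> (\<forall>i. D i \<le> ennreal (2 * C / (real k + 1)) + e i)" for k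
  proof -
    define \<delta> where "\<delta> = R / (4 * (real k + 1))"
    define m where "m = cone_mass TYPE('n) \<delta>"
    define t where "t = (\<lambda>i. smear ?B \<delta> (f i))"
    have \<delta>: "\<delta> > 0" using R by (simp add: \<delta>_def)
    have \<delta>R: "\<delta> \<le> R / 4" using R by (simp add: \<delta>_def field_simps)
    have L: "supermean_L1 ?B (f i) C \<delta> m" for i
      using super C L1 \<delta> by unfold_locales (auto simp: m_def)
    note [measurable] = supermean_L1.smear_measurable[OF L, folded t_def]
    have m: "m > 0" by (rule supermean_L1.m[OF L])
    define K where "K = C * \<delta> / m"
    have t0: "0 \<le> t i x" and tK: "t i x \<le> K" and tlip: "\<bar>t i x - t i y\<bar> \<le> C / m * norm (x - y)" for i x y
      unfolding t_def K_def
      by (rule supermean_L1.smear_nonneg[OF L] supermean_L1.smear_le[OF L] supermean_L1.smear_dist[OF L])+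
    have tmeas[measurable]: "t i \<in> borel_measurable borel" for i
      unfolding t_def by (rule supermean_L1.smear_measurable[OF L])
    have tf: "t i x \<le> f i x" if "cball x \<delta> \<subseteq> ?B" for i x
      unfolding t_def using that by (rule supermean_L1.smear_le_self[OF L])
    have cballH: "cball y \<delta> \<subseteq> ?B" if "dist a y \<le> 3 * R / 4 - \<delta> \<or> dist a y < 3 * R / 4" for y
    proof
      fix z assume "z \<in> cball y \<delta>"
      then have "dist y z \<le> \<delta>" by simp
      then show "z \<in> ?B" using that \<delta>R \<delta> R dist_triangle[of a z y] by auto
    qed
    have tfH: "t i x \<le> f i x" if "x \<in> H" for i x
      using that R by (intro tf cballH) (auto simp: H_def)
    have close: "(\<integral>\<^sup>+x\<in>H. ennreal (f i x - t i x) \<partial>lborel) \<le> ennreal (C / (real k + 1))" for i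
    proof -
      have eq: "4 * C * (R / (4 * q)) / R = C / q" if "q > 0" for q
        using R that by (simp add: field_simps)
      have "4 * C * \<delta> / R = C / (real k + 1)" unfolding \<delta>_def by (rule eq) simp
      then show ?thesis
        using supermean_L1.smear_close[OF L refl \<delta>R, of i] by (simp add: t_def H_def)
    qed
    have "convergent (\<lambda>i. t i x)" for x
    proof (intro Cauchy_convergent CauchyI)
      fix e :: real assume e: "e > 0"
      define d where "d = e / (3 * (C / m + 1))"
      have Cm: "C / m + 1 > 0" using C m by (simp add: add_nonneg_pos)
      have d: "d > 0" using e Cm by (simp add: d_def)
      obtain q where q: "q \<in> Q" "dist q x < d"
        using dense d closure_approachable[of x Q] by auto
      have *: "\<bar>t i x - t i q\<bar> < e / 3" for i
      proof -
        have "\<bar>t i x - t i q\<bar> \<le> C / m * norm (x - q)" by (rule tlip)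
        also have "\<dots> \<le> (C / m + 1) * norm (x - q)" by (intro mult_right_mono) auto
        also have "\<dots> < (C / m + 1) * d"
          using q Cm by (intro mult_strict_left_mono) (auto simp: dist_norm norm_minus_commute)
        also have "\<dots> = e / 3"
          unfolding d_def by (rule canc[OF Cm])
        finally show ?thesis .
      qed
      have "Cauchy (\<lambda>i. t i q)"
        using conv[OF q(1), of k] by (intro convergent_Cauchy) (simp add: t_def \<delta>_def)
      then obtain M where M: "\<And>i j. i \<ge> M \<Longrightarrow> j \<ge> M \<Longrightarrow> norm (t i q - t j q) < e / 3"
        using CauchyD[of "\<lambda>i. t i q" "e / 3"] e by auto
      show "\<exists>M. \<forall>i\<ge>M. \<forall>j\<ge>M. norm (t i x - t j x) < e"
      proof (intro exI allI impI)
        fix i j assume "M \<le> i" "M \<le> j"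
        then show "norm (t i x - t j x) < e"
          using M[of i j] *[of i] *[of j] unfolding real_norm_def by linarith
      qed
    qed
    then obtain s where s: "\<And>x. (\<lambda>i. t i x) \<longlonglongrightarrow> s x"
      unfolding convergent_def by metis
    have smeas[measurable]: "s \<in> borel_measurable borel"
      using s tmeas by (rule borel_measurable_LIMSEQ_real)
    have s0: "0 \<le> s x" for x using s by (rule LIMSEQ_le_const) (auto simp: t0)
    have sK: "s x \<le> K" for x using s by (rule LIMSEQ_le_const2) (auto simp: tK)
    have s_le: "ennreal (s x) \<le> fl x" if x: "x \<in> H" for x
    proof (rule ennreal_le_epsilon)
      fix e :: real assume e: "e > 0"
      define d where "d = min (e / (2 * (C / m + 1))) (R / 4)"
      have Cm: "C / m + 1 > 0" using C m by (simp add: add_nonneg_pos)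
      have d: "d > 0" using e Cm R by (simp add: d_def)
      have "\<forall>\<^sub>F i in sequentially. s x - e / 2 < t i x"
        using s[of x] e by (intro order_tendstoD) auto
      then have "\<forall>\<^sub>F i in sequentially. \<forall>y\<in>ball x d. max 0 (s x - e) \<le> f i y"
      proof eventually_elim
        case (elim i)
        show ?case
        proof
          fix y assume y: "y \<in> ball x d"
          have "dist a y < 3 * R / 4"
            using y x dist_triangle[of a y x] by (auto simp: H_def d_def)
          then have ty: "t i y \<le> f i y" by (intro tf cballH) auto
          have "\<bar>t i x - t i y\<bar> \<le> C / m * norm (x - y)" by (rule tlip)
          also have "\<dots> \<le> (C / m + 1) * norm (x - y)" by (intro mult_right_mono) auto
          also have "\<dots> \<le> (C / m + 1) * (e / (2 * (C / m + 1)))"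
            using y Cm by (intro mult_left_mono) (auto simp: d_def dist_norm)
          also have "\<dots> = e / 2"
            by (rule canc[OF Cm])
          finally have "t i y \<ge> s x - e" using elim by linarith
          with ty t0[of i y] show "max 0 (s x - e) \<le> f i y" by simp
        qed
      qed
      then have "ennreal (max 0 (s x - e)) \<le> fl x"
        using x d by (intro above[of x _ d]) (auto simp: H_def)
      moreover have "ennreal (s x) \<le> ennreal (max 0 (s x - e)) + ennreal e"
        using e by (simp flip: ennreal_plus add: ennreal_leI)
      ultimately show "ennreal (s x) \<le> fl x + ennreal e"
        by (meson add_right_mono order_trans)
    qed
    have finH: "(\<integral>\<^sup>+x. ennreal c * indicator H x \<partial>lborel) < \<infinity>" for c
      using emeasure_lborel_ball_finite[of a "R / 2"]
      by (subst nn_integral_cmult_indicator) (auto simp: H_def ennreal_mult_less_top)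
    define e where "e = (\<lambda>i. \<integral>\<^sup>+x. ennreal \<bar>t i x - s x\<bar> * indicator H x \<partial>lborel)"
    have e: "e \<longlonglongrightarrow> 0"
    proof -
      have "e \<longlonglongrightarrow> (\<integral>\<^sup>+x. 0 \<partial>(lborel :: (complex^'n) measure))"
        unfolding e_def
      proof (rule nn_integral_dominated_convergence[where w = "\<lambda>x. ennreal K * indicator H x"])
        show "AE x in lborel. ennreal \<bar>t i x - s x\<bar> * indicator H x \<le> ennreal K * indicator H x" for i
        proof (intro AE_I2 mult_right_mono ennreal_leI)
          fix x show "\<bar>t i x - s x\<bar> \<le> K" using t0[of i x] tK[of i x] s0[of x] sK[of x] by linarith
        qed simp
        show "AE x in lborel. (\<lambda>i. ennreal \<bar>t i x - s x\<bar> * indicator H x) \<longlonglongrightarrow> 0"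
        proof (intro AE_I2)
          fix x
          have "(\<lambda>i. \<bar>t i x - s x\<bar>) \<longlonglongrightarrow> \<bar>s x - s x\<bar>"
            by (intro tendsto_intros s)
          then have "(\<lambda>i. ennreal \<bar>t i x - s x\<bar>) \<longlonglongrightarrow> ennreal 0"
            by (intro tendsto_ennrealI) simp
          then show "(\<lambda>i. ennreal \<bar>t i x - s x\<bar> * indicator H x) \<longlonglongrightarrow> 0"
            by (cases "x \<in> H") simp_all
        qed
      qed (use finH in \<open>auto\<close>)
      then show ?thesis by simp
    qed
    have tlim: "(\<lambda>i. \<integral>\<^sup>+x. ennreal (t i x) * indicator H x \<partial>lborel)
        \<longlonglongrightarrow> (\<integral>\<^sup>+x. ennreal (s x) * indicator H x \<partial>lborel)"
    proof (rule nn_integral_dominated_convergence[where w = "\<lambda>x. ennreal K * indicator H x"])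
      show "AE x in lborel. ennreal (t i x) * indicator H x \<le> ennreal K * indicator H x" for i
        by (intro AE_I2 mult_right_mono ennreal_leI tK) simp
      show "AE x in lborel. (\<lambda>i. ennreal (t i x) * indicator H x) \<longlonglongrightarrow> ennreal (s x) * indicator H x"
      proof (intro AE_I2)
        fix x
        show "(\<lambda>i. ennreal (t i x) * indicator H x) \<longlonglongrightarrow> ennreal (s x) * indicator H x"
          using tendsto_ennrealI[OF s[of x]] by (cases "x \<in> H") auto
      qed
    qed (use finH in \<open>auto\<close>)
    have fmeas[measurable]: "(\<lambda>x. ennreal (f i x) * indicator H x) \<in> borel_measurable borel" for i
    proof -
      have "(\<lambda>x. (ennreal (f i x) * indicator ?B x) * indicator H x) \<in> borel_measurable borel"
        using super[of i] by (intro borel_measurable_times_ennreal measurable_on_open)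
          (auto simp: supermean_def)
      also have "(\<lambda>x. (ennreal (f i x) * indicator ?B x) * indicator H x)
          = (\<lambda>x. ennreal (f i x) * indicator H x)"
        using R by (auto simp: fun_eq_iff H_def split: split_indicator)
      finally show ?thesis .
    qed
    have gmeas[measurable]: "(\<lambda>x. ennreal (f i x - t i x) * indicator H x) \<in> borel_measurable borel" for i
    proof -
      have "(\<lambda>x. ennreal (f i x) * indicator H x - ennreal (t i x)) \<in> borel_measurable borel"
        by measurable
      also have "(\<lambda>x. ennreal (f i x) * indicator H x - ennreal (t i x))
          = (\<lambda>x. ennreal (f i x - t i x) * indicator H x)"
        using t0 by (auto simp: ennreal_minus fun_eq_iff split: split_indicator)
      finally show ?thesis .
    qed
    have flmeas[measurable]: "(\<lambda>x. fl x * indicator H x) \<in> borel_measurable borel"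
      using meas by (simp add: H_def)
    let ?s = "\<integral>\<^sup>+x. ennreal (s x) * indicator H x \<partial>lborel" and ?\<epsilon> = "ennreal (C / (real k + 1))"
    have "(\<integral>\<^sup>+x. fl x * indicator H x \<partial>lborel)
        \<le> (\<integral>\<^sup>+x. liminf (\<lambda>i. ennreal (f i x) * indicator H x) \<partial>lborel)"
      using below by (intro nn_integral_mono) (auto simp: H_def split: split_indicator)
    also have "\<dots> \<le> liminf (\<lambda>i. \<integral>\<^sup>+x. ennreal (f i x) * indicator H x \<partial>lborel)"
      by (rule nn_integral_liminf) simp
    also have "\<dots> \<le> liminf (\<lambda>i. (\<integral>\<^sup>+x. ennreal (t i x) * indicator H x \<partial>lborel) + ?\<epsilon>)"
    proof (intro Liminf_mono always_eventually allI)
      fix i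
      have "(\<integral>\<^sup>+x. ennreal (f i x) * indicator H x \<partial>lborel)
        = (\<integral>\<^sup>+x. ennreal (t i x) * indicator H x + ennreal (f i x - t i x) * indicator H x \<partial>lborel)"
        using tfH t0 by (intro nn_integral_cong) (auto simp flip: ennreal_plus split: split_indicator)
      also have "\<dots> = (\<integral>\<^sup>+x. ennreal (t i x) * indicator H x \<partial>lborel)
          + (\<integral>\<^sup>+x. ennreal (f i x - t i x) * indicator H x \<partial>lborel)"
        by (rule nn_integral_add) auto
      also have "\<dots> \<le> (\<integral>\<^sup>+x. ennreal (t i x) * indicator H x \<partial>lborel) + ?\<epsilon>"
        using close by (intro add_left_mono)
      finally show "(\<integral>\<^sup>+x. ennreal (f i x) * indicator H x \<partial>lborel)
        \<le> (\<integral>\<^sup>+x. ennreal (t i x) * indicator H x \<partial>lborel) + ?\<epsilon>" .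
    qed
    also have "\<dots> = ?s + ?\<epsilon>"
      by (intro lim_imp_Liminf tendsto_add tlim tendsto_const) simp
    finally have fl_le: "(\<integral>\<^sup>+x. fl x * indicator H x \<partial>lborel) \<le> ?s + ?\<epsilon>" .
    have dmeas[measurable]: "(\<lambda>x. (fl x - ennreal (s x)) * indicator H x) \<in> borel_measurable borel"
    proof -
      have "(\<lambda>x. fl x * indicator H x - ennreal (s x)) \<in> borel_measurable borel"
        by (intro borel_measurable_minus_ennreal flmeas) measurable
      also have "(\<lambda>x. fl x * indicator H x - ennreal (s x)) = (\<lambda>x. (fl x - ennreal (s x)) * indicator H x)"
        by (auto simp: fun_eq_iff split: split_indicator)
      finally show ?thesis .
    qed
    have "?s + (\<integral>\<^sup>+x. (fl x - ennreal (s x)) * indicator H x \<partial>lborel)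
        = (\<integral>\<^sup>+x. ennreal (s x) * indicator H x + (fl x - ennreal (s x)) * indicator H x \<partial>lborel)"
      using dmeas by (intro nn_integral_add[symmetric]) auto
    also have "\<dots> = (\<integral>\<^sup>+x. fl x * indicator H x \<partial>lborel)"
      using s_le by (intro nn_integral_cong) (auto split: split_indicator)
    also note fl_le
    finally have "(\<integral>\<^sup>+x. (fl x - ennreal (s x)) * indicator H x \<partial>lborel) \<le> ?\<epsilon>"
    proof -
      assume *: "?s + (\<integral>\<^sup>+x. (fl x - ennreal (s x)) * indicator H x \<partial>lborel) \<le> ?s + ?\<epsilon>"
      have "?s \<le> (\<integral>\<^sup>+x. ennreal K * indicator H x \<partial>lborel)"
        by (intro nn_integral_mono mult_right_mono ennreal_leI sK) simp
      then have "?s < \<infinity>" using finH le_less_trans by blast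
      with * show ?thesis by auto
    qed
    note diff = this
    have "D i \<le> ennreal (2 * C / (real k + 1)) + e i" for i
    proof -
      have "D i \<le> (\<integral>\<^sup>+x. ennreal (f i x - t i x) * indicator H x
          + (ennreal \<bar>t i x - s x\<bar> * indicator H x + (fl x - ennreal (s x)) * indicator H x) \<partial>lborel)"
        unfolding D_def
      proof (intro nn_integral_mono)
        fix x
        show "((ennreal (f i x) - fl x) + (fl x - ennreal (f i x))) * indicator H x
          \<le> ennreal (f i x - t i x) * indicator H x
          + (ennreal \<bar>t i x - s x\<bar> * indicator H x + (fl x - ennreal (s x)) * indicator H x)"
        proof (cases "x \<in> H")
          case True
          from ennreal_dist_triangle[OF t0 tfH[OF True] s0 s_le[OF True]] True show ?thesis by simp
        qed simp
      qed
      also have "\<dots> = (\<integral>\<^sup>+x. ennreal (f i x - t i x) * indicator H x \<partial>lborel)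
          + (\<integral>\<^sup>+x. ennreal \<bar>t i x - s x\<bar> * indicator H x + (fl x - ennreal (s x)) * indicator H x \<partial>lborel)"
        using gmeas dmeas by (intro nn_integral_add) auto
      also have "(\<integral>\<^sup>+x. ennreal \<bar>t i x - s x\<bar> * indicator H x + (fl x - ennreal (s x)) * indicator H x \<partial>lborel)
          = e i + (\<integral>\<^sup>+x. (fl x - ennreal (s x)) * indicator H x \<partial>lborel)"
        unfolding e_def using dmeas by (intro nn_integral_add) auto
      also have "(\<integral>\<^sup>+x. ennreal (f i x - t i x) * indicator H x \<partial>lborel) + \<dots> \<le> ?\<epsilon> + (e i + ?\<epsilon>)"
        using close diff by (intro add_mono) auto
      also have "\<dots> = ennreal (2 * C / (real k + 1)) + e i"
      proof -
        have "?\<epsilon> + ?\<epsilon> = ennreal (2 * C / (real k + 1))"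
          using C by (simp flip: ennreal_plus)
        then show ?thesis by (metis add.assoc add.commute)
      qed
      finally show ?thesis .
    qed
    with e show ?thesis by blast
  qed
  have "D \<longlonglongrightarrow> 0"
  proof (rule order_tendstoI)
    fix y :: ennreal assume "0 < y"
    obtain r where r: "0 < r" "ennreal r < y"
    proof (cases y)
      case (real v)
      with \<open>0 < y\<close> have "0 < v" by simp
      then show ?thesis using that[of "v / 2"] real by (simp add: ennreal_less_iff)
    next
      case top
      then show ?thesis using that[of 1] by simp
    qed
    obtain k where k: "4 * C / r < real k" using reals_Archimedean2 by blast
    then have "2 * C / (real k + 1) < r / 2" using r by (simp add: field_simps)
    obtain e where e: "e \<longlonglongrightarrow> 0" "\<And>i. D i \<le> ennreal (2 * C / (real k + 1)) + e i"
      using main[of k] by blast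
    have "\<forall>\<^sub>F i in sequentially. e i < ennreal (r / 2)"
      using e(1) r by (intro order_tendstoD) auto
    then show "\<forall>\<^sub>F i in sequentially. D i < y"
    proof eventually_elim
      case (elim i)
      have "D i \<le> ennreal (r / 2) + ennreal (r / 2)"
        using e(2)[of i] elim \<open>2 * C / (real k + 1) < r / 2\<close>
        by (meson add_mono ennreal_leI less_imp_le order_trans)
      also have "\<dots> = ennreal r" using r by (simp flip: ennreal_plus)
      finally show ?case using r by simp
    qed
  qed simp
  then show ?thesis by (simp add: D_def[abs_def] H_def)
qed

section \<open>Levi forms and (1,1)-forms\<close>

lemma c2_on_smooth:
  fixes f :: "'v::euclidean_space \<Rightarrow> real"
  assumes f: "smooth_on S f"
  shows "c2_on S f (\<lambda>b. iter_deriv [b] f) (\<lambda>b' b. iter_deriv [b', b] f)"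
proof -
  have diff: "iter_deriv vs f differentiable (at x)" if "x \<in> S" for vs x
    using f that unfolding smooth_on_def by blast
  have rep: "(g has_derivative (\<lambda>v. \<Sum>b\<in>Basis. (v \<bullet> b) * frechet_derivative g (at x) b)) (at x)"
    if "g differentiable (at x)" for g :: "'v \<Rightarrow> real" and x
  proof -
    have g: "(g has_derivative frechet_derivative g (at x)) (at x)"
      using that by (simp add: frechet_derivative_works)
    have "frechet_derivative g (at x) v = (\<Sum>b\<in>Basis. (v \<bullet> b) * frechet_derivative g (at x) b)" for v
      using linear_sum[OF has_derivative_linear[OF g], of "\<lambda>b. (v \<bullet> b) *\<^sub>R b" Basis]
        linear_scale[OF has_derivative_linear[OF g]]
      by (simp add: euclidean_representation)
    then show ?thesis by (intro has_derivative_eq_rhs[OF g] ext)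
  qed
  show ?thesis
    unfolding c2_on_def
  proof (intro conjI ballI)
    fix x assume x: "x \<in> S"
    show "(f has_derivative (\<lambda>v. \<Sum>b\<in>Basis. (v \<bullet> b) * iter_deriv [b] f x)) (at x)"
      using rep[OF diff[OF x, of "[]"]] by simp
    show "(iter_deriv [b] f has_derivative (\<lambda>v. \<Sum>b'\<in>Basis. (v \<bullet> b') * iter_deriv [b', b] f x)) (at x)"
      for b
      using rep[OF diff[OF x, of "[b]"]] by simp
  next
    show "continuous_on S (iter_deriv [b', b] f)" for b b'
      using diff by (intro continuous_at_imp_continuous_on ballI differentiable_imp_continuous_within)
  qed
qed

lemma c2_on_lincomb:
  assumes u: "c2_on V u u1 u2" and w: "c2_on V w w1 w2"
  shows "c2_on V (\<lambda>x. \<alpha> * u x + \<beta> * w x) (\<lambda>b x. \<alpha> * u1 b x + \<beta> * w1 b x)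
    (\<lambda>b' b x. \<alpha> * u2 b' b x + \<beta> * w2 b' b x)"
proof -
  have comb: "((\<lambda>x. \<alpha> * f x + \<beta> * g x) has_derivative (\<lambda>v. \<Sum>b\<in>Basis. (v \<bullet> b) * (\<alpha> * F b + \<beta> * G b))) (at x)"
    if f: "(f has_derivative (\<lambda>v. \<Sum>b\<in>Basis. (v \<bullet> b) * F b)) (at x)"
      and g: "(g has_derivative (\<lambda>v. \<Sum>b\<in>Basis. (v \<bullet> b) * G b)) (at x)"
    for f g :: "'a \<Rightarrow> real" and F G x
  proof -
    have "((\<lambda>x. \<alpha> * f x + \<beta> * g x) has_derivative
        (\<lambda>v. \<alpha> * (\<Sum>b\<in>Basis. (v \<bullet> b) * F b) + \<beta> * (\<Sum>b\<in>Basis. (v \<bullet> b) * G b))) (at x)"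
      by (intro has_derivative_add has_derivative_mult_right f g)
    then show ?thesis
      by (simp add: sum_distrib_left sum.distrib algebra_simps)
  qed
  show ?thesis
    unfolding c2_on_def
  proof (intro conjI ballI)
    fix x assume "x \<in> V"
    then show "((\<lambda>x. \<alpha> * u x + \<beta> * w x) has_derivative
        (\<lambda>v. \<Sum>b\<in>Basis. (v \<bullet> b) * (\<alpha> * u1 b x + \<beta> * w1 b x))) (at x)"
      using u w unfolding c2_on_def by (intro comb) blast+
    show "((\<lambda>x. \<alpha> * u1 b x + \<beta> * w1 b x) has_derivative
        (\<lambda>v. \<Sum>b'\<in>Basis. (v \<bullet> b') * (\<alpha> * u2 b' b x + \<beta> * w2 b' b x))) (at x)" if "b \<in> Basis" for b
      using u w that \<open>x \<in> V\<close> unfolding c2_on_def by (intro comb) blast+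
  next
    fix b b' :: 'a assume "b \<in> Basis" "b' \<in> Basis"
    then show "continuous_on V (\<lambda>x. \<alpha> * u2 b' b x + \<beta> * w2 b' b x)"
      using u w unfolding c2_on_def by (intro continuous_intros) blast+
  qed
qed

lemma hess_lincomb:
  "hess (\<lambda>b' b x. \<alpha> * u2 b' b x + \<beta> * w2 b' b x) x v = \<alpha> * hess u2 x v + \<beta> * hess w2 x v"
  unfolding hess_def by (simp add: sum_distrib_left sum.distrib algebra_simps)

lemma levi_lincomb:
  "levi (\<lambda>b' b x. \<alpha> * u2 b' b x + \<beta> * w2 b' b x) x v = \<alpha> * levi u2 x v + \<beta> * levi w2 x v"
  unfolding levi_def hess_lincomb by (simp add: algebra_simps)

lemma sum_Basis_twice_inner: "(\<Sum>b\<in>Basis. (v \<bullet> b) * (2 * (w \<bullet> b))) = 2 * (v \<bullet> w)"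
  by (subst euclidean_inner[of v w]) (simp add: sum_distrib_left mult_ac)

lemma c2_on_norm2:
  fixes a :: "'v::euclidean_space"
  shows "c2_on V (\<lambda>x. (x - a) \<bullet> (x - a)) (\<lambda>b x. 2 * ((x - a) \<bullet> b)) (\<lambda>b' b x. 2 * (b' \<bullet> b))"
  unfolding c2_on_def
proof (intro conjI ballI)
  fix x
  have "((\<lambda>x. (x - a) \<bullet> (x - a)) has_derivative (\<lambda>v. (x - a) \<bullet> v + v \<bullet> (x - a))) (at x)"
    by (auto intro!: derivative_eq_intros)
  also have "(\<lambda>v. (x - a) \<bullet> v + v \<bullet> (x - a)) = (\<lambda>v. \<Sum>b\<in>Basis. (v \<bullet> b) * (2 * ((x - a) \<bullet> b)))"
    unfolding sum_Basis_twice_inner by (simp add: inner_commute)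
  finally show "((\<lambda>x. (x - a) \<bullet> (x - a)) has_derivative
      (\<lambda>v. \<Sum>b\<in>Basis. (v \<bullet> b) * (2 * ((x - a) \<bullet> b)))) (at x)" .
  fix b :: 'v
  have "((\<lambda>x. 2 * ((x - a) \<bullet> b)) has_derivative (\<lambda>v. 2 * (v \<bullet> b))) (at x)"
    by (auto intro!: derivative_eq_intros)
  then show "((\<lambda>x. 2 * ((x - a) \<bullet> b)) has_derivative
      (\<lambda>v. \<Sum>b'\<in>Basis. (v \<bullet> b') * (2 * (b' \<bullet> b)))) (at x)"
    by (rule has_derivative_eq_rhs)
      (use sum_Basis_twice_inner[of _ b] in \<open>simp add: inner_commute[of b]\<close>)
qed auto

lemma levi_norm2:
  fixes v :: "complex^'n::finite"
  shows "levi (\<lambda>b' b x. 2 * (b' \<bullet> b)) x v = 4 * (norm v)\<^sup>2"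
proof -
  have "hess (\<lambda>b' b x. 2 * (b' \<bullet> b)) x v = 2 * (norm v)\<^sup>2" for v :: "complex^'n"
  proof -
    have "(\<Sum>b'\<in>Basis. (v \<bullet> b') * (2 * (b' \<bullet> b))) = 2 * (v \<bullet> b)" for b
      using sum_Basis_twice_inner[of v b] by (simp add: inner_commute[of b])
    then have "hess (\<lambda>b' b x. 2 * (b' \<bullet> b)) x v = (\<Sum>b\<in>Basis. (v \<bullet> b) * (2 * (v \<bullet> b)))"
      unfolding hess_def by simp
    then show ?thesis unfolding sum_Basis_twice_inner by (simp add: power2_norm_eq_inner)
  qed
  then show ?thesis by (simp add: levi_def norm_vector_smult)
qed

lemma sum_complex_Basis:
  "(\<Sum>b\<in>(Basis :: (complex^'n::finite) set). g b) = (\<Sum>k\<in>UNIV. g (axis k 1) + g (axis k \<i>))"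
proof -
  have B: "(Basis :: (complex^'n) set) = (\<lambda>(k, u). axis k u) ` (UNIV \<times> {1, \<i>})"
    by (auto simp: Basis_vec_def Basis_complex_def)
  have inj: "inj_on (\<lambda>(k, u). axis k u :: complex^'n) (UNIV \<times> {1, \<i>})"
    by (auto simp: inj_on_def axis_eq_axis)
  have "(\<Sum>b\<in>(Basis :: (complex^'n) set). g b) = (\<Sum>(k, u)\<in>UNIV \<times> {1, \<i>}. g (axis k u))"
    unfolding B by (subst sum.reindex[OF inj]) (simp add: case_prod_unfold)
  also have "\<dots> = (\<Sum>k\<in>UNIV. \<Sum>u\<in>{1, \<i>}. g (axis k u))"
    by (rule sum.cartesian_product[symmetric])
  finally show ?thesis by simp
qed

lemma inner_axis_complex: "v \<bullet> axis k (1::complex) = Re (v $ k)" "v \<bullet> axis k \<i> = Im (v $ k)"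
  by (simp_all add: inner_axis inner_complex_def)

definition herm_form :: "complex^'n^'n \<Rightarrow> complex^'n::finite \<Rightarrow> real" where
  "herm_form H v = Re (\<Sum>j\<in>UNIV. \<Sum>k\<in>UNIV. H $ j $ k * (v $ j * cnj (v $ k)))"

text \<open>Four times an entry of the complex Hessian is
  \<open>(\<partial>/\<partial>x\<^sub>j - \<i> \<partial>/\<partial>y\<^sub>j) (\<partial>/\<partial>x\<^sub>k + \<i> \<partial>/\<partial>y\<^sub>k) f\<close>; multiplying out and taking real parts gives the
  second derivatives along \<open>v\<close> and \<open>\<i> v\<close>.  This links the complex Hessian, through which the potential
  enters a form, to the real second derivatives that enter the circle means.\<close>

lemma levi_complex_hessian:
  assumes S: "open S" and f: "smooth_on S f" and z: "z \<in> S"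
  shows "levi (\<lambda>b' b. iter_deriv [b', b] f) z v = 4 * herm_form (complex_hessian f z) v"
proof -
  have diff: "iter_deriv vs f differentiable (at x)" if "x \<in> S" for vs x
    using f that unfolding smooth_on_def by blast
  let ?d = "\<lambda>a b. iter_deriv [a, b] f z"
  have fd: "frechet_derivative (\<lambda>w. complex_of_real (g w)) (at x) = (\<lambda>v. complex_of_real (frechet_derivative g (at x) v))"
    if "g differentiable (at x)" for g :: "complex^'a \<Rightarrow> real" and x
    using that
    by (intro frechet_derivative_at[symmetric] bounded_linear.has_derivative[OF bounded_linear_of_real])
      (simp add: frechet_derivative_works[symmetric])
  have dzb: "dzbar k (\<lambda>w. complex_of_real (f w)) x
      = (complex_of_real (iter_deriv [axis k 1] f x) + \<i> * complex_of_real (iter_deriv [axis k \<i>] f x)) / 2"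
    if "x \<in> S" for k x
    using fd[OF diff[OF that, of "[]", simplified]] by (simp add: dzbar_def)
  have dzb': "frechet_derivative (dzbar k (\<lambda>w. complex_of_real (f w))) (at z) a
      = (complex_of_real (?d a (axis k 1)) + \<i> * complex_of_real (?d a (axis k \<i>))) / 2" for k a
  proof -
    let ?g = "\<lambda>x. (complex_of_real (iter_deriv [axis k 1] f x) + \<i> * complex_of_real (iter_deriv [axis k \<i>] f x)) / 2"
    let ?g' = "\<lambda>a. (complex_of_real (frechet_derivative (iter_deriv [axis k 1] f) (at z) a)
        + \<i> * complex_of_real (frechet_derivative (iter_deriv [axis k \<i>] f) (at z) a)) / 2"
    have D: "((\<lambda>x. complex_of_real (iter_deriv [e] f x)) has_derivative
        (\<lambda>a. complex_of_real (frechet_derivative (iter_deriv [e] f) (at z) a))) (at z)" for e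
      using diff[OF z, of "[e]"]
      by (intro bounded_linear.has_derivative[OF bounded_linear_of_real])
        (simp only: frechet_derivative_works)
    have "(?g has_derivative ?g') (at z)"
      using has_derivative_add[OF D[of "axis k 1"] has_derivative_mult_right[OF D[of "axis k \<i>"], of \<i>]]
      by (rule bounded_linear.has_derivative[OF bounded_linear_divide])
    then have "(dzbar k (\<lambda>w. complex_of_real (f w)) has_derivative ?g') (at z)"
      by (rule has_derivative_transform_within_open[OF _ S z]) (simp add: dzb)
    from frechet_derivative_at[OF this, symmetric] show ?thesis by simp
  qed
  have H: "complex_hessian f z $ j $ k = (complex_of_real (?d (axis j 1) (axis k 1) + ?d (axis j \<i>) (axis k \<i>))
      + \<i> * complex_of_real (?d (axis j 1) (axis k \<i>) - ?d (axis j \<i>) (axis k 1))) / 4" for j k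
    unfolding complex_hessian_def dz_def by (simp add: dzb') (simp add: field_simps)
  let ?x = "\<lambda>k. Re (v $ k)" and ?y = "\<lambda>k. Im (v $ k)"
  have h: "hess (\<lambda>b' b. iter_deriv [b', b] f) z u = (\<Sum>k\<in>UNIV. \<Sum>j\<in>UNIV.
      Re (u $ k) * (Re (u $ j) * ?d (axis j 1) (axis k 1) + Im (u $ j) * ?d (axis j \<i>) (axis k 1))
      + Im (u $ k) * (Re (u $ j) * ?d (axis j 1) (axis k \<i>) + Im (u $ j) * ?d (axis j \<i>) (axis k \<i>)))"
    for u
    unfolding hess_def sum_complex_Basis sum_distrib_left sum.distrib[symmetric]
    by (intro sum.cong refl) (simp add: inner_axis_complex algebra_simps del: iter_deriv.simps)
  have "levi (\<lambda>b' b. iter_deriv [b', b] f) z v = (\<Sum>k\<in>UNIV. \<Sum>j\<in>UNIV.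
      4 * Re (complex_hessian f z $ j $ k * (v $ j * cnj (v $ k))))"
    unfolding levi_def h sum.distrib[symmetric]
    by (intro sum.cong refl) (simp add: H del: iter_deriv.simps, simp add: algebra_simps del: iter_deriv.simps)
  also have "\<dots> = 4 * herm_form (complex_hessian f z) v"
    unfolding herm_form_def by (subst sum.swap) (simp add: sum_distrib_left)
  finally show ?thesis .
qed

lemma bilinear_form:
  assumes "alternating 2 f"
  shows "linear (\<lambda>v. f [v, w])" "linear (\<lambda>w. f [v, w])"
  using alternating_linear[OF assms, of "[v, w]" 0] alternating_linear[OF assms, of "[v, w]" 1]
  by simp_all

lemma form_expand:
  assumes f: "alternating 2 f"
  shows "f [v, w] = (\<Sum>b\<in>Basis. \<Sum>b'\<in>Basis. (v \<bullet> b) * ((w \<bullet> b') * f [b, b' :: 'v::euclidean_space]))"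
proof -
  note l1 = bilinear_form(1)[OF f] and l2 = bilinear_form(2)[OF f]
  have "f [v, w] = f [\<Sum>b\<in>Basis. (v \<bullet> b) *\<^sub>R b, w]" by (simp add: euclidean_representation)
  also have "\<dots> = (\<Sum>b\<in>Basis. (v \<bullet> b) * f [b, w])"
    using linear_sum[OF l1[of w], of "\<lambda>b. (v \<bullet> b) *\<^sub>R b" Basis] linear_scale[OF l1[of w]] by simp
  also have "\<dots> = (\<Sum>b\<in>Basis. (v \<bullet> b) * (\<Sum>b'\<in>Basis. (w \<bullet> b') * f [b, b']))"
  proof (intro sum.cong refl arg_cong2[where f = "(*)"])
    fix b
    have "f [b, w] = f [b, \<Sum>b'\<in>Basis. (w \<bullet> b') *\<^sub>R b']" by (simp add: euclidean_representation)
    also have "\<dots> = (\<Sum>b'\<in>Basis. (w \<bullet> b') * f [b, b'])"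
      using linear_sum[OF l2[of b], of "\<lambda>b'. (w \<bullet> b') *\<^sub>R b'" Basis] linear_scale[OF l2[of b]] by simp
    finally show "f [b, w] = (\<Sum>b'\<in>Basis. (w \<bullet> b') * f [b, b'])" .
  qed
  finally show ?thesis by (simp add: sum_distrib_left)
qed

text \<open>Together with \<open>levi_complex_hessian\<close> and \<open>idd_levi\<close> this compares a (1,1)-form with the Levi
  form of a local potential: both are determined by their values on \<open>v, \<i> v\<close>.\<close>

lemma form_coeffs:
  fixes \<omega> :: "('a, 'n::finite) form"
  assumes f: "alternating 2 (\<omega> c p)" and rot: "rotation_invariant \<omega>"
  shows "\<omega> c p [v, \<i> *s v] = 2 * herm_form (coeffs \<omega> c p) v"
proof -
  let ?W = "\<lambda>a b. \<omega> c p [a, b]"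
  have I: "?W (\<i> *s a) (\<i> *s b) = ?W a b" for a b
  proof -
    have "rotate_form \<i> \<omega> c p [a, b] = \<omega> c p [a, b]"
      using rot by (simp add: rotation_invariant_def)
    then show ?thesis by (simp add: rotate_form_def)
  qed
  have ax: "\<i> *s axis j 1 = (axis j \<i> :: complex^'n)" "\<i> *s axis j \<i> = (- axis j 1 :: complex^'n)" for j
    by (auto simp: vec_eq_iff axis_def)
  have W1: "?W (axis j \<i>) (axis k \<i>) = ?W (axis j 1) (axis k 1)" for j k
    using I[of "axis j 1" "axis k 1"] by (simp add: ax)
  have W2: "?W (axis j \<i>) (axis k 1) = - ?W (axis j 1) (axis k \<i>)" for j k
    using I[of "axis j \<i>" "axis k 1"] linear_neg[OF bilinear_form(1)[OF f]] by (simp add: ax)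
  have "\<omega> c p [v, \<i> *s v] = (\<Sum>j\<in>UNIV. \<Sum>k\<in>UNIV.
      (Re (v $ j) * Re (v $ k) + Im (v $ j) * Im (v $ k)) * ?W (axis j 1) (axis k \<i>)
      + (Im (v $ j) * Re (v $ k) - Re (v $ j) * Im (v $ k)) * ?W (axis j 1) (axis k 1))"
    unfolding form_expand[OF f, of v "\<i> *s v"] sum_complex_Basis sum.distrib[symmetric]
    by (intro sum.cong refl) (simp add: inner_axis_complex W1 W2 algebra_simps)
  also have "\<dots> = (\<Sum>j\<in>UNIV. \<Sum>k\<in>UNIV. 2 * Re (coeffs \<omega> c p $ j $ k * (v $ j * cnj (v $ k))))"
    by (intro sum.cong refl) (simp add: coeffs_def field_simps)
  finally show ?thesis
    by (simp add: herm_form_def sum_distrib_left)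
qed

lemma idd_levi:
  fixes A :: "('a, 'n::finite) chart set"
  assumes "c \<in> A" "p \<in> fst c"
  shows "idd A f c p [v, \<i> *s v] = 2 * herm_form (complex_hessian (f \<circ> cinv c) (snd c p)) v"
proof -
  have "\<i> * (\<Sum>j\<in>UNIV. \<Sum>k\<in>UNIV. H $ j $ k * (v $ j * cnj ((\<i> *s v) $ k) - (\<i> *s v) $ j * cnj (v $ k)))
      = 2 * (\<Sum>j\<in>UNIV. \<Sum>k\<in>UNIV. H $ j $ k * (v $ j * cnj (v $ k)))" for H :: "complex^'n^'n"
    unfolding sum_distrib_left by (intro sum.cong refl) (simp add: algebra_simps)
  then show ?thesis using assms by (simp add: idd_def herm_form_def)
qed

lemma form_bound_on_compact:
  fixes \<omega> :: "('a, 'n::finite) form"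
  assumes \<omega>: "smooth_form A 2 \<omega>" and c: "c \<in> A" and K: "compact K" "K \<subseteq> snd c ` fst c"
  obtains C where "C \<ge> 0" "\<And>x v. x \<in> K \<Longrightarrow> \<omega> c (cinv c x) [v, \<i> *s v] \<le> C * (norm v)\<^sup>2"
proof -
  have bd: "\<exists>M. \<forall>x\<in>K. \<bar>\<omega> c (cinv c x) [b, b']\<bar> \<le> M" for b b'
  proof -
    have "smooth_on (snd c ` fst c) (\<lambda>x. \<omega> c (cinv c x) [b, b'])"
      using \<omega> c unfolding smooth_form_def by simp
    then have "continuous_on K (\<lambda>x. \<omega> c (cinv c x) [b, b'])"
      using smooth_on_continuous K(2) continuous_on_subset by blast
    then have "bounded ((\<lambda>x. \<omega> c (cinv c x) [b, b']) ` K)"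
      using K(1) compact_continuous_image compact_imp_bounded by blast
    then show ?thesis by (auto simp: bounded_iff)
  qed
  define M where "M = (\<lambda>b b'. SOME m. \<forall>x\<in>K. \<bar>\<omega> c (cinv c x) [b, b']\<bar> \<le> m)"
  have M: "\<bar>\<omega> c (cinv c x) [b, b']\<bar> \<le> M b b'" if "x \<in> K" for b b' x
    using bspec[OF someI_ex[OF bd[of b b']] that] unfolding M_def .
  define C where "C = (\<Sum>b\<in>Basis. \<Sum>b'\<in>Basis. \<bar>M b b'\<bar>)"
  have "\<omega> c (cinv c x) [v, \<i> *s v] \<le> C * (norm v)\<^sup>2" if x: "x \<in> K" for x v
  proof -
    have alt: "alternating 2 (\<omega> c (cinv c x))"
      by (rule smooth_form_alternating[OF \<omega> c cinv_mem[OF subsetD[OF K(2) x]]])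
    have "\<omega> c (cinv c x) [v, \<i> *s v] \<le> (\<Sum>b\<in>Basis. \<Sum>b'\<in>Basis. \<bar>M b b'\<bar> * (norm v)\<^sup>2)"
      unfolding form_expand[OF alt, of v "\<i> *s v"]
    proof (intro sum_mono)
      fix b b' :: "complex^'n" assume b: "b \<in> Basis" "b' \<in> Basis"
      have "\<bar>v \<bullet> b\<bar> \<le> norm v" "\<bar>(\<i> *s v) \<bullet> b'\<bar> \<le> norm v"
        using b Basis_le_norm[of b v] Basis_le_norm[of b' "\<i> *s v"] by (simp_all add: norm_vector_smult)
      then have "\<bar>v \<bullet> b\<bar> * (\<bar>(\<i> *s v) \<bullet> b'\<bar> * \<bar>\<omega> c (cinv c x) [b, b']\<bar>) \<le> norm v * (norm v * \<bar>M b b'\<bar>)"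
        using M[OF x, of b b'] by (intro mult_mono) auto
      then show "(v \<bullet> b) * ((\<i> *s v) \<bullet> b' * \<omega> c (cinv c x) [b, b']) \<le> \<bar>M b b'\<bar> * (norm v)\<^sup>2"
        unfolding abs_mult[symmetric] power2_eq_square by (simp only: mult_ac)
    qed
    then show ?thesis by (simp add: C_def sum_distrib_right)
  qed
  moreover have "C \<ge> 0" unfolding C_def by (intro sum_nonneg) auto
  ultimately show ?thesis using that by blast
qed

section \<open>Upper limits of sequences of functions\<close>

text \<open>The half-relaxed upper limit, that is, the largest limit of \<open>\<psi>\<^sub>i (q\<^sub>i)\<close> along subsequences with
  \<open>q\<^sub>i \<rightarrow> p\<close>.  Unlike the pointwise upper limit it is upper semicontinuous without a further
  regularisation, and being defined in terms of open sets only it does not depend on charts.\<close>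

definition upper_limit :: "(nat \<Rightarrow> 'a::topological_space \<Rightarrow> real) \<Rightarrow> 'a \<Rightarrow> ereal" where
  "upper_limit \<psi> p = (INF N\<in>{N. open N \<and> p \<in> N}. limsup (\<lambda>i. SUP q\<in>N. ereal (\<psi> i q)))"

lemma upper_limit_less:
  assumes "upper_limit \<psi> p < a"
  obtains N where "open N" "p \<in> N" "\<forall>\<^sub>F i in sequentially. \<forall>q\<in>N. ereal (\<psi> i q) < a"
    "\<And>q. q \<in> N \<Longrightarrow> upper_limit \<psi> q < a"
proof -
  obtain N where N: "open N" "p \<in> N" "limsup (\<lambda>i. SUP q\<in>N. ereal (\<psi> i q)) < a"
    using assms unfolding upper_limit_def INF_less_iff by blast
  have "\<forall>\<^sub>F i in sequentially. (SUP q\<in>N. ereal (\<psi> i q)) < a"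
    using N(3) by (rule Limsup_lessD)
  then have "\<forall>\<^sub>F i in sequentially. \<forall>q\<in>N. ereal (\<psi> i q) < a"
    by eventually_elim (metis SUP_lessD)
  moreover have "upper_limit \<psi> q < a" if "q \<in> N" for q
    using N that unfolding upper_limit_def INF_less_iff by blast
  ultimately show ?thesis using that N by blast
qed

lemma open_upper_limit_less: "open {p. upper_limit \<psi> p < a}"
  unfolding open_subopen[of "{p. upper_limit \<psi> p < a}"]
  by (metis (mono_tags, lifting) mem_Collect_eq subsetI upper_limit_less)

lemma measurable_upper_limit [measurable]: "upper_limit \<psi> \<in> borel_measurable borel"
  by (rule borel_measurableI_less) (simp add: open_upper_limit_less)

lemma limsup_le_upper_limit: "limsup (\<lambda>i. ereal (\<psi> i p)) \<le> upper_limit \<psi> p"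
  unfolding upper_limit_def
  by (intro INF_greatest Limsup_mono always_eventually allI SUP_upper) auto

lemma upper_limit_le:
  assumes "open N" "p \<in> N" "\<forall>\<^sub>F i in sequentially. \<forall>q\<in>N. ereal (\<psi> i q) \<le> c"
  shows "upper_limit \<psi> p \<le> c"
proof -
  have "upper_limit \<psi> p \<le> limsup (\<lambda>i. SUP q\<in>N. ereal (\<psi> i q))"
    unfolding upper_limit_def using assms by (intro INF_lower) auto
  also have "\<dots> \<le> c"
    using assms(3) by (intro Limsup_bounded) (auto elim!: eventually_mono intro: SUP_least)
  finally show ?thesis .
qed

lemma upper_limit_ge:
  assumes "\<And>N. open N \<Longrightarrow> p \<in> N \<Longrightarrow> \<exists>\<^sub>F i in sequentially. \<exists>q\<in>N. c \<le> ereal (\<psi> i q)"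
  shows "c \<le> upper_limit \<psi> p"
proof (rule ccontr)
  assume "\<not> c \<le> upper_limit \<psi> p"
  then have "upper_limit \<psi> p < c" by simp
  then obtain N where "open N" "p \<in> N" "\<forall>\<^sub>F i in sequentially. \<forall>q\<in>N. ereal (\<psi> i q) < c"
    by (rule upper_limit_less)
  then have "\<forall>\<^sub>F i in sequentially. \<not> (\<exists>q\<in>N. c \<le> ereal (\<psi> i q))"
    by (auto elim!: eventually_mono simp: not_le)
  then show False using assms[OF \<open>open N\<close> \<open>p \<in> N\<close>] by (simp add: frequently_def)
qed

lemma upper_limit_approach:
  assumes "open N" "p \<in> N" "ereal b < upper_limit \<psi> p"
  obtains i q where "i \<ge> m" "q \<in> N" "b < \<psi> i q"
proof -
  have "\<exists>i\<ge>m. \<exists>q\<in>N. b < \<psi> i q"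
  proof (rule ccontr)
    assume "\<not> ?thesis"
    then have "\<forall>\<^sub>F i in sequentially. \<forall>q\<in>N. ereal (\<psi> i q) \<le> ereal b"
      by (intro eventually_sequentiallyI[of m]) force
    then have "upper_limit \<psi> p \<le> ereal b" by (rule upper_limit_le[OF assms(1,2)])
    with assms(3) show False by simp
  qed
  then show ?thesis using that by blast
qed

text \<open>Fatou's lemma for the nonnegative functions \<open>C - v k\<close>, put into the form in which circle means
  of extended real functions are written, as a difference of two nonnegative integrals.  The errors \<open>e\<close>
  leave room for centres that move with \<open>k\<close>.\<close>

lemma reverse_fatou_circle:
  fixes G :: "real \<Rightarrow> ereal" and v :: "nat \<Rightarrow> real \<Rightarrow> real"
  assumes G[measurable]: "G \<in> borel_measurable borel" and C: "C \<ge> 0" "\<And>t. G t \<le> ereal C"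
    and v: "\<And>k. continuous_on {0..2*pi} (v k)" "\<And>k t. v k t \<le> C"
    and lim: "\<And>t. limsup (\<lambda>k. ereal (v k t)) \<le> G t"
    and a: "\<And>k. 2 * pi * a \<le> integral {0..2*pi} (v k) + e k" and e: "e \<longlonglongrightarrow> 0"
  shows "ereal a \<le> (enn2ereal (\<integral>\<^sup>+t\<in>{0..2*pi}. e2ennreal (G t) \<partial>lborel)
      - enn2ereal (\<integral>\<^sup>+t\<in>{0..2*pi}. e2ennreal (- G t) \<partial>lborel)) / ereal (2 * pi)"
proof -
  let ?I = "{0..2*pi}"
  define P where "P = (\<integral>\<^sup>+t\<in>?I. e2ennreal (G t) \<partial>lborel)"
  define N where "N = (\<integral>\<^sup>+t\<in>?I. e2ennreal (- G t) \<partial>lborel)"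
  define Z where "Z = (\<integral>\<^sup>+t\<in>?I. e2ennreal (ereal C - G t) \<partial>lborel)"
  have cI: "(\<integral>\<^sup>+t\<in>?I. ennreal c \<partial>lborel) = ennreal (2 * pi * c)" if "c \<ge> 0" for c
    using that by (subst nn_integral_cmult_indicator) (auto simp: mult.commute simp flip: ennreal_mult)
  have vle: "integral ?I (v k) \<le> 2 * pi * C" for k
  proof -
    have "integral ?I (v k) \<le> integral ?I (\<lambda>t. C)"
      using v by (intro integral_le integrable_continuous_real) auto
    then show ?thesis by simp
  qed
  have Z_le: "Z \<le> ennreal (2 * pi * (C - a))"
  proof -
    have "Z \<le> (\<integral>\<^sup>+t. liminf (\<lambda>k. ennreal (C - v k t) * indicator ?I t) \<partial>lborel)"
      unfolding Z_def
    proof (intro nn_integral_mono)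
      fix t
      have "e2ennreal (ereal C - G t) \<le> liminf (\<lambda>k. ennreal (C - v k t))"
        unfolding le_Liminf_iff
      proof (intro allI impI)
        fix y assume y: "y < e2ennreal (ereal C - G t)"
        then obtain r where r: "y = ennreal r" "r \<ge> 0"
          by (cases y) auto
        have "ereal r < ereal C - G t"
          using y r by (metis e2ennreal_enn2ereal e2ennreal_mono enn2ereal_ennreal leD not_le_imp_less)
        then have "G t < ereal (C - r)"
          by (cases "G t") auto
        then have "limsup (\<lambda>k. ereal (v k t)) < ereal (C - r)" using lim le_less_trans by blast
        then have "\<forall>\<^sub>F k in sequentially. ereal (v k t) < ereal (C - r)" by (rule Limsup_lessD)
        then show "\<forall>\<^sub>F k in sequentially. y < ennreal (C - v k t)"
          by eventually_elim (use r in \<open>simp add: ennreal_less_iff\<close>)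
      qed
      then show "e2ennreal (ereal C - G t) * indicator ?I t
          \<le> liminf (\<lambda>k. ennreal (C - v k t) * indicator ?I t)"
        by (cases "t \<in> ?I") auto
    qed
    also have "\<dots> \<le> liminf (\<lambda>k. \<integral>\<^sup>+t. ennreal (C - v k t) * indicator ?I t \<partial>lborel)"
    proof (rule nn_integral_liminf)
      fix k
      have "(\<lambda>t. indicator ?I t *\<^sub>R (C - v k t)) \<in> borel_measurable borel"
        using v(1) by (intro borel_measurable_continuous_on_indicator continuous_intros) auto
      then have "(\<lambda>t. ennreal (indicator ?I t *\<^sub>R (C - v k t))) \<in> borel_measurable lborel" by simp
      also have "(\<lambda>t. ennreal (indicator ?I t *\<^sub>R (C - v k t))) = (\<lambda>t. ennreal (C - v k t) * indicator ?I t)"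
        by (auto simp: indicator_def)
      finally show "(\<lambda>t. ennreal (C - v k t) * indicator ?I t) \<in> borel_measurable lborel" .
    qed
    also have "\<dots> \<le> liminf (\<lambda>k. ennreal (2 * pi * (C - a) + e k))"
    proof (intro Liminf_mono always_eventually allI)
      fix k
      have "((\<lambda>t. C - v k t) has_integral (2 * pi * C - integral ?I (v k))) ?I"
        using has_integral_diff[OF has_integral_const_real[of C 0 "2*pi"] integrable_integral[OF integrable_continuous_real[OF v(1)[of k]]]]
        by simp
      then have "(\<integral>\<^sup>+t. ennreal (C - v k t) * indicator ?I t \<partial>lborel) = ennreal (2 * pi * C - integral ?I (v k))"
        using v(2) by (intro nn_integral_has_integral_lebesgue') auto
      also have "\<dots> \<le> ennreal (2 * pi * (C - a) + e k)"
        using a[of k] by (intro ennreal_leI) (simp add: right_diff_distrib)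
      finally show "(\<integral>\<^sup>+t. ennreal (C - v k t) * indicator ?I t \<partial>lborel) \<le> ennreal (2 * pi * (C - a) + e k)" .
    qed
    also have "\<dots> = ennreal (2 * pi * (C - a))"
    proof (intro lim_imp_Liminf tendsto_ennrealI)
      show "(\<lambda>k. 2 * pi * (C - a) + e k) \<longlonglongrightarrow> 2 * pi * (C - a)"
        using tendsto_add[OF tendsto_const e, of "2 * pi * (C - a)"] by simp
    qed simp
    finally show ?thesis .
  qed
  have Ca: "0 \<le> 2 * pi * (C - a)"
  proof -
    have "2 * pi * a \<le> 2 * pi * C + e k" for k using a[of k] vle[of k] by linarith
    moreover have "(\<lambda>k. 2 * pi * C + e k) \<longlonglongrightarrow> 2 * pi * C"
      using tendsto_add[OF tendsto_const e, of "2 * pi * C"] by simp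
    ultimately have "2 * pi * a \<le> 2 * pi * C" using LIMSEQ_le_const by blast
    then show ?thesis by (simp add: right_diff_distrib)
  qed
  \<comment> \<open>The identity \<open>(C - G) + G\<^sup>+ = C + G\<^sup>-\<close>, which avoids subtracting possibly infinite integrals.\<close>
  have ZP: "Z + P = ennreal (2 * pi * C) + N"
  proof -
    have "Z + P = (\<integral>\<^sup>+t. e2ennreal (ereal C - G t) * indicator ?I t + e2ennreal (G t) * indicator ?I t \<partial>lborel)"
      unfolding Z_def P_def by (rule nn_integral_add[symmetric]) measurable
    also have "\<dots> = (\<integral>\<^sup>+t. ennreal C * indicator ?I t + e2ennreal (- G t) * indicator ?I t \<partial>lborel)"
    proof (intro nn_integral_cong)
      fix t
      have "e2ennreal (ereal C - G t) + e2ennreal (G t) = ennreal C + e2ennreal (- G t)"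
      proof (cases "G t")
        case (real r)
        then have "r \<le> C" using C(2)[of t] by simp
        then show ?thesis
          using real C(1) by (cases "r \<ge> 0") (simp_all add: e2ennreal_ereal ennreal_neg flip: ennreal_plus)
      next
        case PInf then show ?thesis using C(2)[of t] by simp
      next
        case MInf then show ?thesis by (simp add: e2ennreal_neg)
      qed
      then show "e2ennreal (ereal C - G t) * indicator ?I t + e2ennreal (G t) * indicator ?I t
        = ennreal C * indicator ?I t + e2ennreal (- G t) * indicator ?I t"
        by (cases "t \<in> ?I") auto
    qed
    also have "\<dots> = (\<integral>\<^sup>+t\<in>?I. ennreal C \<partial>lborel) + N"
      unfolding N_def by (rule nn_integral_add) measurable
    finally show ?thesis using cI[OF C(1)] by simp
  qed
  have "P \<le> (\<integral>\<^sup>+t\<in>?I. ennreal C \<partial>lborel)"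
    unfolding P_def using e2ennreal_mono[OF C(2)]
    by (intro nn_integral_mono mult_right_mono) (auto simp: e2ennreal_ereal)
  then have P: "P < top" using cI[OF C(1)] ennreal_less_top le_less_trans by metis
  have Z: "Z < top" using Z_le ennreal_less_top le_less_trans by blast
  then have "N < top" using ZP P by (metis ennreal_add_eq_top less_top)
  then obtain p n z where pnz: "P = ennreal p" "N = ennreal n" "Z = ennreal z" "p \<ge> 0" "n \<ge> 0" "z \<ge> 0"
    using P Z by (metis ennreal_cases less_irrefl)
  have "z + p = 2 * pi * C + n"
    using ZP pnz C(1) by (simp flip: ennreal_plus)
  moreover have "z \<le> 2 * pi * (C - a)" using Z_le pnz Ca by simp
  ultimately have "2 * pi * a \<le> p - n" by (simp add: right_diff_distrib)
  then have "a \<le> (p - n) / (2 * pi)" by (simp add: field_simps)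
  then show ?thesis
    using pnz unfolding P_def[symmetric] N_def[symmetric] by (simp add: enn2ereal_ennreal)
qed

section \<open>Potentials in charts\<close>

lemma c2_on_subset: "c2_on S u u1 u2 \<Longrightarrow> V \<subseteq> S \<Longrightarrow> c2_on V u u1 u2"
  unfolding c2_on_def by (meson continuous_on_subset subsetD)

lemma integrable_on_circle:
  fixes f :: "complex^'n::finite \<Rightarrow> real"
  assumes f: "continuous_on V f" and V: "\<And>t. z + cis t *s w \<in> V"
  shows "continuous_on {0..2*pi} (\<lambda>t. f (z + cis t *s w))"
    and "(\<lambda>t. f (z + cis t *s w)) integrable_on {0..2*pi}"
proof -
  show "continuous_on {0..2*pi} (\<lambda>t. f (z + cis t *s w))"
  proof (rule continuous_on_compose2[OF f])
    show "continuous_on {0..2*pi} (\<lambda>t. z + cis t *s w)"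
      by (intro continuous_intros bounded_linear.continuous_on[OF bounded_linear_smult_left])
  qed (use V in auto)
  then show "(\<lambda>t. f (z + cis t *s w)) integrable_on {0..2*pi}"
    by (rule integrable_continuous_real)
qed

context
  fixes A :: "('a::t2_space, 'n::finite) chart set" and \<omega>K \<omega>sr :: "('a, 'n) form"
  assumes X: "compact_complex_manifold A" and \<omega>K: "closed11 A \<omega>K" and \<omega>sr: "closed11 A \<omega>sr"
begin

lemma smooth_potential_c2:
  assumes "smooth_fun_on A UNIV \<psi>" "c \<in> A"
  shows "c2_on (snd c ` fst c) (\<psi> \<circ> cinv c) (\<lambda>b. iter_deriv [b] (\<psi> \<circ> cinv c))
    (\<lambda>b' b. iter_deriv [b', b] (\<psi> \<circ> cinv c))"
  using assms unfolding smooth_fun_on_def by (intro c2_on_smooth) auto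

text \<open>Positivity of the metric bounds the Levi form of its potential from below by the background forms.\<close>

lemma potential_levi_bound:
  assumes \<psi>: "smooth_fun_on A UNIV \<psi>" and pos: "kahler_form A (potential_form A \<omega>K \<omega>sr \<epsilon> \<psi>)"
    and c: "c \<in> A" and x: "x \<in> snd c ` fst c" and v: "v \<noteq> 0"
  shows "levi (\<lambda>b' b. iter_deriv [b', b] (\<psi> \<circ> cinv c)) x v
    \<ge> - 2 * \<omega>sr c (cinv c x) [v, \<i> *s v] - 2 * (\<epsilon> * \<omega>K c (cinv c x) [v, \<i> *s v])"
proof -
  let ?p = "cinv c x"
  have p: "?p \<in> fst c" using x by (rule cinv_mem)
  have xp: "snd c ?p = x" by (rule chart_cinv[OF X c x])
  have "0 < potential_form A \<omega>K \<omega>sr \<epsilon> \<psi> c ?p [v, \<i> *s v]"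
    using pos c p v unfolding kahler_form_def by blast
  also have "\<dots> = \<omega>sr c ?p [v, \<i> *s v] + \<epsilon> * \<omega>K c ?p [v, \<i> *s v]
      + 2 * herm_form (complex_hessian (\<psi> \<circ> cinv c) x) v"
    using idd_levi[OF c p, of \<psi> v] by (simp add: potential_form_def form_lin_def xp)
  also have "4 * herm_form (complex_hessian (\<psi> \<circ> cinv c) x) v
      = levi (\<lambda>b' b. iter_deriv [b', b] (\<psi> \<circ> cinv c)) x v"
    using \<psi> c x unfolding smooth_fun_on_def
    by (intro levi_complex_hessian[OF open_chart_image[OF X c] _ x, symmetric]) auto
  then have "2 * herm_form (complex_hessian (\<psi> \<circ> cinv c) x) v
      = levi (\<lambda>b' b. iter_deriv [b', b] (\<psi> \<circ> cinv c)) x v / 2" by simp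
  finally show ?thesis by simp
qed

text \<open>The Levi form of \<open>\<kappa> \<bar>x - a\<bar>\<^sup>2\<close> is a multiple of the Euclidean metric and, for large \<open>\<kappa>\<close>,
  outweighs the background forms on the ball.  One \<open>\<kappa>\<close> serves all potentials because \<open>\<epsilon> \<le> 1\<close>.\<close>

lemma supermean_in_chart_ball:
  assumes c: "c \<in> A" and B: "cball a R \<subseteq> snd c ` fst c"
  shows "\<exists>\<kappa>\<ge>0. \<forall>\<epsilon> \<psi>. 0 < \<epsilon> \<longrightarrow> \<epsilon> \<le> 1 \<longrightarrow> smooth_fun_on A UNIV \<psi> \<longrightarrow>
      kahler_form A (potential_form A \<omega>K \<omega>sr \<epsilon> \<psi>) \<longrightarrow> (\<forall>p. \<psi> p \<le> 0) \<longrightarrow>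
    supermean (ball a R) (\<lambda>x. \<kappa> * (R\<^sup>2 - (norm (x - a))\<^sup>2) - \<psi> (cinv c x))"
proof -
  have sK: "smooth_form A 2 \<omega>K" and sS: "smooth_form A 2 \<omega>sr"
    using \<omega>K \<omega>sr by (simp_all add: closed11_def)
  obtain C1 where C1: "C1 \<ge> 0" "\<And>x v. x \<in> cball a R \<Longrightarrow> \<omega>sr c (cinv c x) [v, \<i> *s v] \<le> C1 * (norm v)\<^sup>2"
    using form_bound_on_compact[OF sS c compact_cball B] by blast
  obtain C2 where C2: "C2 \<ge> 0" "\<And>x v. x \<in> cball a R \<Longrightarrow> \<omega>K c (cinv c x) [v, \<i> *s v] \<le> C2 * (norm v)\<^sup>2"
    using form_bound_on_compact[OF sK c compact_cball B] by blast
  define \<kappa> where "\<kappa> = C1 + C2"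
  have "supermean (ball a R) (\<lambda>x. \<kappa> * (R\<^sup>2 - (norm (x - a))\<^sup>2) - \<psi> (cinv c x))"
    if \<epsilon>: "0 < \<epsilon>" "\<epsilon> \<le> 1" and \<psi>: "smooth_fun_on A UNIV \<psi>"
      and pos: "kahler_form A (potential_form A \<omega>K \<omega>sr \<epsilon> \<psi>)" and neg: "\<And>p. \<psi> p \<le> 0" for \<psi> \<epsilon>
  proof -
    let ?u1 = "\<lambda>b. iter_deriv [b] (\<psi> \<circ> cinv c)" and ?u2 = "\<lambda>b' b. iter_deriv [b', b] (\<psi> \<circ> cinv c)"
    let ?u = "\<lambda>x. 1 * (\<psi> \<circ> cinv c) x + \<kappa> * ((x - a) \<bullet> (x - a))"
    let ?w2 = "\<lambda>b' b x. 1 * ?u2 b' b x + \<kappa> * (2 * (b' \<bullet> b))"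
    let ?f = "\<lambda>x. \<kappa> * (R\<^sup>2 - (norm (x - a))\<^sup>2) - \<psi> (cinv c x)"
    have sub: "ball a R \<subseteq> snd c ` fst c" using B ball_subset_cball by blast
    have c2: "c2_on (ball a R) ?u (\<lambda>b x. 1 * ?u1 b x + \<kappa> * (2 * ((x - a) \<bullet> b))) ?w2"
      by (intro c2_on_lincomb c2_on_norm2 c2_on_subset[OF smooth_potential_c2[OF \<psi> c] sub])
    have cu: "continuous_on (ball a R) ?u" by (rule c2_on_continuous(1)[OF c2])
    have f_eq: "?f x = \<kappa> * R\<^sup>2 - ?u x" for x
      by (simp add: power2_norm_eq_inner right_diff_distrib)
    have levi: "levi ?w2 x v \<ge> 0" if x: "x \<in> ball a R" for x v
    proof (cases "v = 0")
      case True then show ?thesis by (simp add: levi_def hess_def)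
    next
      case False
      have xc: "x \<in> cball a R" using x by simp
      have K: "\<epsilon> * \<omega>K c (cinv c x) [v, \<i> *s v] \<le> C2 * (norm v)\<^sup>2"
      proof -
        have "\<epsilon> * \<omega>K c (cinv c x) [v, \<i> *s v] \<le> \<epsilon> * (C2 * (norm v)\<^sup>2)"
          using C2(2)[OF xc] \<epsilon> by (intro mult_left_mono) auto
        also have "\<dots> \<le> 1 * (C2 * (norm v)\<^sup>2)"
          using C2(1) \<epsilon> by (intro mult_right_mono) auto
        finally show ?thesis by simp
      qed
      have "levi ?u2 x v \<ge> - 2 * \<omega>sr c (cinv c x) [v, \<i> *s v] - 2 * (\<epsilon> * \<omega>K c (cinv c x) [v, \<i> *s v])"
        using x sub by (intro potential_levi_bound[OF \<psi> pos c _ False]) auto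
      moreover have "\<kappa> * (4 * (norm v)\<^sup>2) = 4 * (C1 * (norm v)\<^sup>2) + 4 * (C2 * (norm v)\<^sup>2)"
        by (simp add: \<kappa>_def algebra_simps)
      moreover have "0 \<le> C1 * (norm v)\<^sup>2" "0 \<le> C2 * (norm v)\<^sup>2" using C1(1) C2(1) by simp_all
      ultimately have "0 \<le> levi ?u2 x v + \<kappa> * (4 * (norm v)\<^sup>2)"
        using C1(2)[OF xc, of v] K by linarith
      then show ?thesis unfolding levi_lincomb levi_norm2 by (simp only: mult_1)
    qed
    show ?thesis
      unfolding supermean_def
    proof (intro conjI ballI allI impI)
      show "continuous_on (ball a R) ?f"
        unfolding f_eq by (intro continuous_intros cu)
      show "0 \<le> ?f x" if "x \<in> ball a R" for x
      proof -
        have "(norm (x - a))\<^sup>2 \<le> R\<^sup>2"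
          using that by (intro power_mono) (auto simp: dist_norm norm_minus_commute)
        then have "0 \<le> \<kappa> * (R\<^sup>2 - (norm (x - a))\<^sup>2)" using C1(1) C2(1) by (simp add: \<kappa>_def)
        then show ?thesis using neg[of "cinv c x"] by linarith
      qed
      fix x w assume disc: "\<forall>\<zeta>. norm \<zeta> \<le> 1 \<longrightarrow> x + \<zeta> *s w \<in> ball a R"
      then have circ: "x + cis t *s w \<in> ball a R" for t by simp
      have "2 * pi * ?u x \<le> integral {0..2*pi} (\<lambda>t. ?u (x + cis t *s w))"
        using disc levi by (intro circle_mean_inequality[OF c2]) auto
      moreover have "integral {0..2*pi} (\<lambda>t. ?f (x + cis t *s w))
          = integral {0..2*pi} (\<lambda>t. \<kappa> * R\<^sup>2) - integral {0..2*pi} (\<lambda>t. ?u (x + cis t *s w))"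
        unfolding f_eq using circ by (intro integral_diff integrable_on_circle[OF cu]) auto
      ultimately show "integral {0..2*pi} (\<lambda>t. ?f (x + cis t *s w)) \<le> 2 * pi * ?f x"
        unfolding f_eq by (simp add: right_diff_distrib)
    qed
  qed
  moreover have "\<kappa> \<ge> 0" using C1 C2 by (simp add: \<kappa>_def)
  ultimately show ?thesis by (intro exI[of _ \<kappa>] conjI allI impI) auto
qed

text \<open>If \<open>\<rho>\<close> is a local potential of \<open>\<omega>sr\<close>, then \<open>\<psi> + \<rho>\<close> is plurisubharmonic up to the form
  \<open>\<epsilon> \<omega>K\<close>.  Adding \<open>\<epsilon> C \<bar>z\<bar>\<^sup>2\<close> compensates for it, at the price of an error that vanishes with
  \<open>\<epsilon>\<close>, uniformly in the potential and in the disc.\<close>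

lemma local_potential_circle_inequality:
  assumes c: "c \<in> A" and V: "open V" "V \<subseteq> snd c ` fst c" and \<rho>: "smooth_on V \<rho>"
    and hess: "\<And>z. z \<in> V \<Longrightarrow> complex_hessian \<rho> z = coeffs \<omega>sr c (cinv c z)"
    and K: "compact K" "K \<subseteq> V"
  shows "\<exists>S. \<forall>\<psi> \<epsilon> z w. 0 < \<epsilon> \<longrightarrow> smooth_fun_on A UNIV \<psi> \<longrightarrow>
      kahler_form A (potential_form A \<omega>K \<omega>sr \<epsilon> \<psi>) \<longrightarrow> (\<forall>\<zeta>. norm \<zeta> \<le> 1 \<longrightarrow> z + \<zeta> *s w \<in> K) \<longrightarrow>
    2 * pi * (\<psi> (cinv c z) + \<rho> z)
      \<le> integral {0..2*pi} (\<lambda>t. \<psi> (cinv c (z + cis t *s w)) + \<rho> (z + cis t *s w)) + \<epsilon> * S"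
proof -
  have sK: "smooth_form A 2 \<omega>K" and sS: "smooth_form A 2 \<omega>sr" and rot: "rotation_invariant \<omega>sr"
    using \<omega>K \<omega>sr by (simp_all add: closed11_def)
  have KW: "K \<subseteq> snd c ` fst c" using K V by blast
  obtain C where C: "C \<ge> 0" "\<And>x v. x \<in> K \<Longrightarrow> \<omega>K c (cinv c x) [v, \<i> *s v] \<le> C * (norm v)\<^sup>2"
    using form_bound_on_compact[OF sK c K(1) KW] by blast
  obtain r where r: "r > 0" "\<And>x. x \<in> K \<Longrightarrow> norm x \<le> r"
    using compact_imp_bounded[OF K(1)] bounded_pos by blast
  define S where "S = 2 * pi * (C * r\<^sup>2)"
  have "2 * pi * (\<psi> (cinv c z) + \<rho> z)
      \<le> integral {0..2*pi} (\<lambda>t. \<psi> (cinv c (z + cis t *s w)) + \<rho> (z + cis t *s w)) + \<epsilon> * S"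
    if \<epsilon>: "0 < \<epsilon>" and \<psi>: "smooth_fun_on A UNIV \<psi>"
      and pos: "kahler_form A (potential_form A \<omega>K \<omega>sr \<epsilon> \<psi>)"
      and disc: "\<And>\<zeta>. norm \<zeta> \<le> 1 \<Longrightarrow> z + \<zeta> *s w \<in> K" for \<psi> \<epsilon> z w
  proof -
    let ?u1 = "\<lambda>b. iter_deriv [b] (\<psi> \<circ> cinv c)" and ?u2 = "\<lambda>b' b. iter_deriv [b', b] (\<psi> \<circ> cinv c)"
    let ?r1 = "\<lambda>b. iter_deriv [b] \<rho>" and ?r2 = "\<lambda>b' b. iter_deriv [b', b] \<rho>"
    let ?g = "\<lambda>x. 1 * (\<psi> \<circ> cinv c) x + 1 * \<rho> x"
    let ?q = "\<lambda>x::complex^'n. (x - 0) \<bullet> (x - 0)"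
    let ?u = "\<lambda>x. 1 * ?g x + (\<epsilon> * C) * ?q x"
    let ?w2 = "\<lambda>b' b x. 1 * (1 * ?u2 b' b x + 1 * ?r2 b' b x) + (\<epsilon> * C) * (2 * (b' \<bullet> b))"
    have cg2: "c2_on V ?g (\<lambda>b x. 1 * ?u1 b x + 1 * ?r1 b x) (\<lambda>b' b x. 1 * ?u2 b' b x + 1 * ?r2 b' b x)"
      by (intro c2_on_lincomb c2_on_smooth[OF \<rho>] c2_on_subset[OF smooth_potential_c2[OF \<psi> c] V(2)])
    have cq2: "c2_on V ?q (\<lambda>b x. 2 * ((x - 0) \<bullet> b)) (\<lambda>b' b x. 2 * (b' \<bullet> b))" by (rule c2_on_norm2)
    note c2 = c2_on_lincomb[OF cg2 cq2, of 1 "\<epsilon> * C"]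
    have cg: "continuous_on V ?g" and cq: "continuous_on V ?q"
      by (rule c2_on_continuous(1)[OF cg2] c2_on_continuous(1)[OF cq2])+
    have levi: "levi ?w2 x v \<ge> 0" if x: "x \<in> K" for x v
    proof (cases "v = 0")
      case True then show ?thesis by (simp add: levi_def hess_def)
    next
      case False
      have xV: "x \<in> V" and xW: "x \<in> snd c ` fst c" using x K V by auto
      have "levi ?r2 x v = 4 * herm_form (coeffs \<omega>sr c (cinv c x)) v"
        using levi_complex_hessian[OF V(1) \<rho> xV] hess[OF xV] by simp
      also have "\<dots> = 2 * \<omega>sr c (cinv c x) [v, \<i> *s v]"
        using form_coeffs[OF smooth_form_alternating[OF sS c cinv_mem[OF xW]] rot] by simp
      finally have r2: "levi ?r2 x v = 2 * \<omega>sr c (cinv c x) [v, \<i> *s v]" .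
      have "levi ?u2 x v \<ge> - 2 * \<omega>sr c (cinv c x) [v, \<i> *s v] - 2 * (\<epsilon> * \<omega>K c (cinv c x) [v, \<i> *s v])"
        by (rule potential_levi_bound[OF \<psi> pos c xW False])
      moreover have "\<epsilon> * \<omega>K c (cinv c x) [v, \<i> *s v] \<le> \<epsilon> * (C * (norm v)\<^sup>2)"
        using C(2)[OF x] \<epsilon> by (intro mult_left_mono) auto
      moreover have "0 \<le> \<epsilon> * (C * (norm v)\<^sup>2)" using C(1) \<epsilon> by simp
      moreover have "(\<epsilon> * C) * (4 * (norm v)\<^sup>2) = 4 * (\<epsilon> * (C * (norm v)\<^sup>2))" by simp
      ultimately have "0 \<le> levi ?u2 x v + levi ?r2 x v + (\<epsilon> * C) * (4 * (norm v)\<^sup>2)"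
        using r2 by linarith
      then show ?thesis unfolding levi_lincomb levi_norm2 by (simp only: mult_1)
    qed
    have circ: "z + cis t *s w \<in> V" "z + cis t *s w \<in> K" for t
      using disc[of "cis t"] K by auto
    have zK: "z \<in> K" using disc[of 0] by simp
    have ig: "(\<lambda>t. ?g (z + cis t *s w)) integrable_on {0..2*pi}"
      and iq: "(\<lambda>t. ?q (z + cis t *s w)) integrable_on {0..2*pi}"
      using circ by (intro integrable_on_circle[OF cg] integrable_on_circle[OF cq]; blast)+
    have "2 * pi * ?u z \<le> integral {0..2*pi} (\<lambda>t. ?u (z + cis t *s w))"
      using disc K levi by (intro circle_mean_inequality[OF c2]) auto
    also have "\<dots> = integral {0..2*pi} (\<lambda>t. ?g (z + cis t *s w))
        + \<epsilon> * C * integral {0..2*pi} (\<lambda>t. ?q (z + cis t *s w))"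
      using ig iq by (subst integral_add) (auto intro!: integrable_on_mult_right)
    also have "\<dots> \<le> integral {0..2*pi} (\<lambda>t. ?g (z + cis t *s w)) + \<epsilon> * C * (2 * pi * r\<^sup>2)"
    proof (intro add_left_mono mult_left_mono)
      have "integral {0..2*pi} (\<lambda>t. ?q (z + cis t *s w)) \<le> integral {0..2*pi} (\<lambda>t. r\<^sup>2)"
      proof (rule integral_le[OF iq])
        show "?q (z + cis t *s w) \<le> r\<^sup>2" for t
          using power_mono[OF r(2)[OF circ(2)[of t]], of 2] by (simp add: power2_norm_eq_inner)
      qed auto
      then show "integral {0..2*pi} (\<lambda>t. ?q (z + cis t *s w)) \<le> 2 * pi * r\<^sup>2" by simp
    qed (use \<epsilon> C in auto)
    finally have "2 * pi * ?u z \<le> integral {0..2*pi} (\<lambda>t. ?g (z + cis t *s w)) + \<epsilon> * S"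
      by (simp add: S_def mult_ac)
    moreover have "2 * pi * ?g z \<le> 2 * pi * ?u z"
      using \<epsilon> C(1) by simp
    ultimately have "2 * pi * ?g z \<le> integral {0..2*pi} (\<lambda>t. ?g (z + cis t *s w)) + \<epsilon> * S"
      by linarith
    then show ?thesis by simp
  qed
  then show ?thesis by (intro exI[of _ S] allI impI) blast
qed

text \<open>Choose points \<open>q k \<rightarrow> z\<close> and indices \<open>i k\<close> at which \<open>\<psi> (i k)\<close> almost attains the upper limit at
  \<open>z\<close>.  The submean inequality on the translated circles around \<open>q k\<close> passes to the limit: on the left by
  this choice, on the right by the reverse Fatou lemma, as values along \<open>q k + cis t *s w\<close> are
  controlled by the upper limit at \<open>z + cis t *s w\<close>.\<close>

lemma upper_limit_PSH:
  fixes \<psi> :: "nat \<Rightarrow> 'a \<Rightarrow> real" and \<epsilon> :: "nat \<Rightarrow> real"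
  assumes \<epsilon>: "\<And>i. 0 < \<epsilon> i" "\<epsilon> \<longlonglongrightarrow> 0" and \<psi>: "\<And>i. smooth_fun_on A UNIV (\<psi> i)"
    and pos: "\<And>i. kahler_form A (potential_form A \<omega>K \<omega>sr (\<epsilon> i) (\<psi> i))"
    and neg: "\<And>i p. \<psi> i p \<le> 0" and ne: "\<exists>p. upper_limit \<psi> p \<noteq> - \<infinity>"
  shows "upper_limit \<psi> \<in> PSH A \<omega>sr"
  unfolding PSH_def mem_Collect_eq
proof (intro conjI ballI allI impI ne)
  fix c V \<rho>
  assume c: "c \<in> A" and H: "open V \<and> V \<subseteq> snd c ` fst c \<and> smooth_on V \<rho> \<and>
    (\<forall>z\<in>V. complex_hessian \<rho> z = coeffs \<omega>sr c (cinv c z))"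
  have V: "open V" "V \<subseteq> snd c ` fst c" and \<rho>: "smooth_on V \<rho>"
    by (rule conjunct1[OF H] conjunct1[OF conjunct2[OF H]]
        conjunct1[OF conjunct2[OF conjunct2[OF H]]])+
  have hess: "complex_hessian \<rho> z = coeffs \<omega>sr c (cinv c z)" if "z \<in> V" for z
    by (rule bspec[OF conjunct2[OF conjunct2[OF conjunct2[OF H]]] that])
  have c\<rho>: "continuous_on V \<rho>" using \<rho> by (rule smooth_on_continuous)
  let ?U = "upper_limit \<psi>"
  define u where "u = (\<lambda>z. ereal (\<rho> z) + ?U (cinv c z))"
  have U0: "?U p \<le> 0" for p
  proof (rule upper_limit_le[of UNIV])
    show "\<forall>\<^sub>F i in sequentially. \<forall>q\<in>UNIV. ereal (\<psi> i q) \<le> 0"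
      by (intro always_eventually allI ballI) (simp add: neg)
  qed auto
  have near: "\<exists>N. open N \<and> z \<in> N \<and> N \<subseteq> V \<and> (\<forall>x\<in>N. \<rho> x + b < a) \<and> (\<forall>x\<in>N. ?U (cinv c x) < ereal b)
      \<and> (\<forall>\<^sub>F i in sequentially. \<forall>x\<in>N. \<psi> i (cinv c x) < b)"
    if z: "z \<in> V" and b: "?U (cinv c z) < ereal b" "\<rho> z + b < a" for z a b
  proof -
    obtain N where N: "open N" "cinv c z \<in> N" "\<forall>\<^sub>F i in sequentially. \<forall>q\<in>N. ereal (\<psi> i q) < ereal b"
      "\<And>q. q \<in> N \<Longrightarrow> ?U q < ereal b"
      using upper_limit_less[OF b(1)] by blast
    have "open (V \<inter> cinv c -` N)"
      using continuous_open_preimage[OF continuous_on_subset[OF continuous_cinv[OF X c] V(2)] V(1) N(1)] .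
    moreover have "open (V \<inter> \<rho> -` {..<a - b})"
      by (rule continuous_open_preimage[OF c\<rho> V(1)]) simp
    ultimately have "open ((V \<inter> cinv c -` N) \<inter> (V \<inter> \<rho> -` {..<a - b}))" by (rule open_Int)
    moreover have "\<forall>\<^sub>F i in sequentially. \<forall>x\<in>(V \<inter> cinv c -` N) \<inter> (V \<inter> \<rho> -` {..<a - b}). \<psi> i (cinv c x) < b"
      using N(3) by eventually_elim auto
    ultimately show ?thesis
      using z b N by (intro exI[of _ "(V \<inter> cinv c -` N) \<inter> (V \<inter> \<rho> -` {..<a - b})"]) auto
  qed
  have split: "\<exists>b. ?U (cinv c z) < ereal b \<and> \<rho> z + b < a" if "u z < ereal a" for z a
  proof -
    have "?U (cinv c z) < ereal (a - \<rho> z)"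
      using that unfolding u_def by (cases "?U (cinv c z)") auto
    then obtain b where "?U (cinv c z) < ereal b" "ereal b < ereal (a - \<rho> z)"
      using ereal_dense2 by blast
    then show ?thesis by (intro exI[of _ b]) auto
  qed
  have fin: "u z < \<infinity>" for z
    using U0[of "cinv c z"] by (cases "?U (cinv c z)") (auto simp: u_def)
  have open_real: "open {z\<in>V. u z < ereal a}" for a
  proof (subst open_subopen, intro ballI)
    fix z assume "z \<in> {z\<in>V. u z < ereal a}"
    then have z: "z \<in> V" "u z < ereal a" by auto
    obtain b where b: "?U (cinv c z) < ereal b" "\<rho> z + b < a" using split[OF z(2)] by blast
    obtain N where N: "open N" "z \<in> N" "N \<subseteq> V" "\<forall>x\<in>N. \<rho> x + b < a" "\<forall>x\<in>N. ?U (cinv c x) < ereal b"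
      using near[OF z(1) b] by blast
    have "u x < ereal a" if "x \<in> N" for x
    proof -
      have "\<rho> x + b < a" "?U (cinv c x) < ereal b" using N that by auto
      then show ?thesis unfolding u_def by (cases "?U (cinv c x)") auto
    qed
    then show "\<exists>T. open T \<and> z \<in> T \<and> T \<subseteq> {z\<in>V. u z < ereal a}"
      using N by (intro exI[of _ N]) auto
  qed
  have open_u: "open {z\<in>V. u z < a}" for a
  proof (cases a)
    case (real r) then show ?thesis using open_real by simp
  next
    case PInf
    then have "{z\<in>V. u z < a} = V" using fin by auto
    then show ?thesis using V by simp
  next
    case MInf then show ?thesis by simp
  qed
  have sub: "u z \<le> circle_mean u z w" if disc: "\<forall>\<zeta>. norm \<zeta> \<le> 1 \<longrightarrow> z + \<zeta> *s w \<in> V" for z w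
  proof (cases "u z = - \<infinity>")
    case True then show ?thesis by simp
  next
    case False
    then obtain U' where U': "?U (cinv c z) = ereal U'"
      using U0[of "cinv c z"] by (cases "?U (cinv c z)") (auto simp: u_def)
    have zV: "z \<in> V" using disc[rule_format, of 0] by simp
    let ?D = "(\<lambda>\<zeta>. z + \<zeta> *s w) ` cball 0 1"
    have "compact ?D"
      by (intro compact_continuous_image continuous_intros
          bounded_linear.continuous_on[OF bounded_linear_smult_left]) auto
    moreover have "?D \<subseteq> V" using disc by auto
    ultimately obtain d where d: "d > 0" "(\<Union>x\<in>?D. cball x d) \<subseteq> V"
      using compact_subset_open_imp_cball_epsilon_subset[of ?D V] V(1) by blast
    \<comment> \<open>A compact neighbourhood of the disc that contains all its small translates.\<close>
    define K where "K = (\<Union>x\<in>?D. cball x d)"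
    have K: "compact K" "K \<subseteq> V"
      unfolding K_def by (rule compact_minkowski_sum_cball[OF \<open>compact ?D\<close>], rule d(2))
    obtain S where S1: "\<forall>\<psi> \<epsilon> z w. 0 < \<epsilon> \<longrightarrow> smooth_fun_on A UNIV \<psi> \<longrightarrow>
      kahler_form A (potential_form A \<omega>K \<omega>sr \<epsilon> \<psi>) \<longrightarrow> (\<forall>\<zeta>. norm \<zeta> \<le> 1 \<longrightarrow> z + \<zeta> *s w \<in> K) \<longrightarrow>
    2 * pi * (\<psi> (cinv c z) + \<rho> z)
      \<le> integral {0..2*pi} (\<lambda>t. \<psi> (cinv c (z + cis t *s w)) + \<rho> (z + cis t *s w)) + \<epsilon> * S"
      using local_potential_circle_inequality[OF c V \<rho> hess K] ..
    have S: "2 * pi * (\<psi> i (cinv c q) + \<rho> q)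
        \<le> integral {0..2*pi} (\<lambda>t. \<psi> i (cinv c (q + cis t *s w)) + \<rho> (q + cis t *s w)) + \<epsilon> i * S"
      if "\<And>\<zeta>. norm \<zeta> \<le> 1 \<Longrightarrow> q + \<zeta> *s w \<in> K" for i q
      by (rule S1[rule_format, OF \<epsilon>(1) \<psi> pos]) (rule that)
    have "bounded (\<rho> ` K)"
      using compact_continuous_image[OF continuous_on_subset[OF c\<rho> K(2)] K(1)] compact_imp_bounded by blast
    then obtain C where C: "C > 0" "\<And>x. x \<in> K \<Longrightarrow> \<bar>\<rho> x\<bar> \<le> C"
      unfolding bounded_pos by auto
    define e where "e = (\<lambda>k::nat. min d (1 / (real k + 1)))"
    have e0: "e k > 0" for k using d by (simp add: e_def)
    have "\<exists>i q. i \<ge> k \<and> dist z q < e k \<and> U' - 1 / (real k + 1) < \<psi> i (cinv c q)" for k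
    proof -
      let ?N = "{p \<in> fst c. snd c p \<in> ball z (e k)}"
      have "open ?N" by (rule open_chart_vimage[OF X c open_ball])
      moreover have "cinv c z \<in> ?N"
        using zV V e0[of k] by (auto simp: cinv_mem chart_cinv[OF X c])
      moreover have "ereal (U' - 1 / (real k + 1)) < ?U (cinv c z)" by (simp add: U')
      ultimately obtain i p where "i \<ge> k" "p \<in> ?N" "U' - 1 / (real k + 1) < \<psi> i p"
        by (rule upper_limit_approach)
      then show ?thesis
        by (intro exI[of _ i] exI[of _ "snd c p"]) (auto simp: cinv_chart[OF X c])
    qed
    then obtain i q where iq: "\<And>k. i k \<ge> k" "\<And>k. dist z (q k) < e k"
        "\<And>k. U' - 1 / (real k + 1) < \<psi> (i k) (cinv c (q k))"
      by metis
    have qz: "q \<longlonglongrightarrow> z"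
    proof (rule metric_LIMSEQ_I)
      fix r :: real assume "r > 0"
      then obtain n :: nat where n: "1 / (real n + 1) < r"
        using reals_Archimedean[of r] by (auto simp: inverse_eq_divide add.commute)
      have "dist (q k) z < r" if "k \<ge> n" for k
      proof -
        have "1 / (real k + 1) \<le> 1 / (real n + 1)" using that by (intro divide_left_mono) auto
        then show ?thesis using iq(2)[of k] n by (simp add: e_def dist_commute)
      qed
      then show "\<exists>n. \<forall>k\<ge>n. dist (q k) z < r" by blast
    qed
    have qK: "q k + \<zeta> *s w \<in> K" if "norm \<zeta> \<le> 1" for k \<zeta>
    proof -
      have "dist (z + \<zeta> *s w) (q k + \<zeta> *s w) \<le> d"
        using iq(2)[of k] by (simp add: e_def dist_norm)
      then have "q k + \<zeta> *s w \<in> cball (z + \<zeta> *s w) d" by (simp only: mem_cball)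
      moreover have "z + \<zeta> *s w \<in> ?D" using that by auto
      ultimately show ?thesis unfolding K_def by blast
    qed
    define v where "v = (\<lambda>k t. \<psi> (i k) (cinv c (q k + cis t *s w)) + \<rho> (q k + cis t *s w))"
    have seqi: "filterlim i at_top sequentially"
      by (rule filterlim_at_top_mono[OF filterlim_ident]) (simp add: iq(1))
    have circV: "z + cis t *s w \<in> V" for t using disc by simp
    have circK: "z + cis t *s w \<in> K" for t
    proof -
      have "z + cis t *s w \<in> ?D" by (rule image_eqI[of _ _ "cis t"]) auto
      moreover have "z + cis t *s w \<in> cball (z + cis t *s w) d" using d by simp
      ultimately show ?thesis unfolding K_def by blast
    qed
    have cont_circ: "continuous_on UNIV (\<lambda>t. z + cis t *s w)"
      by (intro continuous_intros bounded_linear.continuous_on[OF bounded_linear_smult_left])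
    have "ereal (U' + \<rho> z) \<le> (enn2ereal (\<integral>\<^sup>+t\<in>{0..2*pi}. e2ennreal (u (z + cis t *s w)) \<partial>lborel)
      - enn2ereal (\<integral>\<^sup>+t\<in>{0..2*pi}. e2ennreal (- u (z + cis t *s w)) \<partial>lborel)) / ereal (2 * pi)"
    proof (rule reverse_fatou_circle[where C = C and v = v])
      show "(\<lambda>t. u (z + cis t *s w)) \<in> borel_measurable borel"
      proof (rule borel_measurableI_less)
        fix y
        have "open ((\<lambda>t. z + cis t *s w) -` {z\<in>V. u z < y})"
          by (rule open_vimage[OF open_u cont_circ])
        also have "(\<lambda>t. z + cis t *s w) -` {z\<in>V. u z < y} = {t \<in> space borel. u (z + cis t *s w) < y}"
          using circV by auto
        finally show "{t \<in> space borel. u (z + cis t *s w) < y} \<in> sets borel" by simp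
      qed
      show "C \<ge> 0" using C by simp
      show "u (z + cis t *s w) \<le> ereal C" for t
        using U0[of "cinv c (z + cis t *s w)"] C(2)[OF circK[of t]] unfolding u_def
        by (cases "?U (cinv c (z + cis t *s w))") auto
      show "continuous_on {0..2*pi} (v k)" for k
      proof -
        have "continuous_on V (\<lambda>x. \<psi> (i k) (cinv c x) + \<rho> x)"
          using c2_on_continuous(1)[OF c2_on_subset[OF smooth_potential_c2[OF \<psi> c] V(2)]]
          by (intro continuous_intros c\<rho>) (simp add: o_def)
        from integrable_on_circle(1)[OF this, of "q k" w] show ?thesis
          unfolding v_def using qK[of "cis t" k for t] K by auto
      qed
      show "v k t \<le> C" for k t
        using neg[of "i k" "cinv c (q k + cis t *s w)"] C(2)[OF qK[of "cis t" k]]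
        by (simp add: v_def)
      show "limsup (\<lambda>k. ereal (v k t)) \<le> u (z + cis t *s w)" for t
      proof (rule ccontr)
        assume "\<not> limsup (\<lambda>k. ereal (v k t)) \<le> u (z + cis t *s w)"
        then obtain a where a: "u (z + cis t *s w) < ereal a" "ereal a < limsup (\<lambda>k. ereal (v k t))"
          by (metis ereal_dense2 not_le_imp_less)
        obtain b where b: "?U (cinv c (z + cis t *s w)) < ereal b" "\<rho> (z + cis t *s w) + b < a"
          using split[OF a(1)] by blast
        obtain N where N: "open N" "z + cis t *s w \<in> N" "\<forall>x\<in>N. \<rho> x + b < a"
          "\<forall>\<^sub>F i in sequentially. \<forall>x\<in>N. \<psi> i (cinv c x) < b"
          using near[OF circV b] by blast
        have "(\<lambda>k. q k + cis t *s w) \<longlonglongrightarrow> z + cis t *s w"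
          by (intro tendsto_intros qz)
        then have "\<forall>\<^sub>F k in sequentially. q k + cis t *s w \<in> N"
          using N(1,2) by (rule topological_tendstoD)
        moreover have "\<forall>\<^sub>F k in sequentially. \<forall>x\<in>N. \<psi> (i k) (cinv c x) < b"
          using eventually_compose_filterlim[OF N(4) seqi] .
        ultimately have "\<forall>\<^sub>F k in sequentially. ereal (v k t) \<le> ereal a"
        proof eventually_elim
          case (elim k)
          then have "\<psi> (i k) (cinv c (q k + cis t *s w)) < b" "\<rho> (q k + cis t *s w) + b < a"
            using N(3) by auto
          then show ?case by (simp add: v_def)
        qed
        then have "limsup (\<lambda>k. ereal (v k t)) \<le> ereal a" by (rule Limsup_bounded)
        with a(2) show False by simp
      qed
      show "2 * pi * (U' + \<rho> z) \<le> integral {0..2*pi} (v k)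
        + (\<epsilon> (i k) * S + 2 * pi * (1 / (real k + 1)) + 2 * pi * (\<rho> z - \<rho> (q k)))" for k
      proof -
        have "2 * pi * (\<psi> (i k) (cinv c (q k)) + \<rho> (q k)) \<le> integral {0..2*pi} (v k) + \<epsilon> (i k) * S"
          unfolding v_def by (rule S) (rule qK)
        moreover have "2 * pi * (U' - 1 / (real k + 1)) \<le> 2 * pi * \<psi> (i k) (cinv c (q k))"
          using iq(3)[of k] by (intro mult_left_mono) auto
        ultimately show ?thesis by (simp only: distrib_left right_diff_distrib)
      qed
      have "(\<lambda>k. \<epsilon> (i k)) \<longlonglongrightarrow> 0" by (rule filterlim_compose[OF \<epsilon>(2) seqi])
      moreover have "(\<lambda>k. \<rho> (q k)) \<longlonglongrightarrow> \<rho> z"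
        using c\<rho> zV V(1) qz by (metis continuous_on_eq_continuous_at isCont_tendsto_compose)
      moreover have "(\<lambda>k. 1 / (real k + 1)) \<longlonglongrightarrow> 0"
        using LIMSEQ_inverse_real_of_nat by (simp add: inverse_eq_divide add.commute)
      ultimately have "(\<lambda>k. \<epsilon> (i k) * S + 2 * pi * (1 / (real k + 1)) + 2 * pi * (\<rho> z - \<rho> (q k)))
        \<longlonglongrightarrow> 0 * S + 2 * pi * 0 + 2 * pi * (\<rho> z - \<rho> z)"
        by (intro tendsto_intros)
      then show "(\<lambda>k. \<epsilon> (i k) * S + 2 * pi * (1 / (real k + 1)) + 2 * pi * (\<rho> z - \<rho> (q k))) \<longlonglongrightarrow> 0"
        by simp
    qed
    then show ?thesis
      by (simp add: circle_mean_def u_def U' add.commute)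
  qed
  show "psh_on V (\<lambda>z. ereal (\<rho> z) + ?U (cinv c z))"
    unfolding psh_on_def using fin open_u sub unfolding u_def by blast
qed

end

section \<open>Integral bounds for normalised potentials\<close>

lemma supermean_subset: "supermean B f \<Longrightarrow> B' \<subseteq> B \<Longrightarrow> supermean B' f"
  unfolding supermean_def by (meson continuous_on_subset subsetD)

text \<open>The negative of \<open>\<psi> + \<kappa> \<bar>x - a\<bar>\<^sup>2\<close>, shifted so that it is nonnegative on the ball of radius \<open>R\<close>
  whenever \<open>\<psi> \<le> 0\<close>.\<close>

definition chart_fun :: "('a, 'n::finite) chart \<Rightarrow> complex^'n \<Rightarrow> real \<Rightarrow> real \<Rightarrow> ('a \<Rightarrow> real)
    \<Rightarrow> complex^'n \<Rightarrow> real" where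
  "chart_fun c a R \<kappa> \<psi> x = \<kappa> * (R\<^sup>2 - (norm (x - a))\<^sup>2) - \<psi> (cinv c x)"

text \<open>Chebyshev's inequality: a function with large values on the whole ball has a large integral.  The
  bound \<open>L\<close> is the same for all functions with the same integral bound.\<close>

lemma supermean_lower_value:
  fixes y :: "complex^'n::finite"
  assumes s: "s > 0" and sub: "ball y s \<subseteq> B" and C: "C \<ge> 0"
  obtains L where "\<And>f. (\<integral>\<^sup>+x\<in>B. ennreal (f x) \<partial>lborel) \<le> ennreal C \<Longrightarrow> \<exists>x\<in>ball y s. f x \<le> L"
proof -
  define v where "v = Sigma_Algebra.measure lborel (ball y s)"
  have v: "v > 0" unfolding v_def using s by (rule content_ball_pos)
  have ev: "emeasure lborel (ball y s) = ennreal v"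
    unfolding v_def using emeasure_lborel_ball_finite[of y s]
    by (intro emeasure_eq_ennreal_measure) (simp add: less_top)
  have "\<exists>x\<in>ball y s. f x \<le> (C + 1) / v"
    if f: "(\<integral>\<^sup>+x\<in>B. ennreal (f x) \<partial>lborel) \<le> ennreal C" for f :: "complex^'n \<Rightarrow> real"
  proof (rule ccontr)
    assume "\<not> ?thesis"
    then have big: "f x \<ge> (C + 1) / v" if "x \<in> ball y s" for x using that by force
    have "ennreal (C + 1) = ennreal ((C + 1) / v) * emeasure lborel (ball y s)"
      unfolding ev using v C by (simp flip: ennreal_mult)
    also have "\<dots> = (\<integral>\<^sup>+x. ennreal ((C + 1) / v) * indicator (ball y s) x \<partial>lborel)"
      by (subst nn_integral_cmult_indicator) auto
    also have "\<dots> \<le> (\<integral>\<^sup>+x\<in>B. ennreal (f x) \<partial>lborel)"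
    proof (intro nn_integral_mono)
      fix x
      show "ennreal ((C + 1) / v) * indicator (ball y s) x \<le> ennreal (f x) * indicator B x"
      proof (cases "x \<in> ball y s")
        case True
        then have "x \<in> B" using sub by blast
        then show ?thesis using True big[OF True] by (simp add: ennreal_leI)
      qed simp
    qed
    also have "\<dots> \<le> ennreal C" by (rule f)
    finally have "C + 1 \<le> C" using C by (simp add: ennreal_le_iff)
    then show False by simp
  qed
  then show ?thesis by (rule that)
qed

definition normalized_potentials :: "('a, 'n::finite) chart set \<Rightarrow> ('a, 'n) form \<Rightarrow> ('a, 'n) form
    \<Rightarrow> (nat \<Rightarrow> real) \<Rightarrow> (nat \<Rightarrow> 'a \<Rightarrow> real) \<Rightarrow> bool" where
  "normalized_potentials A \<omega>K \<omega>sr \<epsilon> \<psi> \<longleftrightarrow> (\<forall>i. 0 < \<epsilon> i \<and> \<epsilon> i \<le> 1 \<and> smooth_fun_on A UNIV (\<psi> i) \<and>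
     kahler_form A (potential_form A \<omega>K \<omega>sr (\<epsilon> i) (\<psi> i)) \<and> (\<forall>p. \<psi> i p \<le> 0))"

definition good_chart_ball :: "('a, 'n::finite) chart set \<Rightarrow> (nat \<Rightarrow> 'a \<Rightarrow> real) \<Rightarrow> ('a, 'n) chart
    \<Rightarrow> complex^'n \<Rightarrow> real \<Rightarrow> real \<Rightarrow> bool" where
  "good_chart_ball A \<psi> c a R \<kappa> \<longleftrightarrow> c \<in> A \<and> 0 < R \<and> 0 \<le> \<kappa> \<and> cball a R \<subseteq> snd c ` fst c \<and>
     (\<forall>i. supermean (ball a R) (chart_fun c a R \<kappa> (\<psi> i)))"

context
  fixes A :: "('a::t2_space, 'n::finite) chart set"
  assumes X: "compact_complex_manifold A"
begin

text \<open>Sequential compactness, which for a general topological space does not follow from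
  compactness; here a chart ball containing infinitely many points reduces it to the Euclidean case.\<close>

lemma compact_cluster_subsequence:
  fixes pt :: "nat \<Rightarrow> 'a"
  obtains r p where "strict_mono r"
    "\<And>N. open N \<Longrightarrow> p \<in> N \<Longrightarrow> \<forall>\<^sub>F i in sequentially. pt (r i) \<in> N"
proof -
  have "\<exists>c R. p \<in> fst c \<and> c \<in> A \<and> R > 0 \<and> cball (snd c p) R \<subseteq> snd c ` fst c" for p
  proof -
    obtain c where c: "c \<in> A" "p \<in> fst c" using charts_cover[OF X] by blast
    then show ?thesis
      using open_chart_image[OF X c(1)] open_contains_cball by (metis imageI)
  qed
  then obtain c R where cR: "\<And>p. p \<in> fst (c p)" "\<And>p. c p \<in> A" "\<And>p. R p > (0::real)"
      "\<And>p. cball (snd (c p) p) (R p) \<subseteq> snd (c p) ` fst (c p)"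
    by metis
  let ?N = "\<lambda>p. {q \<in> fst (c p). snd (c p) q \<in> ball (snd (c p) p) (R p)}"
  obtain P where P: "finite P" "UNIV \<subseteq> (\<Union>p\<in>P. ?N p)"
  proof (rule compactE_image)
    show "compact (UNIV :: 'a set)" using X by (simp add: compact_complex_manifold_def)
    show "open (?N p)" for p by (rule open_chart_vimage[OF X cR(2) open_ball])
    show "UNIV \<subseteq> (\<Union>p\<in>UNIV. ?N p)" using cR by auto
  qed blast
  have "infinite (\<Union>p\<in>P. {i. pt i \<in> ?N p})"
  proof -
    have "(\<Union>p\<in>P. {i. pt i \<in> ?N p}) = UNIV" using P(2) by blast
    then show ?thesis by simp
  qed
  then obtain p where p: "infinite {i. pt i \<in> ?N p}" using P(1) by blast
  define s where "s = enumerate {i. pt i \<in> ?N p}"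
  have s: "strict_mono s" "\<And>i. pt (s i) \<in> ?N p"
    using strict_mono_enumerate[OF p] enumerate_in_set[OF p] by (simp_all add: s_def)
  have "\<forall>i. snd (c p) (pt (s i)) \<in> cball (snd (c p) p) (R p)"
    using s(2) ball_subset_cball by blast
  then obtain y r where y: "y \<in> cball (snd (c p) p) (R p)" "strict_mono r"
      "((\<lambda>i. snd (c p) (pt (s i))) \<circ> r) \<longlonglongrightarrow> y"
    using compact_imp_seq_compact[OF compact_cball] unfolding seq_compact_def by metis
  have yW: "y \<in> snd (c p) ` fst (c p)" using y(1) cR(4) by blast
  show ?thesis
  proof (rule that)
    show "strict_mono (s \<circ> r)" using s y by (intro strict_mono_o)
    fix N assume N: "open N" "cinv (c p) y \<in> N"
    let ?U = "snd (c p) ` (N \<inter> fst (c p))"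
    have "open ?U" by (rule open_chart_image_subset[OF X cR(2) N(1)])
    moreover have "y \<in> ?U"
      using yW N by (auto simp: cinv_chart[OF X cR(2)] intro!: imageI)
    ultimately have "\<forall>\<^sub>F i in sequentially. snd (c p) (pt (s (r i))) \<in> ?U"
      using topological_tendstoD[OF y(3)] by (simp add: o_def)
    then show "\<forall>\<^sub>F i in sequentially. pt ((s \<circ> r) i) \<in> N"
    proof eventually_elim
      case (elim i)
      then obtain q where q: "q \<in> N" "q \<in> fst (c p)" "snd (c p) (pt (s (r i))) = snd (c p) q" by blast
      have "pt (s (r i)) \<in> fst (c p)" using s(2) by blast
      then have "pt (s (r i)) = q"
        using q cinv_chart[OF X cR(2)] by metis
      then show ?case using q by simp
    qed
  qed
qed

end

context
  fixes A :: "('a::t2_space, 'n::finite) chart set" and \<omega>K \<omega>sr :: "('a, 'n) form"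
  assumes X: "compact_complex_manifold A" and \<omega>K: "closed11 A \<omega>K" and \<omega>sr: "closed11 A \<omega>sr"
begin

lemma good_chart_ball_exists:
  assumes \<psi>: "normalized_potentials A \<omega>K \<omega>sr \<epsilon> \<psi>"
  shows "\<exists>c R \<kappa>. p \<in> fst c \<and> good_chart_ball A \<psi> c (snd c p) R \<kappa>"
proof -
  obtain c where c: "c \<in> A" "p \<in> fst c" using charts_cover[OF X] by blast
  then obtain R where R: "R > 0" "cball (snd c p) R \<subseteq> snd c ` fst c"
    using open_chart_image[OF X c(1)] open_contains_cball by (metis imageI)
  obtain \<kappa> where \<kappa>: "\<kappa> \<ge> 0" and sm: "\<forall>\<epsilon> \<psi>. 0 < \<epsilon> \<longrightarrow> \<epsilon> \<le> 1 \<longrightarrow> smooth_fun_on A UNIV \<psi> \<longrightarrow>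
      kahler_form A (potential_form A \<omega>K \<omega>sr \<epsilon> \<psi>) \<longrightarrow> (\<forall>p. \<psi> p \<le> 0) \<longrightarrow>
      supermean (ball (snd c p) R) (\<lambda>x. \<kappa> * (R\<^sup>2 - (norm (x - snd c p))\<^sup>2) - \<psi> (cinv c x))"
    using supermean_in_chart_ball[OF X \<omega>K \<omega>sr c(1) R(2)] by (elim exE conjE)
  have "supermean (ball (snd c p) R) (chart_fun c (snd c p) R \<kappa> (\<psi> i))" for i
    unfolding chart_fun_def[abs_def]
    using \<psi> unfolding normalized_potentials_def
    by (intro sm[rule_format, of "\<epsilon> i"]) simp_all
  then show ?thesis
    using c R \<open>\<kappa> \<ge> 0\<close> unfolding good_chart_ball_def by blast
qed

text \<open>A lower bound for \<open>\<psi> i\<close> at some point \<open>q\<close>, which may vary with \<open>i\<close> inside the ball of radius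
  \<open>R / 8\<close>, bounds the integral over a ball around \<open>q\<close>.  The radii are chosen such that the ball of radius
  \<open>3 R / 8\<close> around \<open>q\<close> contains the fixed ball of radius \<open>R / 4\<close> and the ball of radius \<open>R / 2\<close> around
  \<open>q\<close> stays inside the chart ball.\<close>

lemma good_chart_ball_L1:
  assumes g: "good_chart_ball A \<psi> c (snd c p) R \<kappa>" and p: "p \<in> fst c"
    and lower: "\<And>N. open N \<Longrightarrow> p \<in> N \<Longrightarrow> \<exists>C. \<forall>\<^sub>F i in sequentially. \<exists>q\<in>N. \<psi> i q \<ge> - C"
  shows "\<exists>C\<ge>0. \<forall>\<^sub>F i in sequentially.
    (\<integral>\<^sup>+x\<in>ball (snd c p) (R / 4). ennreal (chart_fun c (snd c p) R \<kappa> (\<psi> i) x) \<partial>lborel) \<le> ennreal C"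
proof -
  let ?a = "snd c p" and ?f = "\<lambda>i. chart_fun c (snd c p) R \<kappa> (\<psi> i)"
  have c: "c \<in> A" and R: "R > 0" and \<kappa>: "\<kappa> \<ge> 0" and sm: "\<And>i. supermean (ball ?a R) (?f i)"
    using g by (auto simp: good_chart_ball_def)
  let ?N = "{q \<in> fst c. snd c q \<in> ball ?a (R / 8)}"
  have "open ?N" by (rule open_chart_vimage[OF X c open_ball])
  moreover have "p \<in> ?N" using p R by simp
  ultimately obtain C where C: "\<forall>\<^sub>F i in sequentially. \<exists>q\<in>?N. \<psi> i q \<ge> - C" using lower by blast
  define m where "m = cone_mass TYPE('n) (R / 2)"
  have m: "m > 0" unfolding m_def using R by (intro cone_mass) simp
  define C' where "C' = m * max 0 (\<kappa> * R\<^sup>2 + C) / (R / 2 - 3 * R / 8)"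
  have "C' \<ge> 0" using m R by (simp add: C'_def)
  moreover have "\<forall>\<^sub>F i in sequentially. (\<integral>\<^sup>+x\<in>ball ?a (R / 4). ennreal (?f i x) \<partial>lborel) \<le> ennreal C'"
    using C
  proof eventually_elim
    case (elim i)
    then obtain q where q: "q \<in> fst c" "dist ?a (snd c q) < R / 8" "\<psi> i q \<ge> - C" by auto
    let ?y = "snd c q"
    have sub1: "ball ?a (R / 4) \<subseteq> ball ?y (3 * R / 8)"
    proof
      fix x assume "x \<in> ball ?a (R / 4)"
      then show "x \<in> ball ?y (3 * R / 8)"
        using q(2) dist_triangle[of ?y x ?a] by (simp add: dist_commute)
    qed
    have sub2: "cball ?y (R / 2) \<subseteq> ball ?a R"
    proof
      fix x assume "x \<in> cball ?y (R / 2)"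
      then show "x \<in> ball ?a R"
        using q(2) R dist_triangle[of ?a x ?y] by (simp add: dist_commute)
    qed
    have fy: "?f i ?y \<le> max 0 (\<kappa> * R\<^sup>2 + C)"
    proof -
      have "\<kappa> * (R\<^sup>2 - (norm (?y - ?a))\<^sup>2) \<le> \<kappa> * R\<^sup>2" using \<kappa> by (intro mult_left_mono) auto
      then show ?thesis using q(3) by (simp add: chart_fun_def cinv_chart[OF X c q(1)])
    qed
    have "(\<integral>\<^sup>+x\<in>ball ?a (R / 4). ennreal (?f i x) \<partial>lborel) \<le> (\<integral>\<^sup>+x\<in>ball ?y (3 * R / 8). ennreal (?f i x) \<partial>lborel)"
      using sub1 by (intro nn_integral_mono) (auto split: split_indicator)
    also have "\<dots> \<le> ennreal (m * ?f i ?y / (R / 2 - 3 * R / 8))"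
      unfolding m_def using R by (intro supermean_L1_bound[OF open_ball sm _ _ sub2]) auto
    also have "\<dots> \<le> ennreal C'"
      unfolding C'_def using fy m R by (intro ennreal_leI divide_right_mono mult_left_mono) auto
    finally show ?case .
  qed
  ultimately show ?thesis by blast
qed

text \<open>Call a point good if every neighbourhood contains, for almost all \<open>i\<close>, a point at which
  \<open>\<psi> i\<close> is bounded below independently of \<open>i\<close>.  Bad points form an open set by definition.  Near a
  good point the integrals are bounded, so every small ball nearby contains points of bounded value; so good
  points form an open set, too.  Connectedness spreads the property from the cluster point \<open>p0\<close> of the maximum
  points to the whole manifold.\<close>

lemma not_collapsing_everywhere:
  assumes \<psi>: "normalized_potentials A \<omega>K \<omega>sr \<epsilon> \<psi>"
    and p0: "\<And>N. open N \<Longrightarrow> p0 \<in> N \<Longrightarrow> \<forall>\<^sub>F i in sequentially. \<exists>q\<in>N. \<psi> i q = 0"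
    and N: "open N" "p \<in> N"
  shows "\<exists>C. \<forall>\<^sub>F i in sequentially. \<exists>q\<in>N. \<psi> i q \<ge> - C"
proof -
  define G where "G = {p. \<forall>N. open N \<longrightarrow> p \<in> N \<longrightarrow> (\<exists>C. \<forall>\<^sub>F i in sequentially. \<exists>q\<in>N. \<psi> i q \<ge> - C)}"
  have "p0 \<in> G"
    unfolding G_def
  proof (intro CollectI allI impI)
    fix N assume "open N" "p0 \<in> N"
    from p0[OF this] have "\<forall>\<^sub>F i in sequentially. \<exists>q\<in>N. \<psi> i q \<ge> - 0"
    proof eventually_elim
      case (elim i)
      then obtain q where "q \<in> N" "\<psi> i q = 0" by blast
      then show ?case by (intro bexI[of _ q]) simp_all
    qed
    then show "\<exists>C. \<forall>\<^sub>F i in sequentially. \<exists>q\<in>N. \<psi> i q \<ge> - C" by blast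
  qed
  moreover have "open G"
  proof (subst open_subopen, intro ballI)
    fix p assume pG: "p \<in> G"
    obtain c R \<kappa> where p: "p \<in> fst c" and g: "good_chart_ball A \<psi> c (snd c p) R \<kappa>"
      using good_chart_ball_exists[OF \<psi>] by blast
    have c: "c \<in> A" and R: "R > 0" and \<kappa>: "\<kappa> \<ge> 0" and W: "cball (snd c p) R \<subseteq> snd c ` fst c"
      using g by (auto simp: good_chart_ball_def)
    let ?a = "snd c p" and ?f = "\<lambda>i. chart_fun c (snd c p) R \<kappa> (\<psi> i)"
    obtain C where C: "C \<ge> 0"
      "\<forall>\<^sub>F i in sequentially. (\<integral>\<^sup>+x\<in>ball ?a (R / 4). ennreal (?f i x) \<partial>lborel) \<le> ennreal C"
      using good_chart_ball_L1[OF g p] pG unfolding G_def by blast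
    let ?T = "{q \<in> fst c. snd c q \<in> ball ?a (R / 4)}"
    have "?T \<subseteq> G"
    proof
      fix q assume q: "q \<in> ?T"
      show "q \<in> G"
        unfolding G_def
      proof (intro CollectI allI impI)
        fix N assume N: "open N" "q \<in> N"
        let ?B = "snd c ` (N \<inter> fst c) \<inter> ball ?a (R / 4)"
        have "open ?B" by (intro open_Int open_ball open_chart_image_subset[OF X c N(1)])
        moreover have "snd c q \<in> ?B" using q N by auto
        ultimately obtain s where s: "s > 0" "ball (snd c q) s \<subseteq> ?B"
          using open_contains_ball by blast
        then have "ball (snd c q) s \<subseteq> ball ?a (R / 4)" by blast
        from supermean_lower_value[OF s(1) this C(1)]
        obtain L where L: "\<And>f. (\<integral>\<^sup>+x\<in>ball ?a (R / 4). ennreal (f x) \<partial>lborel) \<le> ennreal C \<Longrightarrow>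
          \<exists>x\<in>ball (snd c q) s. f x \<le> L" by blast
        have "\<forall>\<^sub>F i in sequentially. \<exists>q\<in>N. \<psi> i q \<ge> - L"
          using C(2)
        proof eventually_elim
          case (elim i)
          from L[OF this] obtain x where x: "x \<in> ball (snd c q) s" "?f i x \<le> L" by blast
          then obtain q' where q': "q' \<in> N" "q' \<in> fst c" "x = snd c q'" using s(2) by blast
          have "x \<in> ball ?a (R / 4)" using x(1) s(2) by blast
          then have "norm (x - ?a) \<le> R" using R by (simp add: dist_norm norm_minus_commute)
          then have "0 \<le> \<kappa> * (R\<^sup>2 - (norm (x - ?a))\<^sup>2)"
            using \<kappa> by (intro mult_nonneg_nonneg) (auto intro: power_mono)
          then have "- L \<le> \<psi> i q'"
            using x(2) q' by (simp add: chart_fun_def cinv_chart[OF X c])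
          then show ?case using q' by blast
        qed
        then show "\<exists>C. \<forall>\<^sub>F i in sequentially. \<exists>q\<in>N. \<psi> i q \<ge> - C" by blast
      qed
    qed
    moreover have "open ?T" by (rule open_chart_vimage[OF X c open_ball])
    moreover have "p \<in> ?T" using p R by simp
    ultimately show "\<exists>T. open T \<and> p \<in> T \<and> T \<subseteq> G" by blast
  qed
  moreover have "open (- G)"
  proof (subst open_subopen, intro ballI)
    fix p assume "p \<in> - G"
    then obtain N where N: "open N" "p \<in> N" "\<not> (\<exists>C. \<forall>\<^sub>F i in sequentially. \<exists>q\<in>N. \<psi> i q \<ge> - C)"
      unfolding G_def by blast
    then have "N \<subseteq> - G" unfolding G_def by blast
    with N show "\<exists>T. open T \<and> p \<in> T \<and> T \<subseteq> - G" by blast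
  qed
  moreover have "connected (UNIV :: 'a set)"
    using X by (simp add: compact_complex_manifold_def)
  ultimately have "- G = {}"
    using connectedD[of UNIV G "- G"] by blast
  then have "p \<in> G" by blast
  then show ?thesis using N unfolding G_def by blast
qed

end

section \<open>Compactness of potentials and the limit metric\<close>

lemma frechet_derivative_add_const:
  fixes f :: "'v::real_normed_vector \<Rightarrow> 'b::real_normed_vector"
  shows "frechet_derivative (\<lambda>x. f x + k) F = frechet_derivative f F"
proof -
  have "((\<lambda>x. f x + k) has_derivative D) F \<longleftrightarrow> (f has_derivative D) F" for D
    using has_derivative_add_const[of f D F k] has_derivative_add_const[of "\<lambda>x. f x + k" D F "- k"]
    by auto
  then show ?thesis by (simp add: frechet_derivative_def)
qed

lemma smooth_on_add_const:
  assumes "smooth_on S f"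
  shows "smooth_on S (\<lambda>x. f x + k)"
proof -
  have it: "iter_deriv (v # vs) (\<lambda>x. f x + k) = iter_deriv (v # vs) f" for v vs
    by (induction vs arbitrary: v) (simp_all add: frechet_derivative_add_const)
  show ?thesis
    unfolding smooth_on_def
  proof (intro allI ballI)
    fix vs x assume x: "x \<in> S"
    show "iter_deriv vs (\<lambda>x. f x + k) differentiable (at x)"
    proof (cases vs)
      case Nil
      have "iter_deriv [] f differentiable (at x)" using assms x unfolding smooth_on_def by blast
      then show ?thesis by (simp add: Nil differentiable_add)
    next
      case (Cons v ws)
      then show ?thesis using assms x it[of v ws] unfolding smooth_on_def by metis
    qed
  qed
qed

lemma idd_add_const:
  fixes A :: "('a, 'n::finite) chart set"
  shows "idd A (\<lambda>p. f p + k) = idd A f"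
proof -
  have eq: "complex_hessian ((\<lambda>p. f p + k) \<circ> cinv c) z = complex_hessian (f \<circ> cinv c) z"
    for c :: "('a, 'n) chart" and z
  proof -
    have "dzbar j (\<lambda>w. complex_of_real (((\<lambda>p. f p + k) \<circ> cinv c) w))
        = dzbar j (\<lambda>w. complex_of_real ((f \<circ> cinv c) w))" for j
      by (rule ext) (simp add: dzbar_def frechet_derivative_add_const)
    then show ?thesis by (simp add: complex_hessian_def)
  qed
  show ?thesis unfolding idd_def by (simp only: eq)
qed

text \<open>The complex Hessian annihilates constants, and the system involves the potential through its form
  only.\<close>

lemma approx_cscK_add_const:
  fixes A :: "('a::t2_space, 'n::finite) chart set"
  assumes "approx_cscK A \<omega>K \<omega>sr \<theta> \<omega>\<theta> \<epsilon> \<phi> F"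
  shows "approx_cscK A \<omega>K \<omega>sr \<theta> \<omega>\<theta> \<epsilon> (\<lambda>p. \<phi> p + k) F"
proof -
  have "potential_form A \<omega>K \<omega>sr \<epsilon> (\<lambda>p. \<phi> p + k) = potential_form A \<omega>K \<omega>sr \<epsilon> \<phi>"
    by (simp add: potential_form_def idd_add_const)
  moreover have "smooth_fun_on A UNIV (\<lambda>p. \<phi> p + k)"
    using assms smooth_on_add_const[of _ "\<phi> \<circ> cinv c" k for c :: "('a, 'n) chart"]
    unfolding approx_cscK_def smooth_fun_on_def by (simp add: o_def)
  ultimately show ?thesis using assms unfolding approx_cscK_def by simp
qed

text \<open>The distance of the chart functions equals the distance of the potentials, since the quadratic term
  \<open>K\<close> cancels; for \<open>\<phi> = -\<infinity>\<close> both sides are infinite.\<close>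

lemma ennreal_dist_eq:
  assumes "\<phi> \<le> 0" "0 \<le> K" "\<psi> \<le> K"
  shows "(ennreal (K - \<psi>) - e2ennreal (ereal K - \<phi>)) + (e2ennreal (ereal K - \<phi>) - ennreal (K - \<psi>))
    = e2ennreal \<bar>ereal \<psi> - \<phi>\<bar>"
proof (cases \<phi>)
  case (real v)
  then have v: "v \<le> 0" using assms by simp
  show ?thesis
    using assms real v by (cases "\<psi> \<le> v") (auto simp: e2ennreal_ereal ennreal_minus ennreal_neg)
next
  case PInf then show ?thesis using assms by simp
next
  case MInf then show ?thesis by simp
qed

context
  fixes A :: "('a::t2_space, 'n::finite) chart set"
  assumes X: "compact_complex_manifold A"
begin

lemma smooth_fun_continuous:
  assumes f: "smooth_fun_on A UNIV f"
  shows "continuous_on UNIV f"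
proof -
  have "continuous_on (fst c) f" if c: "c \<in> A" for c
  proof -
    have "smooth_on (snd c ` fst c) (f \<circ> cinv c)"
      using f c unfolding smooth_fun_on_def by auto
    then have "continuous_on (snd c ` fst c) (f \<circ> cinv c)" by (rule smooth_on_continuous)
    then have "continuous_on (fst c) ((f \<circ> cinv c) \<circ> snd c)"
      by (rule continuous_on_compose[OF continuous_chart[OF X c]])
    then show ?thesis
      by (rule continuous_on_eq) (simp add: cinv_chart[OF X c])
  qed
  then have "continuous_on (\<Union>c\<in>A. fst c) f"
    by (intro continuous_on_open_UN) (auto intro: open_chart_domain[OF X])
  moreover have "(\<Union>c\<in>A. fst c) = UNIV" using charts_cover[OF X] by blast
  ultimately show ?thesis by simp
qed

lemma measurable_in_chart:
  fixes g :: "'a \<Rightarrow> ennreal"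
  assumes c: "c \<in> A" and g: "g \<in> borel_measurable borel" and U: "open U" "U \<subseteq> snd c ` fst c"
  shows "(\<lambda>x. g (cinv c x) * indicator U x) \<in> borel_measurable borel"
proof -
  have "cinv c \<in> measurable (restrict_space borel U) borel"
    using continuous_on_subset[OF continuous_cinv[OF X c] U(2)]
    by (rule borel_measurable_continuous_on_restrict)
  then have "(\<lambda>x. g (cinv c x)) \<in> borel_measurable (restrict_space borel U)"
    using g by (rule measurable_compose)
  then show ?thesis
    using U by (subst (asm) borel_measurable_restrict_space_iff_ennreal) auto
qed

text \<open>On a relatively compact part of a chart the measure of the form is dominated by Lebesgue
  measure, so \<open>L\<^sup>1\<close> convergence can be tested in coordinates.\<close>

lemma form_measure_chart_bound:
  assumes \<omega>: "smooth_form A 2 \<omega>" and c: "c \<in> A" and U: "open U" "U \<subseteq> K"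
    and K: "compact K" "K \<subseteq> snd c ` fst c"
  shows "\<exists>D\<ge>0. \<forall>g\<in>borel_measurable borel.
    (\<integral>\<^sup>+p\<in>{q \<in> fst c. snd c q \<in> U}. g p \<partial>form_measure A (wpow A \<omega> CARD('n)))
      \<le> ennreal D * (\<integral>\<^sup>+x\<in>U. g (cinv c x) \<partial>lborel)"
proof -
  let ?\<tau> = "wpow A \<omega> CARD('n)" and ?N = "{q \<in> fst c. snd c q \<in> U}"
  note reg = kahler_volume_regular[OF X \<omega>]
  have "continuous_on K (\<lambda>x. density ?\<tau> c (cinv c x))"
    using continuous_on_subset[OF reg(1)[OF c] K(2)] .
  then have "bounded ((\<lambda>x. density ?\<tau> c (cinv c x)) ` K)"
    using K(1) compact_continuous_image compact_imp_bounded by blast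
  then obtain D where D: "D > 0" "\<And>x. x \<in> K \<Longrightarrow> \<bar>density ?\<tau> c (cinv c x)\<bar> \<le> D"
    unfolding bounded_pos by auto
  have N: "open ?N" by (rule open_chart_vimage[OF X c U(1)])
  have UW: "U \<subseteq> snd c ` fst c" using U K by blast
  have "(\<integral>\<^sup>+p\<in>?N. g p \<partial>form_measure A ?\<tau>) \<le> ennreal D * (\<integral>\<^sup>+x\<in>U. g (cinv c x) \<partial>lborel)"
    if g: "g \<in> borel_measurable borel" for g
  proof -
    have gN: "(\<lambda>p. g p * indicator ?N p) \<in> borel_measurable borel"
      using g N by (intro borel_measurable_times_ennreal borel_measurable_indicator) auto
    have "(\<integral>\<^sup>+p\<in>?N. g p \<partial>form_measure A ?\<tau>) = (\<integral>\<^sup>+p\<in>fst c. (g p * indicator ?N p) \<partial>form_measure A ?\<tau>)"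
      by (intro nn_integral_cong) (auto split: split_indicator)
    also have "\<dots> = (\<integral>\<^sup>+x\<in>snd c ` fst c. ennreal \<bar>density ?\<tau> c (cinv c x)\<bar>
        * (g (cinv c x) * indicator ?N (cinv c x)) \<partial>lborel)"
      by (rule nn_integral_form_measure_chart[OF X reg c gN])
    also have "\<dots> \<le> (\<integral>\<^sup>+x. ennreal D * (g (cinv c x) * indicator U x) \<partial>lborel)"
    proof (intro nn_integral_mono)
      fix x
      show "ennreal \<bar>density ?\<tau> c (cinv c x)\<bar> * (g (cinv c x) * indicator ?N (cinv c x))
          * indicator (snd c ` fst c) x \<le> ennreal D * (g (cinv c x) * indicator U x)"
      proof (cases "x \<in> snd c ` fst c \<and> cinv c x \<in> ?N")
        case True
        then have xU: "x \<in> U" using chart_cinv[OF X c] by auto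
        then have "\<bar>density ?\<tau> c (cinv c x)\<bar> \<le> D" using D U by auto
        then show ?thesis using True xU by (auto intro!: mult_right_mono ennreal_leI)
      qed (auto split: split_indicator)
    qed
    also have "\<dots> = ennreal D * (\<integral>\<^sup>+x\<in>U. g (cinv c x) \<partial>lborel)"
      using measurable_in_chart[OF c g U(1) UW] by (intro nn_integral_cmult) simp
    finally show ?thesis .
  qed
  then have "\<forall>g\<in>borel_measurable borel. (\<integral>\<^sup>+q\<in>?N. g q \<partial>form_measure A ?\<tau>)
      \<le> ennreal D * (\<integral>\<^sup>+x\<in>U. g (cinv c x) \<partial>lborel)" by (rule ballI)
  with less_imp_le[OF D(1)] show ?thesis by (intro exI[of _ D] conjI)
qed

end

context
  fixes A :: "('a::t2_space, 'n::finite) chart set" and \<omega>K \<omega>sr :: "('a, 'n) form"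
  assumes X: "compact_complex_manifold A" and \<omega>K: "closed11 A \<omega>K" and \<omega>sr: "closed11 A \<omega>sr"
begin

lemma upper_limit_nonpos:
  assumes "\<And>i p. \<psi> i p \<le> 0"
  shows "upper_limit \<psi> p \<le> 0"
proof (rule upper_limit_le[of UNIV])
  show "\<forall>\<^sub>F i in sequentially. \<forall>q\<in>UNIV. ereal (\<psi> i q) \<le> 0"
    by (intro always_eventually allI ballI) (simp add: assms)
qed auto

text \<open>The upper limit turns into a half-relaxed lower limit under the change of sign in
  \<open>chart_fun\<close>, so it satisfies both one-sided conditions of \<open>supermean_sequence_L1_convergence\<close>.\<close>

lemma chart_ball_L1_convergence:
  assumes neg: "\<And>i p. \<psi> i p \<le> 0"
    and g: "good_chart_ball A \<psi> c a R \<kappa>" and C: "C \<ge> 0"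
    and L1: "\<And>i. (\<integral>\<^sup>+x\<in>ball a (R / 4). ennreal (chart_fun c a R \<kappa> (\<psi> i) x) \<partial>lborel) \<le> ennreal C"
    and Q: "closure Q = UNIV"
    and conv: "\<And>k x. x \<in> Q \<Longrightarrow> convergent
      (\<lambda>i. smear (ball a (R / 4)) (R / 4 / (4 * (real k + 1))) (chart_fun c a R \<kappa> (\<psi> i)) x)"
  shows "(\<lambda>i. \<integral>\<^sup>+x\<in>ball a (R / 8). e2ennreal \<bar>ereal (\<psi> i (cinv c x)) - upper_limit \<psi> (cinv c x)\<bar> \<partial>lborel)
    \<longlonglongrightarrow> 0"
proof -
  have c: "c \<in> A" and R: "R > 0" and \<kappa>: "\<kappa> \<ge> 0" and W: "cball a R \<subseteq> snd c ` fst c"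
    and sm: "\<And>i. supermean (ball a R) (chart_fun c a R \<kappa> (\<psi> i))"
    using g by (auto simp: good_chart_ball_def)
  let ?U = "upper_limit \<psi>" and ?H = "ball a (R / 4 / 2)"
  define K where "K = (\<lambda>x. \<kappa> * (R\<^sup>2 - (norm (x - a))\<^sup>2))"
  define fl where "fl = (\<lambda>x. e2ennreal (ereal (K x) - ?U (cinv c x)))"
  have U0: "?U p \<le> 0" for p using neg by (rule upper_limit_nonpos)
  have K0: "K x \<ge> 0" if "x \<in> ball a R" for x
    using that \<kappa> unfolding K_def
    by (intro mult_nonneg_nonneg) (auto simp: dist_norm norm_minus_commute intro: power_mono)
  have cK: "continuous_on UNIV K" unfolding K_def by (intro continuous_intros)
  have HB: "?H \<subseteq> ball a R" and HW: "?H \<subseteq> snd c ` fst c" using R W by auto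
  have f: "chart_fun c a R \<kappa> (\<psi> i) x = K x - \<psi> i (cinv c x)" for i x
    by (simp add: chart_fun_def K_def)
  have "(\<lambda>i. \<integral>\<^sup>+x\<in>?H. ((ennreal (chart_fun c a R \<kappa> (\<psi> i) x) - fl x)
      + (fl x - ennreal (chart_fun c a R \<kappa> (\<psi> i) x))) \<partial>lborel) \<longlonglongrightarrow> 0"
  proof (rule supermean_sequence_L1_convergence[OF _ _ C L1 Q conv])
    show "R / 4 > 0" using R by simp
    show "supermean (ball a (R / 4)) (chart_fun c a R \<kappa> (\<psi> i))" for i
      using R by (intro supermean_subset[OF sm]) auto
    show "(\<lambda>x. fl x * indicator ?H x) \<in> borel_measurable borel"
    proof -
      have "(\<lambda>x. cinv c x) \<in> measurable (restrict_space borel ?H) borel"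
        using continuous_on_subset[OF continuous_cinv[OF X c] HW]
        by (rule borel_measurable_continuous_on_restrict)
      from measurable_compose[OF this measurable_upper_limit]
      have m1: "(\<lambda>x. ?U (cinv c x)) \<in> borel_measurable (restrict_space borel ?H)" .
      have "K \<in> borel_measurable (restrict_space borel ?H)"
        using continuous_on_subset[OF cK] by (intro borel_measurable_continuous_on_restrict) simp
      then have "fl \<in> borel_measurable (restrict_space borel ?H)"
        unfolding fl_def using m1 by measurable
      then show ?thesis
        by (subst (asm) borel_measurable_restrict_space_iff_ennreal) auto
    qed
    fix x assume x: "x \<in> ?H"
    show "fl x \<le> liminf (\<lambda>i. ennreal (chart_fun c a R \<kappa> (\<psi> i) x))"
      unfolding le_Liminf_iff
    proof (intro allI impI)
      fix y assume y: "y < fl x"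
      then obtain r where r: "y = ennreal r" "r \<ge> 0" by (cases y) auto
      have "ereal r < ereal (K x) - ?U (cinv c x)"
        using y r unfolding fl_def
        by (metis e2ennreal_enn2ereal e2ennreal_mono enn2ereal_ennreal leD not_le_imp_less)
      then have "?U (cinv c x) < ereal (K x - r)"
        by (cases "?U (cinv c x)") auto
      then have "limsup (\<lambda>i. ereal (\<psi> i (cinv c x))) < ereal (K x - r)"
        using limsup_le_upper_limit le_less_trans by blast
      then have "\<forall>\<^sub>F i in sequentially. ereal (\<psi> i (cinv c x)) < ereal (K x - r)" by (rule Limsup_lessD)
      then show "\<forall>\<^sub>F i in sequentially. y < ennreal (chart_fun c a R \<kappa> (\<psi> i) x)"
        by eventually_elim (use r in \<open>simp add: ennreal_less_iff f\<close>)
    qed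
    fix l r :: real
    assume l: "0 \<le> l" and r: "0 < r"
      and ev: "\<forall>\<^sub>F i in sequentially. \<forall>y\<in>ball x r. l \<le> chart_fun c a R \<kappa> (\<psi> i) y"
    have xW: "x \<in> snd c ` fst c" using x HW by blast
    have "?U (cinv c x) \<le> ereal (K x - l) + ereal e" if e: "e > 0" for e
    proof -
      have "isCont K x" using cK continuous_on_eq_continuous_at[of UNIV K] by simp
      then obtain d where d: "d > 0" "\<And>y. dist y x < d \<Longrightarrow> dist (K y) (K x) < e"
        using e unfolding continuous_at_eps_delta by blast
      let ?N = "{q \<in> fst c. snd c q \<in> ball x (min d r)}"
      have "?U (cinv c x) \<le> ereal (K x - l + e)"
      proof (rule upper_limit_le)
        show "open ?N" by (rule open_chart_vimage[OF X c open_ball])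
        show "cinv c x \<in> ?N"
          using xW d r cinv_mem[OF xW] by (simp add: chart_cinv[OF X c])
        show "\<forall>\<^sub>F i in sequentially. \<forall>q\<in>?N. ereal (\<psi> i q) \<le> ereal (K x - l + e)"
          using ev
        proof eventually_elim
          case (elim i)
          show ?case
          proof
            fix q assume q: "q \<in> ?N"
            then have "l \<le> K (snd c q) - \<psi> i q"
              using elim[rule_format, of "snd c q"] by (simp add: f cinv_chart[OF X c])
            moreover have "dist (K (snd c q)) (K x) < e" using q by (intro d) (auto simp: dist_commute)
            ultimately show "ereal (\<psi> i q) \<le> ereal (K x - l + e)" by (simp add: dist_real_def)
          qed
        qed
      qed
      then show ?thesis by simp
    qed
    then have "?U (cinv c x) \<le> ereal (K x - l)" by (rule ereal_le_epsilon2)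
    then have "ereal l \<le> ereal (K x) - ?U (cinv c x)"
      by (cases "?U (cinv c x)") auto
    from e2ennreal_mono[OF this] show "ennreal l \<le> fl x"
      by (simp add: fl_def e2ennreal_ereal)
  qed
  also have "(\<lambda>i. \<integral>\<^sup>+x\<in>?H. ((ennreal (chart_fun c a R \<kappa> (\<psi> i) x) - fl x)
      + (fl x - ennreal (chart_fun c a R \<kappa> (\<psi> i) x))) \<partial>lborel)
    = (\<lambda>i. \<integral>\<^sup>+x\<in>?H. e2ennreal \<bar>ereal (\<psi> i (cinv c x)) - ?U (cinv c x)\<bar> \<partial>lborel)"
  proof (intro ext nn_integral_cong)
    fix i x
    show "((ennreal (chart_fun c a R \<kappa> (\<psi> i) x) - fl x) + (fl x - ennreal (chart_fun c a R \<kappa> (\<psi> i) x)))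
        * indicator ?H x = e2ennreal \<bar>ereal (\<psi> i (cinv c x)) - ?U (cinv c x)\<bar> * indicator ?H x"
    proof (cases "x \<in> ?H")
      case True
      then have "K x \<ge> 0" using HB K0 by blast
      moreover have "\<psi> i (cinv c x) \<le> K x" using neg[of i "cinv c x"] \<open>K x \<ge> 0\<close> by linarith
      ultimately show ?thesis
        unfolding f fl_def using ennreal_dist_eq[OF U0] by simp
    qed simp
  qed
  finally show ?thesis by simp
qed

text \<open>Finitely many chart balls of radius \<open>R / 8\<close> cover the manifold, and \<open>not_collapsing_everywhere\<close>
  gives integral bounds on the corresponding balls of radius \<open>R / 4\<close>.  The averages at the points
  of a dense set, for all balls of the cover and all radii \<open>R / (16 (k + 1))\<close>, are countably many bounded
  sequences, and one diagonal subsequence makes all of them converge.\<close>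

theorem potentials_L1_compactness:
  assumes \<psi>: "normalized_potentials A \<omega>K \<omega>sr \<epsilon> \<psi>"
    and p0: "\<And>N. open N \<Longrightarrow> p0 \<in> N \<Longrightarrow> \<forall>\<^sub>F i in sequentially. \<exists>q\<in>N. \<psi> i q = 0"
  shows "\<exists>r. strict_mono r \<and> (\<lambda>i. \<integral>\<^sup>+p. e2ennreal \<bar>ereal (\<psi> (r i) p) - upper_limit (\<lambda>i. \<psi> (r i)) p\<bar>
    \<partial>form_measure A (wpow A \<omega>K CARD('n))) \<longlonglongrightarrow> 0"
proof -
  let ?M = "form_measure A (wpow A \<omega>K CARD('n))"
  have sK: "smooth_form A 2 \<omega>K" using \<omega>K by (simp add: closed11_def)
  have neg: "\<psi> i p \<le> 0" for i p using \<psi> by (simp add: normalized_potentials_def)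
  define G where "G = (\<lambda>p (c :: ('a, 'n) chart, R, \<kappa>, C). p \<in> fst c \<and> good_chart_ball A \<psi> c (snd c p) R \<kappa> \<and> C \<ge> 0 \<and>
    (\<forall>\<^sub>F i in sequentially. (\<integral>\<^sup>+x\<in>ball (snd c p) (R / 4).
      ennreal (chart_fun c (snd c p) R \<kappa> (\<psi> i) x) \<partial>lborel) \<le> ennreal C))"
  have "\<forall>p. \<exists>t. G p t"
  proof
    fix p
    from good_chart_ball_exists[OF X \<omega>K \<omega>sr \<psi>, of p]
    obtain c R \<kappa> where c: "p \<in> fst c" "good_chart_ball A \<psi> c (snd c p) R \<kappa>"
      by (elim exE conjE)
    have "\<exists>C\<ge>0. \<forall>\<^sub>F i in sequentially.
        (\<integral>\<^sup>+x\<in>ball (snd c p) (R / 4). ennreal (chart_fun c (snd c p) R \<kappa> (\<psi> i) x) \<partial>lborel) \<le> ennreal C"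
      by (rule good_chart_ball_L1[OF X \<omega>K \<omega>sr c(2,1) not_collapsing_everywhere[OF X \<omega>K \<omega>sr \<psi> p0]])
    then obtain C where "C \<ge> 0" "\<forall>\<^sub>F i in sequentially.
        (\<integral>\<^sup>+x\<in>ball (snd c p) (R / 4). ennreal (chart_fun c (snd c p) R \<kappa> (\<psi> i) x) \<partial>lborel) \<le> ennreal C"
      by (elim exE conjE)
    with c have "G p (c, R, \<kappa>, C)" by (simp add: G_def)
    then show "\<exists>t. G p t" ..
  qed
  from choice[OF this] obtain t where t: "\<forall>p. G p (t p)" ..
  define c where "c = (\<lambda>p. fst (t p))"
  define R where "R = (\<lambda>p. fst (snd (t p)))"
  define \<kappa> where "\<kappa> = (\<lambda>p. fst (snd (snd (t p))))"
  define C where "C = (\<lambda>p. snd (snd (snd (t p))))"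
  have G: "G p (c p, R p, \<kappa> p, C p)" for p
    using t by (simp add: c_def R_def \<kappa>_def C_def)
  then have pc: "p \<in> fst (c p)" and g: "good_chart_ball A \<psi> (c p) (snd (c p) p) (R p) (\<kappa> p)" and C: "C p \<ge> 0"
    and L1ev: "\<forall>\<^sub>F i in sequentially. (\<integral>\<^sup>+x\<in>ball (snd (c p) p) (R p / 4).
      ennreal (chart_fun (c p) (snd (c p) p) (R p) (\<kappa> p) (\<psi> i) x) \<partial>lborel) \<le> ennreal (C p)" for p
    unfolding G_def by simp_all
  define a where "a = (\<lambda>p. snd (c p) p)"
  define f where "f = (\<lambda>p i. chart_fun (c p) (a p) (R p) (\<kappa> p) (\<psi> i))"
  have cA: "c p \<in> A" and R: "R p > 0" and W: "cball (a p) (R p) \<subseteq> snd (c p) ` fst (c p)"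
    and sm: "supermean (ball (a p) (R p)) (f p i)" for p i
    using g[of p] by (auto simp: good_chart_ball_def a_def f_def)
  define N where "N = (\<lambda>p. {q \<in> fst (c p). snd (c p) q \<in> ball (a p) (R p / 8)})"
  have openN: "open (N p)" for p unfolding N_def by (rule open_chart_vimage[OF X cA open_ball])
  obtain P where P: "finite P" "UNIV \<subseteq> (\<Union>p\<in>P. N p)"
  proof (rule compactE_image)
    show "compact (UNIV :: 'a set)" using X by (simp add: compact_complex_manifold_def)
    show "UNIV \<subseteq> (\<Union>p\<in>UNIV. N p)" using pc R by (auto simp: N_def a_def)
  qed (rule openN, rule that)
  have "\<forall>\<^sub>F i in sequentially. \<forall>p\<in>P. (\<integral>\<^sup>+x\<in>ball (a p) (R p / 4). ennreal (f p i x) \<partial>lborel) \<le> ennreal (C p)"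
    unfolding f_def a_def by (rule eventually_ball_finite[OF P(1)]) (intro ballI L1ev)
  then obtain M where M': "\<forall>i\<ge>M. \<forall>p\<in>P. (\<integral>\<^sup>+x\<in>ball (a p) (R p / 4). ennreal (f p i x) \<partial>lborel) \<le> ennreal (C p)"
    unfolding eventually_sequentially by (elim exE)
  have M: "(\<integral>\<^sup>+x\<in>ball (a p) (R p / 4). ennreal (f p i x) \<partial>lborel) \<le> ennreal (C p)"
    if "i \<ge> M" "p \<in> P" for i p
    using that by (rule M'[rule_format])
  obtain Q :: "(complex^'n) set" where Q: "countable Q"
    and Q2: "\<forall>S. open S \<longrightarrow> S \<noteq> {} \<longrightarrow> (\<exists>d\<in>Q. d \<in> S)"
    using countable_dense_exists[where 'a = "complex^'n"] by (elim exE conjE)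
  have Qd: "closure Q = UNIV"
  proof (rule ccontr)
    assume "closure Q \<noteq> UNIV"
    then have "open (- closure Q)" "- closure Q \<noteq> {}" by auto
    then have "\<exists>d\<in>Q. d \<in> - closure Q" by (rule Q2[rule_format])
    then show False using closure_subset by blast
  qed
  \<comment> \<open>The shift by \<open>M\<close> discards the finitely many indices before the integral bounds hold.\<close>
  define b where "b = (\<lambda>(p, k, x) i. smear (ball (a p) (R p / 4)) (R p / 4 / (4 * (real k + 1))) (f p (i + M)) x)"
  obtain r' where r': "strict_mono r'" "\<And>j. j \<in> P \<times> (UNIV :: nat set) \<times> Q \<Longrightarrow> convergent (\<lambda>i. b j (r' i))"
  proof (rule convergent_subsequence_family[of "P \<times> (UNIV :: nat set) \<times> Q" b])
    show "countable (P \<times> (UNIV :: nat set) \<times> Q)"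
      by (intro countable_SIGMA countable_finite[OF P(1)] Q) simp_all
    fix j assume "j \<in> P \<times> (UNIV :: nat set) \<times> Q"
    then obtain p k x where j: "j = (p, k, x)" "p \<in> P" by auto
    let ?\<delta> = "R p / 4 / (4 * (real k + 1))"
    have L: "supermean_L1 (ball (a p) (R p / 4)) (f p (i + M)) (C p) ?\<delta> (cone_mass TYPE('n) ?\<delta>)" for i
      using R[of p] C[of p] M[of "i + M" p] j(2) by unfold_locales (auto intro: supermean_subset[OF sm])
    show "bounded (range (b j))"
      unfolding bounded_iff
    proof (intro exI ballI)
      fix y assume "y \<in> range (b j)"
      then obtain i where "y = smear (ball (a p) (R p / 4)) ?\<delta> (f p (i + M)) x"
        by (auto simp: b_def j(1))
      then show "norm y \<le> C p * ?\<delta> / cone_mass TYPE('n) ?\<delta>"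
        using supermean_L1.smear_le[OF L] supermean_L1.smear_nonneg[OF L] by simp
    qed
  qed blast
  define r where "r = (\<lambda>i. r' i + M)"
  have r: "strict_mono r" using r'(1) by (auto simp: r_def strict_mono_def)
  let ?\<psi> = "\<lambda>i. \<psi> (r i)"
  let ?g = "\<lambda>i p. e2ennreal \<bar>ereal (?\<psi> i p) - upper_limit ?\<psi> p\<bar>"
  have lim: "(\<lambda>i. \<integral>\<^sup>+x\<in>ball (a p) (R p / 8). ?g i (cinv (c p) x) \<partial>lborel) \<longlonglongrightarrow> 0" if p: "p \<in> P" for p
  proof (rule chart_ball_L1_convergence[where C = "C p" and \<kappa> = "\<kappa> p" and Q = Q])
    show "?\<psi> i q \<le> 0" for i q by (rule neg)
    show "good_chart_ball A ?\<psi> (c p) (a p) (R p) (\<kappa> p)"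
      using g[of p] by (simp add: good_chart_ball_def a_def)
    show "C p \<ge> 0" by (rule C)
    show "(\<integral>\<^sup>+x\<in>ball (a p) (R p / 4). ennreal (chart_fun (c p) (a p) (R p) (\<kappa> p) (?\<psi> i) x) \<partial>lborel) \<le> ennreal (C p)" for i
      using M[of "r i" p] p by (simp add: f_def r_def)
    show "closure Q = UNIV" by (rule Qd)
    show "convergent (\<lambda>i. smear (ball (a p) (R p / 4)) (R p / 4 / (4 * (real k + 1)))
        (chart_fun (c p) (a p) (R p) (\<kappa> p) (?\<psi> i)) x)" if "x \<in> Q" for k x
      using r'(2)[of "(p, k, x)"] p that by (simp add: b_def f_def r_def)
  qed
  have gm: "?g i \<in> borel_measurable borel" for i
  proof -
    have "continuous_on UNIV (?\<psi> i)"
      using \<psi> by (intro smooth_fun_continuous[OF X]) (simp add: normalized_potentials_def)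
    then have [measurable]: "?\<psi> i \<in> borel_measurable borel" by (rule borel_measurable_continuous_onI)
    show ?thesis by measurable
  qed
  have "\<exists>D\<ge>0. \<forall>g\<in>borel_measurable borel. (\<integral>\<^sup>+q\<in>N p. g q \<partial>?M)
      \<le> ennreal D * (\<integral>\<^sup>+x\<in>ball (a p) (R p / 8). g (cinv (c p) x) \<partial>lborel)" for p
    unfolding N_def
  proof (rule form_measure_chart_bound[OF X sK cA open_ball])
    show "ball (a p) (R p / 8) \<subseteq> cball (a p) (R p)" using R[of p] by auto
  qed (use W in auto)
  then have "\<forall>p. \<exists>D. \<forall>g\<in>borel_measurable borel. (\<integral>\<^sup>+q\<in>N p. g q \<partial>?M)
      \<le> ennreal D * (\<integral>\<^sup>+x\<in>ball (a p) (R p / 8). g (cinv (c p) x) \<partial>lborel)" by blast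
  from choice[OF this] obtain D where D': "\<forall>p. \<forall>g\<in>borel_measurable borel. (\<integral>\<^sup>+q\<in>N p. g q \<partial>?M)
      \<le> ennreal (D p) * (\<integral>\<^sup>+x\<in>ball (a p) (R p / 8). g (cinv (c p) x) \<partial>lborel)" ..
  have D: "(\<integral>\<^sup>+q\<in>N p. g q \<partial>?M)
      \<le> ennreal (D p) * (\<integral>\<^sup>+x\<in>ball (a p) (R p / 8). g (cinv (c p) x) \<partial>lborel)"
    if "g \<in> borel_measurable borel" for p g
    using bspec[OF spec[OF D'] that] .
  have setsM: "sets ?M = sets borel"
    by (rule conjunct1[OF form_measure_spec[OF X kahler_volume_regular[OF X sK]]])
  have mM: "borel_measurable ?M = borel_measurable borel"
    by (rule measurable_cong_sets) (auto simp: setsM)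
  have bound: "(\<integral>\<^sup>+q. ?g i q \<partial>?M)
      \<le> (\<Sum>p\<in>P. ennreal (D p) * (\<integral>\<^sup>+x\<in>ball (a p) (R p / 8). ?g i (cinv (c p) x) \<partial>lborel))" for i
  proof -
    have "(\<integral>\<^sup>+q. ?g i q \<partial>?M) \<le> (\<integral>\<^sup>+q. (\<Sum>p\<in>P. ?g i q * indicator (N p) q) \<partial>?M)"
    proof (intro nn_integral_mono)
      fix q
      obtain p where p: "p \<in> P" "q \<in> N p" using P(2) by blast
      have "?g i q = ?g i q * indicator (N p) q" using p by simp
      also have "\<dots> \<le> (\<Sum>p\<in>P. ?g i q * indicator (N p) q)"
        by (rule member_le_sum[OF p(1)]) (use P(1) in auto)
      finally show "?g i q \<le> (\<Sum>p\<in>P. ?g i q * indicator (N p) q)" .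
    qed
    also have "\<dots> = (\<Sum>p\<in>P. \<integral>\<^sup>+q. ?g i q * indicator (N p) q \<partial>?M)"
    proof (rule nn_integral_sum)
      fix p
      show "(\<lambda>q. ?g i q * indicator (N p) q) \<in> borel_measurable ?M"
        unfolding mM using openN[of p]
        by (intro borel_measurable_times_ennreal gm borel_measurable_indicator) auto
    qed
    also have "\<dots> \<le> (\<Sum>p\<in>P. ennreal (D p) * (\<integral>\<^sup>+x\<in>ball (a p) (R p / 8). ?g i (cinv (c p) x) \<partial>lborel))"
      by (intro sum_mono D gm)
    finally show ?thesis .
  qed
  have "(\<lambda>i. \<Sum>p\<in>P. ennreal (D p) * (\<integral>\<^sup>+x\<in>ball (a p) (R p / 8). ?g i (cinv (c p) x) \<partial>lborel))
      \<longlonglongrightarrow> (\<Sum>p\<in>P. ennreal (D p) * 0)"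
    by (intro tendsto_sum ennreal_tendsto_cmult lim) auto
  then have "(\<lambda>i. \<Sum>p\<in>P. ennreal (D p) * (\<integral>\<^sup>+x\<in>ball (a p) (R p / 8). ?g i (cinv (c p) x) \<partial>lborel))
      \<longlonglongrightarrow> 0" by simp
  then have lim0: "(\<lambda>i. \<integral>\<^sup>+q. ?g i q \<partial>?M) \<longlonglongrightarrow> 0"
    by (rule tendsto_sandwich[OF always_eventually always_eventually tendsto_const, rotated 2])
      (simp_all only: zero_le bound simp_thms)
  show ?thesis by (rule exI[of _ r], rule conjI[OF r lim0])
qed

end

theorem theorem4p40:
  fixes A :: "('a::t2_space, 'n::finite) chart set"
    and I :: "'i set" and V :: "'i \<Rightarrow> 'a set" and g :: "'i \<Rightarrow> 'i \<Rightarrow> 'a \<Rightarrow> complex"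
    and s :: "'i \<Rightarrow> 'a \<Rightarrow> complex" and h :: "'i \<Rightarrow> 'a \<Rightarrow> real" and D :: "'a set"
    and \<omega>K \<omega>sr \<theta> \<mu> \<Theta> :: "('a, 'n) form" and \<omega>\<theta> :: "real \<Rightarrow> ('a, 'n) form"
    and \<beta> \<eta> :: real and \<phi> F :: "real \<Rightarrow> 'a \<Rightarrow> real" and s2 :: "'a \<Rightarrow> real"
  assumes X: "compact_complex_manifold A" and "kahler_form A \<omega>K"
    and aut: "\<forall>f. automorphism A f \<longrightarrow> f = id"
    and L_D: "line_bundle A I V g" "holomorphic_section A I V g s" "hermitian_metric A I V g h"
    and D: "smooth_hypersurface A I V s D"
    and "\<Theta> = curvature_form A I V h" "semipositive A \<Theta>"
    and "s2 = section_norm2 I V s h"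
    and "0 < \<beta>" "\<beta> \<le> 1"
    and theta: "closed11 A \<theta>" "\<theta> \<in> cls A (form_lin 1 (ricci_form A \<omega>K) (- (1 - \<beta>)) \<Theta>)"
    and mu: "smooth_volume_form A \<mu>" "volume_curvature A \<mu> = form_lin 1 \<theta> (1 - \<beta>) \<Theta>"
    and Omega: "closed11 A \<omega>sr" "big A \<omega>K \<omega>sr" "nef A \<omega>K \<omega>sr"
    and ref: "\<forall>\<epsilon>>0. reference_metric A \<omega>K \<omega>sr \<mu> s2 \<beta> \<epsilon> (\<omega>\<theta> \<epsilon>)"
    and i: "0 \<le> \<eta>"
      "ereal \<eta> < ereal ((real CARD('n) + 1) / real CARD('n)) * log_alpha A \<omega>K \<omega>sr s2 \<beta>"
    and ii: "kahler_class A (cls A (form_lin \<eta> \<omega>sr (-1) \<theta>))"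
    and iii: "kahler_class A
      (cls A (form_lin (- average_trace A \<theta> \<omega>sr + \<eta>) \<omega>sr (real CARD('n) - 1) \<theta>))"
    and approx: "\<forall>\<^sub>F \<epsilon> in at_right 0. approx_cscK A \<omega>K \<omega>sr \<theta> \<omega>\<theta> \<epsilon> (\<phi> \<epsilon>) (F \<epsilon>)"
  shows "\<exists>\<psi>. singular_cscK A \<omega>K \<omega>sr \<theta> \<omega>\<theta> \<psi>"
proof -
  have \<omega>K: "closed11 A \<omega>K" using \<open>kahler_form A \<omega>K\<close> by (simp add: kahler_form_def)
  have \<omega>sr: "closed11 A \<omega>sr" by (rule Omega(1))
  obtain b where b: "b > 0" "\<And>\<epsilon>. 0 < \<epsilon> \<Longrightarrow> \<epsilon> < b \<Longrightarrow> approx_cscK A \<omega>K \<omega>sr \<theta> \<omega>\<theta> \<epsilon> (\<phi> \<epsilon>) (F \<epsilon>)"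
    using approx unfolding eventually_at_right_field by (elim exE conjE) (rule that, assumption, simp)
  \<comment> \<open>A null sequence in the range \<open>{0<..<b}\<close> of the hypothesis that is also bounded by one, which
    keeps the constants in the charts independent of the index.\<close>
  define e where "e = (\<lambda>i::nat. min 1 b / (real i + 2))"
  have e: "0 < e i" "e i < b" "e i \<le> 1" for i
  proof -
    have "e i \<le> min 1 b / 2"
      unfolding e_def using b(1) by (intro divide_left_mono) auto
    then show "e i < b" "e i \<le> 1" using b(1) by (auto simp: min_def split: if_splits)
    show "0 < e i" using b(1) by (simp add: e_def)
  qed
  have e0: "e \<longlonglongrightarrow> 0"
  proof -
    have "(\<lambda>i. min 1 b * (1 / (real (i + 1) + 1))) \<longlonglongrightarrow> min 1 b * 0"
      by (intro tendsto_mult tendsto_const LIMSEQ_ignore_initial_segment[where f = "\<lambda>i. 1 / (real i + 1)"])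
        (use LIMSEQ_inverse_real_of_nat in \<open>simp add: inverse_eq_divide add.commute\<close>)
    then show ?thesis by (simp add: e_def[abs_def] add.commute)
  qed
  have app: "approx_cscK A \<omega>K \<omega>sr \<theta> \<omega>\<theta> (e i) (\<phi> (e i)) (F (e i))" for i
    by (rule b(2)[OF e(1,2)])
  have "\<exists>p. \<forall>q. \<phi> (e i) q \<le> \<phi> (e i) p" for i
  proof -
    have "compact (UNIV :: 'a set)" using X by (simp add: compact_complex_manifold_def)
    moreover have "continuous_on UNIV (\<phi> (e i))"
      by (rule smooth_fun_continuous[OF X conjunct1[OF app[unfolded approx_cscK_def]]])
    ultimately show ?thesis using continuous_attains_sup[of UNIV "\<phi> (e i)"] by auto
  qed
  then have "\<forall>i. \<exists>p. \<forall>q. \<phi> (e i) q \<le> \<phi> (e i) p" by (rule allI)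
  from choice[OF this] obtain pt where pt': "\<forall>i. \<forall>q. \<phi> (e i) q \<le> \<phi> (e i) (pt i)" ..
  have pt: "\<phi> (e i) q \<le> \<phi> (e i) (pt i)" for i q using pt' by (elim allE)
  \<comment> \<open>Normalised to have maximum zero, attained at \<open>pt i\<close>.\<close>
  define \<psi> where "\<psi> = (\<lambda>i p. \<phi> (e i) p + (- \<phi> (e i) (pt i)))"
  have app\<psi>: "approx_cscK A \<omega>K \<omega>sr \<theta> \<omega>\<theta> (e i) (\<psi> i) (F (e i))" for i
    unfolding \<psi>_def by (rule approx_cscK_add_const[OF app])
  have smooth: "smooth_fun_on A UNIV (\<psi> i)"
    and kahler: "kahler_form A (potential_form A \<omega>K \<omega>sr (e i) (\<psi> i))" for i
    using app\<psi>[of i] by (simp_all only: approx_cscK_def simp_thms)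
  have \<psi>0: "\<psi> i (pt i) = 0" and neg: "\<psi> i p \<le> 0" for i p
    using pt[of i p] by (auto simp: \<psi>_def)
  obtain s' p0 where s': "strict_mono s'"
    and p0: "\<And>N. open N \<Longrightarrow> p0 \<in> N \<Longrightarrow> \<forall>\<^sub>F i in sequentially. pt (s' i) \<in> N"
  proof (rule compact_cluster_subsequence[OF X, where pt = pt])
    fix r p assume "strict_mono r" "\<And>N. open N \<Longrightarrow> p \<in> N \<Longrightarrow> \<forall>\<^sub>F i in sequentially. pt (r i) \<in> N"
    then show thesis by (rule that)
  qed
  have norm: "normalized_potentials A \<omega>K \<omega>sr (\<lambda>i. e (s' i)) (\<lambda>i. \<psi> (s' i))"
    unfolding normalized_potentials_def
    by (intro allI conjI) (use e neg smooth kahler in simp_all)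
  have p0': "\<forall>\<^sub>F i in sequentially. \<exists>q\<in>N. \<psi> (s' i) q = 0" if "open N" "p0 \<in> N" for N
    using p0[OF that] by eventually_elim (rule bexI, rule \<psi>0)
  obtain r where r: "strict_mono r"
    and L1: "(\<lambda>i. \<integral>\<^sup>+p. e2ennreal \<bar>ereal (\<psi> (s' (r i)) p) - upper_limit (\<lambda>i. \<psi> (s' (r i))) p\<bar>
      \<partial>form_measure A (wpow A \<omega>K CARD('n))) \<longlonglongrightarrow> 0"
  proof -
    have "\<exists>r. strict_mono r \<and> (\<lambda>i. \<integral>\<^sup>+p. e2ennreal \<bar>ereal (\<psi> (s' (r i)) p)
        - upper_limit (\<lambda>i. \<psi> (s' (r i))) p\<bar> \<partial>form_measure A (wpow A \<omega>K CARD('n))) \<longlonglongrightarrow> 0"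
      by (rule potentials_L1_compactness[OF X \<omega>K \<omega>sr norm p0'])
    then show ?thesis by (elim exE conjE) (rule that)
  qed
  let ?\<psi> = "\<lambda>i. \<psi> (s' (r i))"
  have "strict_mono (s' \<circ> r)" using s' r by (rule strict_mono_o)
  then have e0': "(\<lambda>i. e (s' (r i))) \<longlonglongrightarrow> 0"
    using LIMSEQ_subseq_LIMSEQ[OF e0] by (simp add: o_def)
  \<comment> \<open>The maximum points accumulate at \<open>p0\<close>, so the upper limit does not degenerate to \<open>-\<infinity>\<close> there.\<close>
  have "0 \<le> upper_limit ?\<psi> p0"
  proof (rule upper_limit_ge)
    fix N assume "open N" "p0 \<in> N"
    then have "\<forall>\<^sub>F i in sequentially. pt (s' (r i)) \<in> N"
      by (intro eventually_subseq[OF r] p0)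
    then have "\<forall>\<^sub>F i in sequentially. \<exists>q\<in>N. 0 \<le> ereal (?\<psi> i q)"
    proof eventually_elim
      case (elim i)
      then show ?case by (rule bexI[rotated]) (simp add: \<psi>0)
    qed
    then show "\<exists>\<^sub>F i in sequentially. \<exists>q\<in>N. 0 \<le> ereal (?\<psi> i q)"
      by (rule eventually_frequently[rotated]) simp
  qed
  then have "upper_limit ?\<psi> p0 \<noteq> - \<infinity>" by auto
  then have ne: "\<exists>p. upper_limit ?\<psi> p \<noteq> - \<infinity>" by blast
  have "upper_limit ?\<psi> \<in> PSH A \<omega>sr"
  proof (rule upper_limit_PSH[OF X \<omega>K \<omega>sr _ e0' _ _ _ ne])
    show "0 < e (s' (r i))" "?\<psi> i p \<le> 0" for i p by (rule e(1), rule neg)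
    show "smooth_fun_on A UNIV (?\<psi> i)"
      "kahler_form A (potential_form A \<omega>K \<omega>sr (e (s' (r i))) (?\<psi> i))" for i
      by (rule smooth, rule kahler)
  qed
  moreover have "\<exists>(\<epsilon> :: nat \<Rightarrow> real) \<psi> F. (\<forall>i. \<epsilon> i > 0) \<and> \<epsilon> \<longlonglongrightarrow> 0 \<and>
        (\<forall>i. approx_cscK A \<omega>K \<omega>sr \<theta> \<omega>\<theta> (\<epsilon> i) (\<psi> i) (F i)) \<and>
        (\<lambda>i. \<integral>\<^sup>+p. e2ennreal \<bar>ereal (\<psi> i p) - upper_limit ?\<psi> p\<bar> \<partial>form_measure A (wpow A \<omega>K CARD('n)))
          \<longlonglongrightarrow> 0"
  proof (rule exI[of _ "\<lambda>i. e (s' (r i))"], rule exI[of _ ?\<psi>], rule exI[of _ "\<lambda>i. F (e (s' (r i)))"],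
      intro conjI allI)
    show "0 < e (s' (r i))" for i by (rule e(1))
    show "approx_cscK A \<omega>K \<omega>sr \<theta> \<omega>\<theta> (e (s' (r i))) (?\<psi> i) (F (e (s' (r i))))" for i
      by (rule app\<psi>)
  qed (rule e0' L1)+
  ultimately have "singular_cscK A \<omega>K \<omega>sr \<theta> \<omega>\<theta> (upper_limit ?\<psi>)"
    unfolding singular_cscK_def by (rule conjI)
  then show ?thesis by (rule exI[of _ "upper_limit ?\<psi>"])
qed

end
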